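(* Let $r,s\in\mathbb{C}^*$ be roots of unity with $r^2\neq s^2$. Suppose $\mathcal{N}$ is a simple $\mathcal{B}$-module that is $X_1$-torsionfree and $X_3$-torsionfree. Then $\mathcal{N}$ is isomorphic to exactly one of the following (types of) simple $\mathcal{B}$-modules: (1) $\mathcal{M}_1(\lambda)$ for some $\lambda=(\lambda_1,\lambda_2,\lambda_3,\lambda_4)\in(\mathbb{C}^* )^3\times\mathbb{C}$ with $\lambda_4\neq\frac{s^2(r^2-s^2)}{1-rs^{-1}}\lambda_3$, if $\mathcal{N}$ is $\tilde X$-torsionfree and $X_2$-torsionfree; (2) $\mathcal{M}_2(\mu)$ for some $\mu=(\mu_1,\mu_2,\mu_3)\in(\mathbb{C}^* )^2\times\mathbb{C}$, if $\mathcal{N}$ is $\tilde X$-torsionfree and $X_2$-torsion; (3) $\mathcal{M}_3(\epsilon)$ for some $\epsilon=(\epsilon_1,\epsilon_2,\epsilon_3)\in(\mathbb{C}^* )^3$, if $\mathcal{N}$ is $\tilde X$-torsion.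
   Context: $\mathcal{B}$ is the $\mathbb{C}$-algebra generated by $X_1,X_2,X_3,\tilde W$ with defining relations $$\tilde WX_1=r^{-2}X_1\tilde W,\quad X_2X_1=s^{-2}X_1X_2,\quad X_3X_1=(rs)^{-2}X_1X_3,\quad X_3X_2=(rs)^{-1}X_2X_3,$$ $$\tilde WX_3=rsX_3\tilde W,\quad \tilde WX_2=X_2\tilde W+s^2(r^2-s^2)X_3X_1.$$ (It is a subalgebra of the two-parameter quantized algebra $U^+_{r,s}(B_2)$.) Put $\tilde X=\tilde WX_2-\frac{s^2(r^2-s^2)}{1-rs^{-1}}X_3X_1$, a normal element of $\mathcal{B}$. All modules are right modules; $\operatorname{ord}(z)$ is the multiplicative order of $z$. For $x\in\mathcal{B}$, a module is $x$-torsionfree if no nonzero vector is annihilated by a power of $x$, and $x$-torsion if every vector is annihilated by a power of $x$. $\mathcal{M}_1(\lambda)$: put $m_1=\operatorname{ord}(rs^{-1})$, and $\ell_1=\operatorname{ord}(r^2s^2)$ if $\operatorname{ord}(s^2)\mid\operatorname{ord}(r^2s^2)\operatorname{ord}(rs^{-1})$, $\ell_1=2\operatorname{ord}(r^2s^2)$ otherwise. Basis $\{e(a,b): 0\le a\le\ell_1-1,\ 0\le b\le m_1-1\}$; action ($\oplus$ modulo $\ell_1$) $$e(a,b)X_1=s^{-2b}\lambda_1e(a\oplus1,b),\qquad e(a,b)X_2=\begin{cases}\lambda_2e(a,b+1),&b\neq m_1-1,\\ s^{2am_1}\lambda_2e(a,0),&b=m_1-1,\end{cases}$$ $$e(a,b)X_3=(rs)^{2a+b}\lambda_1^{-1}\lambda_3e(a\oplus(-1),b),$$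 $$e(a,b)\tilde W=\begin{cases}\lambda_2^{-1}(rs)^{2a}\left(\lambda_4-s^2(r^2-s^2)\frac{1-(rs^{-1})^b}{1-rs^{-1}}\lambda_3\right)e(a,b-1),&b\neq0,\\ \lambda_2^{-1}\lambda_4r^{2a}s^{-2a(m_1-1)}e(a,m_1-1),&b=0.\end{cases}$$ $\mathcal{M}_2(\mu)$: put $\ell_2=\operatorname{ord}(r^2s^2)$, and $m_2=\operatorname{ord}(rs^{-1})$ if $\operatorname{ord}(r^2)\mid\operatorname{ord}(r^2s^2)\operatorname{ord}(rs^{-1})$ or $\mu_3=0$, $m_2=2\operatorname{ord}(rs^{-1})$ otherwise. Basis $\{e(a,b):0\le a\le\ell_2-1,\ 0\le b\le m_2-1\}$; action ($\oplus$ modulo $\ell_2$) $$e(a,b)X_1=r^{-2b}\mu_1e(a\oplus1,b),\qquad e(a,b)X_2=\begin{cases}(rs)^{2a}s^2(r^2-s^2)\frac{1-(r^{-1}s)^b}{1-r^{-1}s}\mu_2e(a,b-1),&b\neq0,\\0,&b=0,\end{cases}$$ $$e(a,b)X_3=(rs)^{2a+b}\mu_1^{-1}\mu_2e(a\oplus(-1),b),\qquad e(a,b)\tilde W=\begin{cases}e(a,b+1),&b\neq m_2-1,\\ r^{2am_2}\mu_3e(a,0),&b=m_2-1.\end{cases}$$ $\mathcal{M}_3(\epsilon)$: put $\ell=\operatorname{lcm}(\operatorname{ord}(rs),\operatorname{ord}(rs^{-1}))$. Basis $\{e(a):0\le a\le\ell-1\}$; action ($\oplus$ modulo $\ell$)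 $$e(a)X_1=\epsilon_1^2\epsilon_3\epsilon_2^{-1}\frac{1-rs^{-1}}{s^2(r^2-s^2)}s^{-2a}e(a\oplus2),\qquad e(a)X_2=\epsilon_1e(a\oplus1),$$ $$e(a)X_3=(rs)^a\epsilon_2e(a),\qquad e(a)\tilde W=\epsilon_1\epsilon_3(rs^{-1})^ae(a\oplus1).$$ *)

theory Defs
  imports
    "HOL-Library.Poly_Mapping"
    "HOL-Algebra.QuotRing"
    "HOL-Algebra.Algebraic_Closure_Type"
begin

section \<open>Right modules over a not necessarily commutative ring\<close>

text \<open>As for the library's record of modules, the fields \<open>mult\<close> and \<open>one\<close> inherited from
  \<^typ>\<open>'b ring\<close> carry no meaning.\<close>

record ('a, 'b) rmodule = "'b ring" +
  ract :: "['b, 'a] \<Rightarrow> 'b"  (infixl \<open>\<star>\<index>\<close> 70)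

locale right_module = R?: ring R + M?: abelian_group M
  for R :: "('a, 'r) ring_scheme" (structure) and M :: "('a, 'b, 'm) rmodule_scheme" (structure) +
  assumes ract_closed:
      "\<lbrakk>x \<in> carrier M; a \<in> carrier R\<rbrakk> \<Longrightarrow> x \<star>\<^bsub>M\<^esub> a \<in> carrier M"
    and ract_add_scalar:
      "\<lbrakk>x \<in> carrier M; a \<in> carrier R; b \<in> carrier R\<rbrakk> \<Longrightarrow>
        x \<star>\<^bsub>M\<^esub> (a \<oplus>\<^bsub>R\<^esub> b) = x \<star>\<^bsub>M\<^esub> a \<oplus>\<^bsub>M\<^esub> x \<star>\<^bsub>M\<^esub> b"
    and ract_add_vector:
      "\<lbrakk>x \<in> carrier M; y \<in> carrier M; a \<in> carrier R\<rbrakk> \<Longrightarrow>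
        (x \<oplus>\<^bsub>M\<^esub> y) \<star>\<^bsub>M\<^esub> a = x \<star>\<^bsub>M\<^esub> a \<oplus>\<^bsub>M\<^esub> y \<star>\<^bsub>M\<^esub> a"
    and ract_mult:
      "\<lbrakk>x \<in> carrier M; a \<in> carrier R; b \<in> carrier R\<rbrakk> \<Longrightarrow>
        x \<star>\<^bsub>M\<^esub> (a \<otimes>\<^bsub>R\<^esub> b) = (x \<star>\<^bsub>M\<^esub> a) \<star>\<^bsub>M\<^esub> b"
    and ract_one:
      "x \<in> carrier M \<Longrightarrow> x \<star>\<^bsub>M\<^esub> \<one>\<^bsub>R\<^esub> = x"

definition right_submodule ::
  "('a, 'r) ring_scheme \<Rightarrow> ('a, 'b, 'm) rmodule_scheme \<Rightarrow> 'b set \<Rightarrow> bool" where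
  "right_submodule R M H \<longleftrightarrow>
     additive_subgroup H M \<and> (\<forall>x\<in>H. \<forall>a\<in>carrier R. x \<star>\<^bsub>M\<^esub> a \<in> H)"

definition simple_right_module ::
  "('a, 'r) ring_scheme \<Rightarrow> ('a, 'b, 'm) rmodule_scheme \<Rightarrow> bool" where
  "simple_right_module R M \<longleftrightarrow>
     right_module R M \<and> carrier M \<noteq> {\<zero>\<^bsub>M\<^esub>} \<and>
     (\<forall>H. right_submodule R M H \<longrightarrow> H = {\<zero>\<^bsub>M\<^esub>} \<or> H = carrier M)"

definition rmodule_iso ::
  "('a, 'r) ring_scheme \<Rightarrow> ('a, 'b, 'm) rmodule_scheme \<Rightarrow> ('a, 'c, 'n) rmodule_scheme \<Rightarrow> bool" where
  "rmodule_iso R M N \<longleftrightarrow>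
     (\<exists>f. bij_betw f (carrier M) (carrier N) \<and>
        (\<forall>x\<in>carrier M. \<forall>y\<in>carrier M. f (x \<oplus>\<^bsub>M\<^esub> y) = f x \<oplus>\<^bsub>N\<^esub> f y) \<and>
        (\<forall>x\<in>carrier M. \<forall>a\<in>carrier R. f (x \<star>\<^bsub>M\<^esub> a) = f x \<star>\<^bsub>N\<^esub> a))"

definition torsionfree ::
  "('a, 'r) ring_scheme \<Rightarrow> ('a, 'b, 'm) rmodule_scheme \<Rightarrow> 'a \<Rightarrow> bool" where
  "torsionfree R M x \<longleftrightarrow>
     \<not> (\<exists>v\<in>carrier M. v \<noteq> \<zero>\<^bsub>M\<^esub> \<and> (\<exists>k::nat. v \<star>\<^bsub>M\<^esub> (x [^]\<^bsub>R\<^esub> k) = \<zero>\<^bsub>M\<^esub>))"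

definition torsion ::
  "('a, 'r) ring_scheme \<Rightarrow> ('a, 'b, 'm) rmodule_scheme \<Rightarrow> 'a \<Rightarrow> bool" where
  "torsion R M x \<longleftrightarrow>
     (\<forall>v\<in>carrier M. \<exists>k::nat. v \<star>\<^bsub>M\<^esub> (x [^]\<^bsub>R\<^esub> k) = \<zero>\<^bsub>M\<^esub>)"


section \<open>The free algebra on four generators\<close>

datatype gen = GX1 | GX2 | GX3 | GW

text \<open>The free monoid on the generators, written additively so that the convolution product of
  \<^theory>\<open>HOL-Library.Poly_Mapping\<close> applies: finitely supported functions from words to
  \<^typ>\<open>complex\<close> then form the free associative algebra.\<close>

datatype word = Word "gen list"

instantiation word :: monoid_add
begin

definition zero_word :: word where
  "zero_word = Word []"

fun plus_word :: "word \<Rightarrow> word \<Rightarrow> word" where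
  "plus_word (Word u) (Word v) = Word (u @ v)"

instance
proof
  fix a b c :: word
  show "a + b + c = a + (b + c)"
    by (cases a; cases b; cases c) simp
  show "0 + a = a" and "a + 0 = a"
    by (cases a; simp add: zero_word_def)+
qed

end

type_synonym free_alg = "word \<Rightarrow>\<^sub>0 complex"

definition free_gen :: "gen \<Rightarrow> free_alg" where
  "free_gen g = Poly_Mapping.single (Word [g]) 1"

definition free_const :: "complex \<Rightarrow> free_alg" where
  "free_const c = Poly_Mapping.single 0 c"


section \<open>The algebra \<open>B\<close>\<close>

text \<open>Each defining relation \<open>u = v\<close> is recorded as \<open>u - v\<close>.\<close>

definition relations_B :: "complex \<Rightarrow> complex \<Rightarrow> free_alg set" where
  "relations_B r s =
    (let X1 = free_gen GX1; X2 = free_gen GX2; X3 = free_gen GX3; W = free_gen GW in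
      { W * X1 - free_const (r powi (-2)) * (X1 * W),
        X2 * X1 - free_const (s powi (-2)) * (X1 * X2),
        X3 * X1 - free_const ((r * s) powi (-2)) * (X1 * X3),
        X3 * X2 - free_const ((r * s) powi (-1)) * (X2 * X3),
        W * X3 - free_const (r * s) * (X3 * W),
        W * X2 - (X2 * W + free_const (s^2 * (r^2 - s^2)) * (X3 * X1)) })"

definition ideal_B :: "complex \<Rightarrow> complex \<Rightarrow> free_alg set" where
  "ideal_B r s = Idl\<^bsub>ring_of_type_algebra\<^esub> (relations_B r s)"

definition alg_B :: "complex \<Rightarrow> complex \<Rightarrow> free_alg set ring" where
  "alg_B r s = ring_of_type_algebra Quot (ideal_B r s)"

definition class_B :: "complex \<Rightarrow> complex \<Rightarrow> free_alg \<Rightarrow> free_alg set" where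
  "class_B r s p = ideal_B r s +>\<^bsub>ring_of_type_algebra\<^esub> p"

definition gen_B :: "complex \<Rightarrow> complex \<Rightarrow> gen \<Rightarrow> free_alg set" where
  "gen_B r s g = class_B r s (free_gen g)"

definition Xtilde :: "complex \<Rightarrow> complex \<Rightarrow> free_alg set" where
  "Xtilde r s = class_B r s
     (free_gen GW * free_gen GX2
       - free_const (s^2 * (r^2 - s^2) / (1 - r * s powi (-1))) * (free_gen GX3 * free_gen GX1))"


section \<open>Modules given by the action of the generators on a basis\<close>

definition scale_pm :: "complex \<Rightarrow> ('i \<Rightarrow>\<^sub>0 complex) \<Rightarrow> ('i \<Rightarrow>\<^sub>0 complex)" where
  "scale_pm c v = Poly_Mapping.map ((*) c) v"

definition lin_ext :: "('j \<Rightarrow> ('i \<Rightarrow>\<^sub>0 complex)) \<Rightarrow> ('j \<Rightarrow>\<^sub>0 complex) \<Rightarrow> ('i \<Rightarrow>\<^sub>0 complex)" where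
  "lin_ext f v = (\<Sum>j\<in>Poly_Mapping.keys v. scale_pm (Poly_Mapping.lookup v j) (f j))"

text \<open>For a right action the leftmost letter of a word acts first.\<close>

fun word_act :: "(gen \<Rightarrow> 'i \<Rightarrow> ('i \<Rightarrow>\<^sub>0 complex)) \<Rightarrow> ('i \<Rightarrow>\<^sub>0 complex) \<Rightarrow> word \<Rightarrow> ('i \<Rightarrow>\<^sub>0 complex)" where
  "word_act T v (Word gs) = fold (\<lambda>g. lin_ext (T g)) gs v"

definition free_act ::
  "(gen \<Rightarrow> 'i \<Rightarrow> ('i \<Rightarrow>\<^sub>0 complex)) \<Rightarrow> ('i \<Rightarrow>\<^sub>0 complex) \<Rightarrow> free_alg \<Rightarrow> ('i \<Rightarrow>\<^sub>0 complex)" where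
  "free_act T v p = lin_ext (word_act T v) p"

text \<open>The vector space with basis \<open>I\<close>, where the generator \<open>g\<close> sends the basis vector \<open>i\<close> to
  \<open>T g i\<close>. An element of \<open>B\<close> is a coset in the free algebra and acts through an arbitrary
  representative; this is independent of the choice, and defines a module, when \<open>T\<close> satisfies the
  defining relations of \<open>B\<close>.\<close>

definition basis_module ::
  "'i set \<Rightarrow> (gen \<Rightarrow> 'i \<Rightarrow> ('i \<Rightarrow>\<^sub>0 complex)) \<Rightarrow> (free_alg set, 'i \<Rightarrow>\<^sub>0 complex) rmodule" where
  "basis_module I T =
    \<lparr>carrier = {v. Poly_Mapping.keys v \<subseteq> I}, monoid.mult = undefined, one = undefined,
     ring.zero = 0, add = (+),
     ract = (\<lambda>v c. free_act T v (SOME p. p \<in> c))\<rparr>"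


section \<open>The three families of modules\<close>

text \<open>Multiplicative order; the value is \<open>0\<close> if \<open>z\<close> is not a root of unity.\<close>

definition mult_ord :: "complex \<Rightarrow> nat" where
  "mult_ord z = (if \<exists>n>0. z ^ n = 1 then LEAST n. n > 0 \<and> z ^ n = 1 else 0)"

text \<open>Below \<open>Poly_Mapping.single i c\<close> is the vector \<open>c e(i)\<close>, and \<open>a \<oplus> (-1)\<close> modulo \<open>n\<close> is written
  \<open>(a + n - 1) mod n\<close>, so that the truncated subtraction on naturals is harmless.\<close>

definition m1 :: "complex \<Rightarrow> complex \<Rightarrow> nat" where
  "m1 r s = mult_ord (r * s powi (-1))"

definition l1 :: "complex \<Rightarrow> complex \<Rightarrow> nat" where
  "l1 r s =
    (if mult_ord (s^2) dvd mult_ord (r^2 * s^2) * mult_ord (r * s powi (-1))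
     then mult_ord (r^2 * s^2) else 2 * mult_ord (r^2 * s^2))"

fun act_M1 :: "complex \<Rightarrow> complex \<Rightarrow> complex \<times> complex \<times> complex \<times> complex \<Rightarrow>
    gen \<Rightarrow> nat \<times> nat \<Rightarrow> (nat \<times> nat \<Rightarrow>\<^sub>0 complex)" where
  "act_M1 r s (k1, k2, k3, k4) GX1 (a, b) =
     Poly_Mapping.single ((a + 1) mod l1 r s, b) (s powi (-2 * int b) * k1)"
| "act_M1 r s (k1, k2, k3, k4) GX2 (a, b) =
     (if b \<noteq> m1 r s - 1 then Poly_Mapping.single (a, b + 1) k2
      else Poly_Mapping.single (a, 0) (s ^ (2 * a * m1 r s) * k2))"
| "act_M1 r s (k1, k2, k3, k4) GX3 (a, b) =
     Poly_Mapping.single ((a + l1 r s - 1) mod l1 r s, b)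
       ((r * s) ^ (2 * a + b) * k1 powi (-1) * k3)"
| "act_M1 r s (k1, k2, k3, k4) GW (a, b) =
     (if b \<noteq> 0 then
        Poly_Mapping.single (a, b - 1)
          (k2 powi (-1) * (r * s) ^ (2 * a) *
           (k4 - s^2 * (r^2 - s^2) * ((1 - (r * s powi (-1)) ^ b) / (1 - r * s powi (-1))) * k3))
      else
        Poly_Mapping.single (a, m1 r s - 1)
          (k2 powi (-1) * k4 * r ^ (2 * a) * s powi (- 2 * int a * (int (m1 r s) - 1))))"

definition mod_M1 :: "complex \<Rightarrow> complex \<Rightarrow> complex \<times> complex \<times> complex \<times> complex \<Rightarrow>
    (free_alg set, nat \<times> nat \<Rightarrow>\<^sub>0 complex) rmodule" where
  "mod_M1 r s k = basis_module ({..<l1 r s} \<times> {..<m1 r s}) (act_M1 r s k)"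

definition params_M1 :: "complex \<Rightarrow> complex \<Rightarrow> (complex \<times> complex \<times> complex \<times> complex) set" where
  "params_M1 r s =
    {(k1, k2, k3, k4). k1 \<noteq> 0 \<and> k2 \<noteq> 0 \<and> k3 \<noteq> 0 \<and>
       k4 \<noteq> s^2 * (r^2 - s^2) / (1 - r * s powi (-1)) * k3}"

definition l2 :: "complex \<Rightarrow> complex \<Rightarrow> nat" where
  "l2 r s = mult_ord (r^2 * s^2)"

definition m2 :: "complex \<Rightarrow> complex \<Rightarrow> complex \<Rightarrow> nat" where
  "m2 r s u3 =
    (if mult_ord (r^2) dvd mult_ord (r^2 * s^2) * mult_ord (r * s powi (-1)) \<or> u3 = 0
     then mult_ord (r * s powi (-1)) else 2 * mult_ord (r * s powi (-1)))"

fun act_M2 :: "complex \<Rightarrow> complex \<Rightarrow> complex \<times> complex \<times> complex \<Rightarrow>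
    gen \<Rightarrow> nat \<times> nat \<Rightarrow> (nat \<times> nat \<Rightarrow>\<^sub>0 complex)" where
  "act_M2 r s (u1, u2, u3) GX1 (a, b) =
     Poly_Mapping.single ((a + 1) mod l2 r s, b) (r powi (-2 * int b) * u1)"
| "act_M2 r s (u1, u2, u3) GX2 (a, b) =
     (if b \<noteq> 0 then
        Poly_Mapping.single (a, b - 1)
          ((r * s) ^ (2 * a) * s^2 * (r^2 - s^2) *
           ((1 - (r powi (-1) * s) ^ b) / (1 - r powi (-1) * s)) * u2)
      else 0)"
| "act_M2 r s (u1, u2, u3) GX3 (a, b) =
     Poly_Mapping.single ((a + l2 r s - 1) mod l2 r s, b)
       ((r * s) ^ (2 * a + b) * u1 powi (-1) * u2)"
| "act_M2 r s (u1, u2, u3) GW (a, b) =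
     (if b \<noteq> m2 r s u3 - 1 then Poly_Mapping.single (a, b + 1) 1
      else Poly_Mapping.single (a, 0) (r ^ (2 * a * m2 r s u3) * u3))"

definition mod_M2 :: "complex \<Rightarrow> complex \<Rightarrow> complex \<times> complex \<times> complex \<Rightarrow>
    (free_alg set, nat \<times> nat \<Rightarrow>\<^sub>0 complex) rmodule" where
  "mod_M2 r s u =
     basis_module ({..<l2 r s} \<times> {..<m2 r s (snd (snd u))}) (act_M2 r s u)"

definition params_M2 :: "(complex \<times> complex \<times> complex) set" where
  "params_M2 = {(u1, u2, u3). u1 \<noteq> 0 \<and> u2 \<noteq> 0}"

definition l3 :: "complex \<Rightarrow> complex \<Rightarrow> nat" where
  "l3 r s = lcm (mult_ord (r * s)) (mult_ord (r * s powi (-1)))"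

fun act_M3 :: "complex \<Rightarrow> complex \<Rightarrow> complex \<times> complex \<times> complex \<Rightarrow>
    gen \<Rightarrow> nat \<Rightarrow> (nat \<Rightarrow>\<^sub>0 complex)" where
  "act_M3 r s (e1, e2, e3) GX1 a =
     Poly_Mapping.single ((a + 2) mod l3 r s)
       (e1^2 * e3 * e2 powi (-1) * ((1 - r * s powi (-1)) / (s^2 * (r^2 - s^2))) *
        s powi (-2 * int a))"
| "act_M3 r s (e1, e2, e3) GX2 a = Poly_Mapping.single ((a + 1) mod l3 r s) e1"
| "act_M3 r s (e1, e2, e3) GX3 a = Poly_Mapping.single a ((r * s) ^ a * e2)"
| "act_M3 r s (e1, e2, e3) GW a =
     Poly_Mapping.single ((a + 1) mod l3 r s) (e1 * e3 * (r * s powi (-1)) ^ a)"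

definition mod_M3 :: "complex \<Rightarrow> complex \<Rightarrow> complex \<times> complex \<times> complex \<Rightarrow>
    (free_alg set, nat \<Rightarrow>\<^sub>0 complex) rmodule" where
  "mod_M3 r s e = basis_module {..<l3 r s} (act_M3 r s e)"

definition params_M3 :: "(complex \<times> complex \<times> complex) set" where
  "params_M3 = {(e1, e2, e3). e1 \<noteq> 0 \<and> e2 \<noteq> 0 \<and> e3 \<noteq> 0}"

end

theory Submission
  imports Defs "HOL-Analysis.Continuum_Not_Denumerable"
begin

text \<open>By Amitsur's argument central elements act on a simple module by scalars. The algebra is
  finite over the central subalgebra generated by high powers of the generators, so commuting
  elements such as \<open>X3 X1\<close>, the normal element \<open>X\<close>-tilde and suitable powers of generators have a
  common eigenvector; the images of this vector under monomials in two generators span the module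
  and reproduce the formulas of one of the three families. Which family occurs is decided by
  whether \<open>X\<close>-tilde vanishes and whether \<open>X2\<close> is injective. Conversely, in each family the
  diagonal elements separate the basis vectors and the generators connect them, which gives
  simplicity; the torsion of \<open>X\<close>-tilde and \<open>X2\<close> tells the families apart.\<close>

section \<open>The action of the free algebra on a vector space with basis\<close>

text \<open>Nothing bounds the dimension of the given module, so scalars for central elements cannot
  come from a characteristic polynomial. Computations take place on representatives in the free
  algebra, modulo the ideal of the relators, without a basis of the quotient. Only W and X2 fail to
  commute up to a scalar. The constant \<tau> = \<gamma> / (1 - q) is the one for which
  \<open>xt\<close> = W X2 - \<tau> Z, with Z = X3 X1, commutes with both. So \<open>xt\<close> is
  zero or injective on a simple module, while Z is injective by the torsion hypotheses. On a common
  eigenvector of \<open>xt\<close> and Z both products W X2 and X2 W are scalars, which turns the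
  chain of vectors under one of the two into the basis of a model. As the models are simple, a
  nonzero homomorphism from a model to the module is bijective; neither linear independence nor a
  dimension is ever computed. The lengths \<open>l1\<close> and, for nonzero third parameter,
  \<open>m2\<close> are joint orders of two roots of unity: one is the ratio of eigenvalues of a
  diagonal element along the chain, the other the factor for moving a closed cycle of one generator
  past the other generator.\<close>

abbreviation (input) "single \<equiv> Poly_Mapping.single"
abbreviation (input) "keys \<equiv> Poly_Mapping.keys"
abbreviation (input) "lookup \<equiv> Poly_Mapping.lookup"

lemma poly_mapping_sum_single:
  "(\<Sum>k\<in>keys p. single k (lookup p k)) = p"
proof (rule poly_mapping_eqI)
  fix k
  show "lookup (\<Sum>k\<in>keys p. single k (lookup p k)) k
    = lookup p k"
    by (cases "k \<in> keys p")
      (auto simp: lookup_sum lookup_single when_def in_keys_iff)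
qed

text \<open>Every element is the sum of its monomials. The additive step carries no condition on
  supports, so any additive property reduces to monomials.\<close>

lemma poly_mapping_add_induct [case_names zero single add]:
  fixes p :: "'a \<Rightarrow>\<^sub>0 'b::comm_monoid_add"
  assumes "P 0" and "\<And>k c. P (single k c)" and "\<And>p q. P p \<Longrightarrow> P q \<Longrightarrow> P (p + q)"
  shows "P p"
proof -
  have "P (\<Sum>k\<in>A. single k (lookup p k))" if "finite A" for A
    using that by induction (auto intro: assms)
  from this[of "keys p"] show ?thesis
    by (simp add: poly_mapping_sum_single)
qed

section \<open>Scalar multiples and linear extension of maps on a basis\<close>

lemma lookup_scale_pm [simp]: "lookup (scale_pm c v) i = c * lookup v i"
  by (auto simp: scale_pm_def map.rep_eq when_def)

lemma scale_pm_add: "scale_pm c (v + w) = scale_pm c v + scale_pm c w"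
  by (rule poly_mapping_eqI) (simp add: lookup_add algebra_simps)

lemma scale_pm_add_left: "scale_pm (c + d) v = scale_pm c v + scale_pm d v"
  by (rule poly_mapping_eqI) (simp add: lookup_add algebra_simps)

lemma scale_pm_scale_pm [simp]: "scale_pm c (scale_pm d v) = scale_pm (c * d) v"
  by (rule poly_mapping_eqI) simp

lemma scale_pm_zero [simp]: "scale_pm 0 v = 0" "scale_pm c 0 = 0"
  by (rule poly_mapping_eqI, simp)+

lemma scale_pm_one [simp]: "scale_pm 1 v = v"
  by (rule poly_mapping_eqI) simp

lemma scale_pm_single [simp]: "scale_pm c (single i x) = single i (c * x)"
  by (rule poly_mapping_eqI) (simp add: lookup_single when_def)

lemma scale_pm_sum: "scale_pm c (sum f A) = (\<Sum>i\<in>A. scale_pm c (f i))"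
  by (induction A rule: infinite_finite_induct) (auto simp: scale_pm_add)

lemma scale_pm_uminus: "scale_pm (- c) v = - scale_pm c v"
  by (rule poly_mapping_eqI) simp

lemma scale_pm_diff: "scale_pm c (v - w) = scale_pm c v - scale_pm c w"
  by (rule poly_mapping_eqI) (simp add: lookup_minus algebra_simps)

lemma keys_scale_pm: "keys (scale_pm c v) \<subseteq> keys v"
  by (auto simp: in_keys_iff)

interpretation scale_pm: vector_space "scale_pm :: complex \<Rightarrow> ('i \<Rightarrow>\<^sub>0 complex) \<Rightarrow> _"
  by unfold_locales (auto simp: scale_pm_add scale_pm_add_left)

lemma lin_ext_superset:
  assumes "finite A" and "keys v \<subseteq> A"
  shows "lin_ext f v = (\<Sum>j\<in>A. scale_pm (lookup v j) (f j))"
  unfolding lin_ext_def by (rule sum.mono_neutral_left) (use assms in \<open>auto simp: in_keys_iff\<close>)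

lemma lin_ext_zero [simp]: "lin_ext f 0 = 0"
  by (simp add: lin_ext_def)

lemma lin_ext_single [simp]: "lin_ext f (single i c) = scale_pm c (f i)"
  by (cases "c = 0") (simp_all add: lin_ext_def)

lemma lin_ext_add: "lin_ext f (v + w) = lin_ext f v + lin_ext f w"
proof -
  let ?A = "keys v \<union> keys w"
  have "lin_ext f u = (\<Sum>j\<in>?A. scale_pm (lookup u j) (f j))"
    if "u \<in> {v, w, v + w}" for u
    by (rule lin_ext_superset) (use that Poly_Mapping.keys_add[of v w] in auto)
  then show ?thesis
    by (simp add: lookup_add scale_pm_add_left sum.distrib)
qed

lemma lin_ext_scale: "lin_ext f (scale_pm c v) = scale_pm c (lin_ext f v)"
  by (induction v rule: poly_mapping_add_induct) (simp_all add: scale_pm_add lin_ext_add)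

lemma lin_ext_fun_add: "lin_ext (\<lambda>j. f j + g j) v = lin_ext f v + lin_ext g v"
  by (simp add: lin_ext_def scale_pm_add sum.distrib)

lemma lin_ext_fun_scale: "lin_ext (\<lambda>j. scale_pm c (f j)) v = scale_pm c (lin_ext f v)"
  by (simp add: lin_ext_def scale_pm_sum mult.commute)

lemma lin_ext_uminus: "lin_ext f (- v) = - lin_ext f v"
  using lin_ext_add[of f v "- v"] by (simp add: eq_neg_iff_add_eq_0 add.commute)

lemma lin_ext_diff: "lin_ext f (v - w) = lin_ext f v - lin_ext f w"
  using lin_ext_add[of f v "- w"] by (simp add: lin_ext_uminus)

lemma keys_lin_ext:
  assumes "\<And>j. j \<in> keys v \<Longrightarrow> keys (f j) \<subseteq> I"
  shows "keys (lin_ext f v) \<subseteq> I"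
proof -
  have "keys (lin_ext f v) \<subseteq>
      (\<Union>j\<in>keys v. keys (scale_pm (lookup v j) (f j)))"
    unfolding lin_ext_def by (rule Poly_Mapping.keys_sum)
  with assms keys_scale_pm show ?thesis by fastforce
qed

section \<open>Scalars inside the free algebra\<close>

lemma free_const_zero [simp]: "free_const 0 = 0"
  and free_const_one [simp]: "free_const 1 = 1"
  by (simp_all add: free_const_def)

lemma free_const_add: "free_const (c + d) = free_const c + free_const d"
  and free_const_mult: "free_const (c * d) = free_const c * free_const d"
  and free_const_uminus: "free_const (- c) = - free_const c"
  and free_const_diff: "free_const (c - d) = free_const c - free_const d"
  by (simp_all add: free_const_def single_add mult_single single_uminus single_diff)

lemma free_const_times: "free_const c * p = scale_pm c p"
  by (simp add: free_const_def scale_pm_def mult_map_scale_conv_mult)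

lemma free_const_commute: "p * free_const c = free_const c * p"
  by (induction p rule: poly_mapping_add_induct)
    (simp_all add: free_const_def mult_single algebra_simps)

lemma free_const_left_commute: "p * (free_const c * q) = free_const c * (p * q)"
  by (simp add: free_const_commute flip: mult.assoc)

lemma free_const_mult_left: "free_const c * (free_const d * p) = free_const (c * d) * p"
  by (simp add: free_const_mult mult.assoc)

lemma scale_pm_mult_left: "scale_pm c p * q = scale_pm c (p * q)" for p q :: free_alg
  by (simp add: mult.assoc flip: free_const_times)

lemma scale_pm_mult_right: "p * scale_pm c q = scale_pm c (p * q)" for p q :: free_alg
  by (simp add: free_const_left_commute flip: free_const_times)

text \<open>Collects all scalars in front of words; an identity in the noncommutative algebra then
  becomes a linear identity between monomials.\<close>

lemmas free_alg_normalize = free_const_times scale_pm_mult_left scale_pm_mult_right scale_pm_add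
  scale_pm_diff scale_pm_uminus distrib_left distrib_right left_diff_distrib right_diff_distrib mult.assoc

section \<open>Words and free algebra elements acting on vectors\<close>

lemma word_act_plus: "word_act T v (u + w) = word_act T (word_act T v u) w"
  by (cases u; cases w) simp

lemma word_act_zero [simp]: "word_act T v 0 = v"
  by (simp add: zero_word_def)

lemma word_act_add: "word_act T (v + w) u = word_act T v u + word_act T w u"
proof -
  have "fold (\<lambda>g. lin_ext (T g)) gs (v + w) =
      fold (\<lambda>g. lin_ext (T g)) gs v + fold (\<lambda>g. lin_ext (T g)) gs w" for gs
    by (induction gs arbitrary: v w) (simp_all add: lin_ext_add)
  then show ?thesis by (cases u) simp
qed

lemma word_act_scale: "word_act T (scale_pm c v) u = scale_pm c (word_act T v u)"
proof -
  have "fold (\<lambda>g. lin_ext (T g)) gs (scale_pm c v) = scale_pm c (fold (\<lambda>g. lin_ext (T g)) gs v)" for gs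
    by (induction gs arbitrary: v) (simp_all add: lin_ext_scale)
  then show ?thesis by (cases u) simp
qed

lemma free_act_add: "free_act T v (p + q) = free_act T v p + free_act T v q"
  by (simp add: free_act_def lin_ext_add)

lemma free_act_diff: "free_act T v (p - q) = free_act T v p - free_act T v q"
  by (simp add: free_act_def lin_ext_diff)

lemma free_act_add_vector: "free_act T (v + w) p = free_act T v p + free_act T w p"
  using lin_ext_fun_add[of "word_act T v" "word_act T w" p]
  by (simp add: free_act_def word_act_add[abs_def])

lemma free_act_scale_vector: "free_act T (scale_pm c v) p = scale_pm c (free_act T v p)"
  using lin_ext_fun_scale[of c "word_act T v" p]
  by (simp add: free_act_def word_act_scale[abs_def])

lemma free_act_zero [simp]: "free_act T v 0 = 0"
  by (simp add: free_act_def)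

lemma free_act_zero_vector [simp]: "free_act T 0 p = 0"
  using free_act_scale_vector[of T 0 0 p] by simp

lemma free_act_one [simp]: "free_act T v 1 = v"
  by (simp add: free_act_def flip: single_one)

lemma free_act_const [simp]: "free_act T v (free_const c) = scale_pm c v"
  by (simp add: free_act_def free_const_def)

lemma free_act_gen [simp]: "free_act T v (free_gen g) = lin_ext (T g) v"
  by (simp add: free_act_def free_gen_def)

lemma free_act_mult: "free_act T v (p * q) = free_act T (free_act T v p) q"
proof (induction p rule: poly_mapping_add_induct)
  case (single k c)
  show ?case
  proof (induction q rule: poly_mapping_add_induct)
    case (single l d)
    show ?case
      by (simp add: free_act_def mult_single word_act_plus word_act_scale mult.commute)
  qed (simp_all add: free_act_add distrib_left)
qed (simp_all add: free_act_add free_act_add_vector distrib_right)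

text \<open>Words are products of letters, so a property of the action has to be verified on scalars
  and single generators only. Invariance of supports, kernels and homomorphisms is proved this
  way.\<close>

lemma free_alg_gen_induct [case_names const gen add mult]:
  assumes "\<And>c. P (free_const c)" and "\<And>g. P (free_gen g)"
    and "\<And>p q. P p \<Longrightarrow> P q \<Longrightarrow> P (p + q)" and "\<And>p q. P p \<Longrightarrow> P q \<Longrightarrow> P (p * q)"
  shows "P (p :: free_alg)"
proof (induction p rule: poly_mapping_add_induct)
  case zero
  show ?case using assms(1)[of 0] by simp
next
  case (single k c)
  obtain gs where k: "k = Word gs" by (cases k)
  have "P (single (Word gs) c)"
  proof (induction gs rule: rev_induct)
    case Nil
    show ?case using assms(1)[of c] by (simp add: free_const_def zero_word_def)
  next
    case (snoc g gs)
    have "single (Word (gs @ [g])) c = single (Word gs) c * free_gen g"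
      by (simp add: free_gen_def mult_single)
    with snoc assms(2,4) show ?case by simp
  qed
  then show ?case by (simp add: k)
qed (rule assms(3))

lemma keys_free_act:
  assumes "\<And>g i. i \<in> I \<Longrightarrow> keys (T g i) \<subseteq> I" and "keys v \<subseteq> I"
  shows "keys (free_act T v p) \<subseteq> I"
  using assms(2)
proof (induction p arbitrary: v rule: free_alg_gen_induct)
  case (const c)
  then show ?case using keys_scale_pm[of c v] by auto
next
  case (gen g)
  then show ?case using assms(1) by (auto intro!: keys_lin_ext)
next
  case (add p q)
  then show ?case using Poly_Mapping.keys_add[of "free_act T v p" "free_act T v q"]
    by (fastforce simp: free_act_add)
qed (auto simp: free_act_mult)

section \<open>The quotient algebra\<close>

lemma ring_free_alg: "ring (ring_of_type_algebra :: 'a::ring_1 ring)"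
proof -
  have "\<exists>y. x + y = 0" for x :: 'a
    using add.right_inverse by blast
  then show ?thesis
    unfolding ring_of_type_algebra_def using add.right_inverse
    by unfold_locales (auto simp: algebra_simps Units_def)
qed

lemma ring_of_type_algebra_simps [simp]:
  "carrier (ring_of_type_algebra :: 'a::ring_1 ring) = UNIV"
  "x \<otimes>\<^bsub>ring_of_type_algebra\<^esub> y = x * y"
  "x \<oplus>\<^bsub>ring_of_type_algebra\<^esub> y = x + y"
  "\<one>\<^bsub>ring_of_type_algebra\<^esub> = 1"
  "\<zero>\<^bsub>ring_of_type_algebra\<^esub> = 0"
  by (simp_all add: ring_of_type_algebra_def)

lemma a_inv_ring_of_type_algebra [simp]:
  "\<ominus>\<^bsub>ring_of_type_algebra\<^esub> x = - (x :: 'a::ring_1)"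
proof -
  interpret ring "ring_of_type_algebra :: 'a ring" by (rule ring_free_alg)
  show ?thesis
    by (rule minus_equality) simp_all
qed

section \<open>The ideal of relations and its cosets\<close>

lemma ideal_ideal_B: "ideal (ideal_B r s) ring_of_type_algebra"
  unfolding ideal_B_def by (rule ring.genideal_ideal[OF ring_free_alg]) simp

lemma relations_subset_ideal_B: "relations_B r s \<subseteq> ideal_B r s"
  unfolding ideal_B_def by (rule ring.genideal_self[OF ring_free_alg]) simp

lemma ring_alg_B: "ring (alg_B r s)"
  unfolding alg_B_def by (rule ideal.quotient_is_ring[OF ideal_ideal_B])

lemma class_B_ring_hom: "class_B r s \<in> ring_hom ring_of_type_algebra (alg_B r s)"
  unfolding alg_B_def class_B_def [abs_def] by (rule ideal.rcos_ring_hom[OF ideal_ideal_B])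

lemma class_B_closed [simp]: "class_B r s p \<in> carrier (alg_B r s)"
  and class_B_add: "class_B r s (p + q) = class_B r s p \<oplus>\<^bsub>alg_B r s\<^esub> class_B r s q"
  and class_B_mult: "class_B r s (p * q) = class_B r s p \<otimes>\<^bsub>alg_B r s\<^esub> class_B r s q"
  and class_B_one: "class_B r s 1 = \<one>\<^bsub>alg_B r s\<^esub>"
  using class_B_ring_hom[of r s] by (auto simp: ring_hom_def)

lemma carrier_alg_B: "carrier (alg_B r s) = range (class_B r s)"
  by (auto simp: alg_B_def class_B_def[abs_def] FactRing_def A_RCOSETS_def RCOSETS_def a_r_coset_def)

lemma class_B_pow: "class_B r s (p ^ k) = class_B r s p [^]\<^bsub>alg_B r s\<^esub> k"
proof -
  interpret ring "alg_B r s" by (rule ring_alg_B)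
  show ?thesis
    by (induction k) (simp_all add: class_B_one class_B_mult power_Suc2 del: power_Suc)
qed

lemma mem_class_B: "q \<in> class_B r s p \<longleftrightarrow> q - p \<in> ideal_B r s"
  unfolding class_B_def a_r_coset_def r_coset_def
  by (auto simp: algebra_simps) (metis add.commute diff_add_cancel)

lemma ideal_B_closed:
  shows "0 \<in> ideal_B r s"
    and "p \<in> ideal_B r s \<Longrightarrow> q \<in> ideal_B r s \<Longrightarrow> p + q \<in> ideal_B r s"
    and "p \<in> ideal_B r s \<Longrightarrow> - p \<in> ideal_B r s"
    and "p \<in> ideal_B r s \<Longrightarrow> p * q \<in> ideal_B r s"
    and "p \<in> ideal_B r s \<Longrightarrow> q * p \<in> ideal_B r s"
proof -
  interpret ideal "ideal_B r s" ring_of_type_algebra by (rule ideal_ideal_B)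
  show "0 \<in> ideal_B r s" using I_r_closed additive_subgroup.zero_closed[OF is_additive_subgroup] by simp
  show "p \<in> ideal_B r s \<Longrightarrow> q \<in> ideal_B r s \<Longrightarrow> p + q \<in> ideal_B r s" using additive_subgroup.a_closed[OF is_additive_subgroup, of p q] by simp
  show "p \<in> ideal_B r s \<Longrightarrow> - p \<in> ideal_B r s" using I_l_closed[of p "- 1"] by simp
  show "p \<in> ideal_B r s \<Longrightarrow> p * q \<in> ideal_B r s" using I_r_closed[of p q] by simp
  show "p \<in> ideal_B r s \<Longrightarrow> q * p \<in> ideal_B r s" using I_l_closed[of p q] by simp
qed

lemma ideal_B_diff: "p \<in> ideal_B r s \<Longrightarrow> q \<in> ideal_B r s \<Longrightarrow> p - q \<in> ideal_B r s"
  using ideal_B_closed(2)[of p r s "- q"] ideal_B_closed(3)[of q r s] by simp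

lemma class_B_eq_iff: "class_B r s p = class_B r s q \<longleftrightarrow> p - q \<in> ideal_B r s"
proof
  have "p \<in> class_B r s p" by (simp add: mem_class_B ideal_B_closed)
  moreover assume "class_B r s p = class_B r s q"
  ultimately show "p - q \<in> ideal_B r s" by (simp add: mem_class_B)
next
  assume pq: "p - q \<in> ideal_B r s"
  show "class_B r s p = class_B r s q"
  proof (rule Set.set_eqI)
    fix x
    show "x \<in> class_B r s p \<longleftrightarrow> x \<in> class_B r s q"
      using ideal_B_closed(2)[OF _ pq, of "x - p"]
        ideal_B_closed(2)[OF _ ideal_B_closed(3)[OF pq], of "x - q"]
      by (auto simp: mem_class_B)
  qed
qed

section \<open>Right modules over the algebra\<close>

text \<open>Horner evaluation at an element of the free algebra. The function \<open>poly\<close>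
  would require coefficients and argument in one commutative ring.\<close>

definition poly_ev :: "free_alg \<Rightarrow> complex poly \<Rightarrow> free_alg" where
  "poly_ev z p = fold_coeffs (\<lambda>a x. free_const a + z * x) p 0"

lemma poly_ev_0 [simp]: "poly_ev z 0 = 0"
  by (simp add: poly_ev_def)

lemma poly_ev_pCons [simp]: "poly_ev z (pCons a p) = free_const a + z * poly_ev z p"
  by (cases "p = 0 \<and> a = 0") (auto simp: poly_ev_def)

lemma poly_ev_add: "poly_ev z (p + q) = poly_ev z p + poly_ev z q"
  by (induction p q rule: poly_induct2) (simp_all add: free_const_add algebra_simps)

lemma poly_ev_smult: "poly_ev z (smult c p) = free_const c * poly_ev z p"
  by (induction p) (simp_all add: free_const_mult distrib_left free_const_left_commute)

text \<open>Multiplicativity survives in the noncommutative algebra because only powers of the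
  single element \<open>z\<close> and central scalars occur.\<close>

lemma poly_ev_mult: "poly_ev z (p * q) = poly_ev z p * poly_ev z q"
  by (induction p) (simp_all add: poly_ev_add poly_ev_smult distrib_right mult.assoc)

lemma poly_ev_linear: "poly_ev z [:- c, 1:] = z - free_const c"
  by (simp add: free_const_uminus)

lemma poly_ev_sum: "poly_ev z (sum f A) = (\<Sum>i\<in>A. poly_ev z (f i))"
  by (induction A rule: infinite_finite_induct) (simp_all add: poly_ev_add)

lemma poly_ev_monom: "poly_ev z (monom c n) = free_const c * z ^ n"
  by (induction n) (simp_all add: monom_0 monom_Suc free_const_left_commute)

section \<open>Scalars, differences and eigenvectors in a right module\<close>

locale alg_B_module =
  fixes r s :: complex and N :: "(free_alg set, 'v) rmodule"
  assumes right_module: "right_module (alg_B r s) N"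
begin

sublocale rm: right_module "alg_B r s" N
  by (rule right_module)

abbreviation V :: "'v set" where "V \<equiv> carrier N"

definition act :: "'v \<Rightarrow> free_alg \<Rightarrow> 'v"  (infixl "\<rhd>" 70) where
  "v \<rhd> p = v \<star>\<^bsub>N\<^esub> class_B r s p"

text \<open>The module record has no complex scalars; they act through the constants of the algebra.
  Hence a homomorphism of modules is automatically complex linear.\<close>

definition smul :: "complex \<Rightarrow> 'v \<Rightarrow> 'v" where
  "smul c v = v \<rhd> free_const c"

lemma act_closed [simp]: "v \<in> V \<Longrightarrow> v \<rhd> p \<in> V"
  by (simp add: act_def rm.ract_closed)

lemma act_mult: "v \<in> V \<Longrightarrow> v \<rhd> (p * q) = v \<rhd> p \<rhd> q"
  by (simp add: act_def class_B_mult rm.ract_mult)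

lemma act_one [simp]: "v \<in> V \<Longrightarrow> v \<rhd> 1 = v"
  by (simp add: act_def class_B_one rm.ract_one)

lemma act_add: "v \<in> V \<Longrightarrow> v \<rhd> (p + q) = v \<rhd> p \<oplus>\<^bsub>N\<^esub> v \<rhd> q"
  by (simp add: act_def class_B_add rm.ract_add_scalar)

lemma act_add_vector: "v \<in> V \<Longrightarrow> w \<in> V \<Longrightarrow> (v \<oplus>\<^bsub>N\<^esub> w) \<rhd> p = v \<rhd> p \<oplus>\<^bsub>N\<^esub> w \<rhd> p"
  by (simp add: act_def rm.ract_add_vector)

lemma zero_mem [simp]: "\<zero>\<^bsub>N\<^esub> \<in> V"
  by (rule rm.M.zero_closed)

lemma act_zero [simp]: assumes "v \<in> V" shows "v \<rhd> 0 = \<zero>\<^bsub>N\<^esub>"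
  using act_add[OF assms, of 0 0] assms by (metis act_closed add_0 rm.M.add.l_cancel_one')

lemma act_zero_vector [simp]: "\<zero>\<^bsub>N\<^esub> \<rhd> p = \<zero>\<^bsub>N\<^esub>"
  using act_add_vector[of "\<zero>\<^bsub>N\<^esub>" "\<zero>\<^bsub>N\<^esub>" p]
  by (metis act_closed zero_mem rm.M.add.l_cancel_one' rm.M.l_zero)

lemma act_eqI: "class_B r s p = class_B r s q \<Longrightarrow> v \<rhd> p = v \<rhd> q"
  by (simp add: act_def)

lemma smul_closed [simp]: "v \<in> V \<Longrightarrow> smul c v \<in> V"
  by (simp add: smul_def)

lemma smul_smul [simp]: "v \<in> V \<Longrightarrow> smul c (smul d v) = smul (c * d) v"
  by (simp add: smul_def mult.commute[of c d] free_const_mult act_mult)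

lemma smul_one [simp]: "v \<in> V \<Longrightarrow> smul 1 v = v"
  by (simp add: smul_def)

lemma smul_zero [simp]: "v \<in> V \<Longrightarrow> smul 0 v = \<zero>\<^bsub>N\<^esub>" "smul c \<zero>\<^bsub>N\<^esub> = \<zero>\<^bsub>N\<^esub>"
  by (simp_all add: smul_def)

lemma smul_add: "v \<in> V \<Longrightarrow> smul (c + d) v = smul c v \<oplus>\<^bsub>N\<^esub> smul d v"
  by (simp add: smul_def free_const_add act_add)

lemma act_smul [simp]: "v \<in> V \<Longrightarrow> smul c v \<rhd> p = smul c (v \<rhd> p)"
  by (simp add: smul_def free_const_commute flip: act_mult)

lemma act_const_mult: "v \<in> V \<Longrightarrow> v \<rhd> (free_const c * p) = smul c (v \<rhd> p)"
  by (simp add: smul_def flip: free_const_commute act_mult)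

lemma smul_eq_zero_iff [simp]: assumes "v \<in> V" shows "smul c v = \<zero>\<^bsub>N\<^esub> \<longleftrightarrow> c = 0 \<or> v = \<zero>\<^bsub>N\<^esub>"
proof (cases "c = 0")
  case False
  have "v = smul (inverse c) (smul c v)" using assms False by simp
  then show ?thesis using False by (metis smul_zero(2))
qed (use assms in simp)

text \<open>Differences are formed in the free algebra instead of in the module, so equations
  between vectors become annihilation statements that can be summed.\<close>

lemma act_diff_eq_zero_iff:
  assumes "v \<in> V" shows "v \<rhd> (p - q) = \<zero>\<^bsub>N\<^esub> \<longleftrightarrow> v \<rhd> p = v \<rhd> q"
proof -
  have "v \<rhd> p = v \<rhd> (p - q) \<oplus>\<^bsub>N\<^esub> v \<rhd> q"
    using act_add[OF assms, of "p - q" q] by simp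
  then show ?thesis
    by (metis act_closed assms rm.M.add.r_cancel_one' rm.M.l_zero)
qed

lemma act_sum_eq_zero:
  assumes "v \<in> V" and "\<And>i. i \<in> A \<Longrightarrow> v \<rhd> f i = \<zero>\<^bsub>N\<^esub>" shows "v \<rhd> sum f A = \<zero>\<^bsub>N\<^esub>"
  using assms(2)
  by (induction A rule: infinite_finite_induct) (simp_all add: assms(1) act_add)

text \<open>Closure under negation comes for free, since -v is v acted on by the constant
  -1.\<close>

lemma right_submoduleI:
  assumes "H \<subseteq> V" "\<zero>\<^bsub>N\<^esub> \<in> H" "\<And>v w. v \<in> H \<Longrightarrow> w \<in> H \<Longrightarrow> v \<oplus>\<^bsub>N\<^esub> w \<in> H"
    and "\<And>v p. v \<in> H \<Longrightarrow> v \<rhd> p \<in> H"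
  shows "right_submodule (alg_B r s) N H"
proof -
  have "\<ominus>\<^bsub>N\<^esub> v = smul (- 1) v" if "v \<in> V" for v
  proof -
    have "smul (- 1) v \<oplus>\<^bsub>N\<^esub> v = smul (- 1 + 1) v"
      using that by (subst smul_add) simp_all
    then show ?thesis using that rm.M.minus_equality by simp
  qed
  then have "\<ominus>\<^bsub>N\<^esub> v \<in> H" if "v \<in> H" for v
    using assms(1,4) that by (auto simp: smul_def)
  with assms have "additive_subgroup H N"
    by (intro additive_subgroupI rm.M.add.subgroupI) auto
  with assms(4) show ?thesis
    by (auto simp: right_submodule_def carrier_alg_B act_def)
qed

lemma submodule_act_closed:
  "right_submodule (alg_B r s) N H \<Longrightarrow> v \<in> H \<Longrightarrow> v \<rhd> p \<in> H"
  by (simp add: right_submodule_def act_def)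

lemma submodule_subset: "right_submodule (alg_B r s) N H \<Longrightarrow> H \<subseteq> V"
  by (auto simp: right_submodule_def dest: additive_subgroup.a_Hcarr)

text \<open>Since a polynomial \<open>p\<close> over the complex numbers splits, \<open>v \<rhd> p(z) = 0\<close> forces some proper
  partial product of linear factors to send \<open>v\<close> to an eigenvector; no finiteness of the dimension
  is needed.\<close>

lemma eigenvector_of_poly:
  assumes "S \<subseteq> V" and S: "\<And>v c. v \<in> S \<Longrightarrow> v \<rhd> (z - free_const c) \<in> S"
    and "p \<noteq> 0" "v \<in> S" "v \<noteq> \<zero>\<^bsub>N\<^esub>" "v \<rhd> poly_ev z p = \<zero>\<^bsub>N\<^esub>"
  obtains w c where "w \<in> S" "w \<noteq> \<zero>\<^bsub>N\<^esub>" "w \<rhd> z = smul c w"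
proof -
  have "\<exists>w\<in>S. w \<noteq> \<zero>\<^bsub>N\<^esub> \<and> (\<exists>c. w \<rhd> z = smul c w)"
    using assms(3-)
  proof (induction "degree p" arbitrary: p v rule: less_induct)
    case less
    have v: "v \<in> V" using less.prems assms(1) by auto
    show ?case
    proof (cases "degree p = 0")
      case True
      then obtain a where "p = [:a:]" by (rule degree_eq_zeroE)
      with less.prems v show ?thesis by (simp flip: smul_def)
    next
      case False
      then have "\<not> constant (poly p)" by (simp add: constant_degree)
      then obtain c where "poly p c = 0" using fundamental_theorem_of_algebra by blast
      then obtain q where p: "p = [:- c, 1:] * q" by (auto simp: poly_eq_0_iff_dvd elim: dvdE)
      show ?thesis
      proof (cases "v \<rhd> (z - free_const c) = \<zero>\<^bsub>N\<^esub>")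
        case True
        then have "v \<rhd> z = smul c v" using v by (simp add: act_diff_eq_zero_iff smul_def)
        with less.prems show ?thesis by blast
      next
        case ne: False
        have "q \<noteq> 0" using less.prems p by auto
        moreover from this have "degree q < degree p" unfolding p by (subst degree_mult_eq) auto
        moreover have "v \<rhd> (z - free_const c) \<rhd> poly_ev z q = \<zero>\<^bsub>N\<^esub>"
          using less.prems v unfolding p poly_ev_mult poly_ev_linear by (simp add: act_mult)
        ultimately show ?thesis using less.hyps[of q] ne S less.prems by blast
      qed
    qed
  qed
  with that show ?thesis by blast
qed

text \<open>The polynomial t^n - d sends \<open>z\<close> to an element killing \<open>v\<close>,
  and it is not zero because n > 0.\<close>

lemma eigenvector_of_power:
  assumes "S \<subseteq> V" and S: "\<And>v c. v \<in> S \<Longrightarrow> v \<rhd> (z - free_const c) \<in> S"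
    and "n > 0" "v \<in> S" "v \<noteq> \<zero>\<^bsub>N\<^esub>" "v \<rhd> z ^ n = smul d v"
  obtains w c where "w \<in> S" "w \<noteq> \<zero>\<^bsub>N\<^esub>" "w \<rhd> z = smul c w"
proof -
  let ?p = "monom 1 n + [:- d:]"
  have v: "v \<in> V" using assms(1,4) by auto
  have "degree ?p = n" using \<open>n > 0\<close> by (subst degree_add_eq_left) (simp_all add: degree_monom_eq)
  with \<open>n > 0\<close> have "?p \<noteq> 0" by auto
  moreover have "v \<rhd> poly_ev z ?p = \<zero>\<^bsub>N\<^esub>"
    using assms(6) v act_diff_eq_zero_iff[OF v, of "z ^ n" "free_const d"]
    by (simp add: poly_ev_add poly_ev_monom free_const_uminus smul_def)
  ultimately show ?thesis
    using eigenvector_of_poly[OF assms(1) S _ assms(4,5)] that by blast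
qed

end

section \<open>Simple modules: cyclic vectors, kernels of normal elements, central scalars\<close>

lemma finite_words_of_bounded_length: "finite (Word ` {gs. length gs \<le> k})"
proof -
  have "g \<in> {GX1, GX2, GX3, GW}" for g by (cases g) auto
  then have "finite (UNIV :: gen set)" by (metis UNIV_I finite.simps finite_subset subsetI)
  from finite_lists_length_le[OF this, of k] show ?thesis by simp
qed

locale simple_alg_B_module = alg_B_module +
  assumes simple: "simple_right_module (alg_B r s) N"
begin

lemma submodule_eq_carrier:
  "right_submodule (alg_B r s) N H \<Longrightarrow> v \<in> H \<Longrightarrow> v \<noteq> \<zero>\<^bsub>N\<^esub> \<Longrightarrow> H = V"
  using simple by (auto simp: simple_right_module_def)

lemma obtain_nonzero: obtains v where "v \<in> V" "v \<noteq> \<zero>\<^bsub>N\<^esub>"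
  using simple zero_mem by (auto simp: simple_right_module_def)

text \<open>The multiples of a nonzero vector form a nonzero submodule.\<close>

lemma cyclic:
  assumes "v \<in> V" "v \<noteq> \<zero>\<^bsub>N\<^esub>" "w \<in> V" obtains p where "w = v \<rhd> p"
proof -
  let ?H = "range (\<lambda>p. v \<rhd> p)"
  have "\<zero>\<^bsub>N\<^esub> \<in> ?H" using assms(1) by (metis act_zero rangeI)
  moreover have "v \<in> ?H" using assms(1) by (metis act_one rangeI)
  ultimately have "right_submodule (alg_B r s) N ?H"
    using assms(1) by (intro right_submoduleI) (auto simp flip: act_add act_mult)
  with \<open>v \<in> ?H\<close> assms(2) have "?H = V" by (intro submodule_eq_carrier)
  with assms(3) that show ?thesis by blast
qed

text \<open>If each generator passes \<open>z\<close> up to a scalar, the kernel of \<open>z\<close>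
  is a submodule. By simplicity \<open>z\<close> then acts injectively or as zero.\<close>

lemma normal_kernel:
  assumes "\<And>g. \<exists>c. class_B r s (free_gen g * z) = class_B r s (free_const c * (z * free_gen g))"
    and "v \<in> V" "v \<noteq> \<zero>\<^bsub>N\<^esub>" "v \<rhd> z = \<zero>\<^bsub>N\<^esub>" "w \<in> V"
  shows "w \<rhd> z = \<zero>\<^bsub>N\<^esub>"
proof -
  have stable: "v \<rhd> p \<rhd> z = \<zero>\<^bsub>N\<^esub>" if "v \<in> V" "v \<rhd> z = \<zero>\<^bsub>N\<^esub>" for v p
    using that
  proof (induction p arbitrary: v rule: free_alg_gen_induct)
    case (gen g)
    obtain c where "class_B r s (free_gen g * z) = class_B r s (free_const c * (z * free_gen g))"
      using assms(1) by blast
    then have "v \<rhd> (free_gen g * z) = v \<rhd> (free_const c * (z * free_gen g))" by (rule act_eqI)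
    with gen show ?case by (simp add: act_mult flip: smul_def)
  qed (simp_all add: act_add act_add_vector act_mult flip: smul_def)
  let ?H = "{v \<in> V. v \<rhd> z = \<zero>\<^bsub>N\<^esub>}"
  have "right_submodule (alg_B r s) N ?H"
    by (intro right_submoduleI) (auto simp: act_add_vector stable)
  then have "?H = V" using assms by (intro submodule_eq_carrier) auto
  with assms(5) show ?thesis by blast
qed

text \<open>Amitsur's argument: otherwise all \<open>z - c\<close> are invertible on \<open>N\<close>. As \<open>N\<close> has countable
  dimension, the uncountably many vectors \<open>v(z - c)\<^sup>-\<^sup>1\<close> are linearly dependent, and clearing
  denominators in a dependency gives a polynomial in \<open>z\<close> that kills \<open>v\<close>, hence an eigenvector.\<close>

lemma central_acts_as_scalar:
  assumes central: "\<And>g. class_B r s (free_gen g * z) = class_B r s (z * free_gen g)"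
  obtains c where "\<And>v. v \<in> V \<Longrightarrow> v \<rhd> z = smul c v"
proof (rule ccontr)
  assume "\<not> thesis"
  with that have notscalar: "\<exists>v\<in>V. v \<rhd> z \<noteq> smul c v" for c by blast
  have comm: "v \<rhd> p \<rhd> z = v \<rhd> z \<rhd> p" if "v \<in> V" for v p
    using that
  proof (induction p arbitrary: v rule: free_alg_gen_induct)
    case (gen g)
    with act_eqI[OF central, of v g] show ?case by (simp add: act_mult)
  qed (simp_all add: act_add act_add_vector act_mult flip: smul_def)
  have inj: "v \<rhd> (z - free_const c) \<noteq> \<zero>\<^bsub>N\<^esub>" if "v \<in> V" "v \<noteq> \<zero>\<^bsub>N\<^esub>" for v c
  proof
    assume 0: "v \<rhd> (z - free_const c) = \<zero>\<^bsub>N\<^esub>"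
    have "w \<rhd> (z - free_const c) = \<zero>\<^bsub>N\<^esub>" if "w \<in> V" for w
    proof (rule normal_kernel[OF _ \<open>v \<in> V\<close> \<open>v \<noteq> _\<close> 0 that])
      fix g
      have "class_B r s (free_gen g * (z - free_const c)) = class_B r s ((z - free_const c) * free_gen g)"
        using central[of g] by (simp add: class_B_eq_iff algebra_simps free_const_commute)
      then show "\<exists>d. class_B r s (free_gen g * (z - free_const c)) =
          class_B r s (free_const d * ((z - free_const c) * free_gen g))"
        by (intro exI[of _ 1]) simp
    qed
    then have "w \<rhd> z = smul c w" if "w \<in> V" for w
      using that by (simp add: act_diff_eq_zero_iff smul_def)
    with notscalar show False by blast
  qed
  obtain v where v: "v \<in> V" "v \<noteq> \<zero>\<^bsub>N\<^esub>" by (rule obtain_nonzero)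
  \<comment> \<open>The nonzero vector v(z - c) generates the module, so v = v(z - c)p for some p.
    Since \<open>z\<close> commutes with the action, v p takes the place of v(z - c)^(-1).\<close>
  have "\<exists>p. v \<rhd> p \<rhd> (z - free_const c) = v" for c
  proof -
    obtain p where p: "v = v \<rhd> (z - free_const c) \<rhd> p"
      using cyclic[OF _ inj[OF v] v(1)] v by auto
    have "v \<rhd> (p * (z - free_const c)) = v \<rhd> ((z - free_const c) * p)"
    proof -
      have "v \<rhd> (p * z - z * p) = \<zero>\<^bsub>N\<^esub>" using v comm by (simp add: act_diff_eq_zero_iff act_mult)
      moreover have "p * z - z * p = p * (z - free_const c) - (z - free_const c) * p"
        by (simp add: algebra_simps free_const_commute)
      ultimately show ?thesis using v by (simp add: act_diff_eq_zero_iff)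
    qed
    with p v show ?thesis by (auto simp: act_mult)
  qed
  then obtain f where f: "v \<rhd> f c \<rhd> (z - free_const c) = v" for c by metis
  have "\<exists>k. keys p \<subseteq> Word ` {gs. length gs \<le> k}" for p :: free_alg
  proof -
    define L where "L w = (case w of Word gs \<Rightarrow> length gs)" for w
    have "keys p \<subseteq> Word ` {gs. length gs \<le> Max (L ` keys p)}"
    proof
      fix w assume w: "w \<in> keys p"
      then have "L w \<le> Max (L ` keys p)" by (intro Max_ge) auto
      then show "w \<in> Word ` {gs. length gs \<le> Max (L ` keys p)}"
        by (cases w) (auto simp: L_def)
    qed
    then show ?thesis by blast
  qed
  then have "\<forall>x. \<exists>k. keys (f (complex_of_real x)) \<subseteq> Word ` {gs. length gs \<le> k}"
    by blast
  from choice[OF this] obtain k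
    where k: "keys (f (complex_of_real x)) \<subseteq> Word ` {gs. length gs \<le> k x}" for x
    by blast
  \<comment> \<open>Uncountably many parameters are sorted by a natural number, the word length
    occurring in \<open>f\<close>. One bound serves infinitely many of them and confines their
    \<open>f\<close> to a finite-dimensional space.\<close>
  obtain n where n: "infinite {x. k x = n}"
  proof -
    have "(\<Union>n. {x. k x = n}) = (UNIV :: real set)" by auto
    then have "\<exists>n. uncountable {x. k x = n}"
      using uncountable_UNIV_real countable_UN[of UNIV "\<lambda>n. {x. k x = n}"] by auto
    with that show ?thesis using countable_finite by blast
  qed
  let ?S = "complex_of_real ` {x. k x = n}"
  have inf: "infinite ?S" using n by (simp add: finite_image_iff inj_on_def)
  \<comment> \<open>Linear dependence concerns the set of values, so infinitely many parameters must
    give infinitely many values. If f c = f d, then (d - c) v f(c) = 0, against v f(c)(z - c) =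
    v.\<close>
  have inj_f: "inj_on f ?S"
  proof (rule inj_onI, rule ccontr)
    fix c d assume "f c = f d" "c \<noteq> d"
    let ?u = "v \<rhd> f c"
    have "?u \<rhd> (free_const d - free_const c) = \<zero>\<^bsub>N\<^esub>"
    proof -
      have "?u \<rhd> (z - free_const c) = ?u \<rhd> (z - free_const d)"
        using f[of c] f[of d] \<open>f c = f d\<close> by simp
      moreover have "free_const d - free_const c = (z - free_const c) - (z - free_const d)" by simp
      ultimately show ?thesis using v act_diff_eq_zero_iff[of ?u] by (metis act_closed)
    qed
    then have "smul (d - c) ?u = \<zero>\<^bsub>N\<^esub>" by (simp add: smul_def free_const_diff)
    with \<open>c \<noteq> d\<close> v have "?u = \<zero>\<^bsub>N\<^esub>" by simp
    with f[of c] v show False by simp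
  qed
  let ?T = "(\<lambda>w. single w (1::complex)) ` Word ` {gs. length gs \<le> n}"
  have "f ` ?S \<subseteq> scale_pm.span ?T"
  proof (rule image_subsetI)
    fix c assume "c \<in> ?S"
    then obtain x where x: "k x = n" "c = complex_of_real x" by blast
    have "(\<Sum>w\<in>keys (f c). scale_pm (lookup (f c) w) (single w 1))
        \<in> scale_pm.span ?T"
      by (intro scale_pm.span_sum scale_pm.span_scale scale_pm.span_base)
        (use k[of x] x in \<open>auto simp: image_iff\<close>)
    then show "f c \<in> scale_pm.span ?T" by (simp add: poly_mapping_sum_single)
  qed
  then have "scale_pm.dependent (f ` ?S)"
    using scale_pm.independent_span_bound[of ?T "f ` ?S"] inf inj_f finite_words_of_bounded_length[of n]
    by (auto simp: finite_image_iff)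
  then obtain t u where t: "finite t" "t \<subseteq> f ` ?S" "(\<Sum>q\<in>t. scale_pm (u q) q) = 0" "\<exists>q\<in>t. u q \<noteq> 0"
    unfolding scale_pm.dependent_explicit by blast
  obtain A where A: "A \<subseteq> ?S" "finite A" "t = f ` A"
    using finite_subset_image[OF t(1,2)] by blast
  have inj_A: "inj_on f A" using inj_f A(1) by (rule inj_on_subset)
  have dep: "(\<Sum>c\<in>A. free_const (u (f c)) * f c) = 0"
    using t(3) inj_A by (simp add: A(3) sum.reindex free_const_times)
  obtain c0 where c0: "c0 \<in> A" "u (f c0) \<noteq> 0" using t(4) A(3) by blast
  \<comment> \<open>\<open>L A\<close> is the common denominator and \<open>Q\<close> the numerator
    of the dependency. At \<open>c0\<close> every summand of \<open>Q\<close> but one vanishes, so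
    \<open>Q\<close> is not zero.\<close>
  define L where "L B = (\<Prod>c\<in>B. [:- c, 1:])" for B :: "complex set"
  define Q where "Q = (\<Sum>c\<in>A. smult (u (f c)) (L (A - {c})))"
  have "poly Q c0 = (\<Sum>c\<in>A. if c = c0 then u (f c) * poly (L (A - {c})) c0 else 0)"
    unfolding Q_def poly_sum
    by (rule sum.cong) (use c0(1) A(2) in \<open>auto simp: L_def poly_prod\<close>)
  also have "\<dots> = u (f c0) * poly (L (A - {c0})) c0" using c0(1) A(2) by simp
  also have "\<dots> \<noteq> 0" using c0(2) A(2) by (auto simp: L_def poly_prod)
  finally have "Q \<noteq> 0" by auto
  \<comment> \<open>On \<open>v\<close>, the product of \<open>f c\<close> with the full denominator
    acts as \<open>L (A - {c})\<close>. The terms with \<open>f\<close> cancel by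
    \<open>dep\<close>, which leaves -Q(z).\<close>
  have "v \<rhd> (\<Sum>c\<in>A. free_const (u (f c)) * f c * poly_ev z (L A)
      - free_const (u (f c)) * poly_ev z (L (A - {c}))) = \<zero>\<^bsub>N\<^esub>"
  proof (rule act_sum_eq_zero[OF v(1)])
    fix c assume "c \<in> A"
    then have "L A = [:- c, 1:] * L (A - {c})" using A(2) by (simp add: L_def prod.remove)
    then have "poly_ev z (L A) = (z - free_const c) * poly_ev z (L (A - {c}))"
      by (simp only: poly_ev_mult poly_ev_linear)
    then show "v \<rhd> (free_const (u (f c)) * f c * poly_ev z (L A)
      - free_const (u (f c)) * poly_ev z (L (A - {c}))) = \<zero>\<^bsub>N\<^esub>"
      using f[of c] v by (simp add: act_diff_eq_zero_iff mult.assoc act_mult flip: smul_def)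
  qed
  also have "(\<Sum>c\<in>A. free_const (u (f c)) * f c * poly_ev z (L A)
      - free_const (u (f c)) * poly_ev z (L (A - {c}))) = 0 - poly_ev z Q"
    by (simp add: sum_subtractf dep Q_def poly_ev_sum poly_ev_smult flip: sum_distrib_right)
  finally have "v \<rhd> poly_ev z Q = \<zero>\<^bsub>N\<^esub>" using v by (simp only: act_diff_eq_zero_iff) simp
  then obtain w c where "w \<in> V" "w \<noteq> \<zero>\<^bsub>N\<^esub>" "w \<rhd> z = smul c w"
    using eigenvector_of_poly[of V z Q v] v \<open>Q \<noteq> 0\<close> by auto
  then show False using inj[of w c] by (simp add: act_diff_eq_zero_iff smul_def)
qed

end

section \<open>Modules given on a basis\<close>

lemma basis_module_simps [simp]:
  "carrier (basis_module I T) = {v. keys v \<subseteq> I}"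
  "\<zero>\<^bsub>basis_module I T\<^esub> = 0"
  "v \<oplus>\<^bsub>basis_module I T\<^esub> w = v + w"
  by (simp_all add: basis_module_def)

lemma keys_add_subset:
  "keys v \<subseteq> I \<Longrightarrow> keys w \<subseteq> I \<Longrightarrow> keys (v + w) \<subseteq> I"
  using Poly_Mapping.keys_add[of v w] by blast

lemma free_act_eq_zero_of_basis:
  assumes "\<And>i. i \<in> I \<Longrightarrow> free_act T (single i 1) p = 0" and "keys v \<subseteq> I"
  shows "free_act T v p = 0"
proof -
  have "free_act T (\<Sum>i\<in>A. single i (lookup v i)) p = 0"
    if "finite A" "A \<subseteq> I" for A
    using that
  proof (induction A)
    case (insert i A)
    have "free_act T (single i (lookup v i)) p = 0"
      using assms(1)[of i] insert.prems
        free_act_scale_vector[of T "lookup v i" "single i 1" p]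
      by simp
    with insert show ?case by (simp add: free_act_add_vector)
  qed simp
  from this[of "keys v"] assms(2) show ?thesis
    by (simp add: poly_mapping_sum_single)
qed

text \<open>The conditions under which \<open>basis_module\<close> is well defined: the relators
  kill the basis vectors, so the representative picked by \<open>SOME\<close> does not
  matter.\<close>

locale basis_rep =
  fixes r s :: complex and I :: "'i set" and T :: "gen \<Rightarrow> 'i \<Rightarrow> ('i \<Rightarrow>\<^sub>0 complex)"
  assumes keys_T: "i \<in> I \<Longrightarrow> keys (T g i) \<subseteq> I"
    and relators: "p \<in> relations_B r s \<Longrightarrow> i \<in> I \<Longrightarrow> free_act T (single i 1) p = 0"
begin

text \<open>The elements acting as zero on the span of \<open>I\<close> form a two-sided ideal,
  since the span is invariant. This ideal contains the relators and therefore everything they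
  generate.\<close>

lemma free_act_ideal_B:
  assumes "p \<in> ideal_B r s" "keys v \<subseteq> I" shows "free_act T v p = 0"
proof -
  let ?J = "{p. \<forall>v. keys v \<subseteq> I \<longrightarrow> free_act T v p = 0}"
  interpret ring "ring_of_type_algebra :: free_alg ring" by (rule ring_free_alg)
  have "free_act T v (- p) = - free_act T v p" for v p
    using free_act_diff[of T v 0 p] by simp
  then have "ideal ?J ring_of_type_algebra"
    by (intro idealI ring_free_alg add.subgroupI)
      (auto simp: free_act_add free_act_mult keys_free_act[OF keys_T] simp flip: a_inv_def intro: exI[of _ 0])
  moreover have "relations_B r s \<subseteq> ?J"
    using free_act_eq_zero_of_basis[OF relators] by blast
  ultimately have "ideal_B r s \<subseteq> ?J"
    unfolding ideal_B_def by (rule genideal_minimal)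
  with assms show ?thesis by blast
qed

lemma ract_class_B:
  assumes "keys v \<subseteq> I"
  shows "v \<star>\<^bsub>basis_module I T\<^esub> class_B r s p = free_act T v p"
proof -
  have "p \<in> class_B r s p" by (simp add: mem_class_B ideal_B_closed)
  then have "(SOME q. q \<in> class_B r s p) \<in> class_B r s p" by (rule someI)
  then have "free_act T v ((SOME q. q \<in> class_B r s p) - p) = 0"
    using assms by (simp add: mem_class_B free_act_ideal_B)
  then show ?thesis by (simp add: basis_module_def free_act_diff)
qed

lemma right_module_basis_module: "right_module (alg_B r s) (basis_module I T)"
proof (intro right_module.intro right_module_axioms.intro ring_alg_B)
  have "\<exists>w. keys w \<subseteq> I \<and> w + v = 0" if "keys v \<subseteq> I" for v :: "'i \<Rightarrow>\<^sub>0 complex"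
    using that keys_scale_pm[of "- 1" v]
    by (intro exI[of _ "scale_pm (- 1) v"]) (simp add: scale_pm_uminus)
  then show "abelian_group (basis_module I T)"
    by (intro abelian_groupI)
      (auto simp: add.assoc add.commute dest: subsetD[OF Poly_Mapping.keys_add])
qed (auto simp: carrier_alg_B ract_class_B keys_free_act[OF keys_T] free_act_add free_act_add_vector
    free_act_mult keys_add_subset
    simp flip: class_B_add class_B_mult class_B_one del: subsetI)

sublocale alg_B_module r s "basis_module I T"
  by (rule alg_B_module.intro) (rule right_module_basis_module)

lemma act_eq_free_act: "keys v \<subseteq> I \<Longrightarrow> act v p = free_act T v p"
  by (simp add: act_def ract_class_B)

text \<open>A nonzero vector of minimal support in a submodule is a multiple of a basis vector, since
  otherwise some \<open>p - \<chi> i\<close> shrinks the support.\<close>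

lemma simple_basis_module:
  assumes "I \<noteq> {}"
    and separate: "\<And>i j. i \<in> I \<Longrightarrow> j \<in> I \<Longrightarrow> i \<noteq> j \<Longrightarrow> \<exists>p \<chi>. \<chi> i \<noteq> \<chi> j \<and>
        (\<forall>k\<in>I. free_act T (single k 1) p = single k (\<chi> k))"
    and transitive: "\<And>i j. i \<in> I \<Longrightarrow> j \<in> I \<Longrightarrow> \<exists>p c. c \<noteq> 0 \<and>
        free_act T (single i 1) p = single j c"
  shows "simple_right_module (alg_B r s) (basis_module I T)"
  unfolding simple_right_module_def
proof (intro conjI allI impI right_module_basis_module)
  obtain i where "i \<in> I" using \<open>I \<noteq> {}\<close> by blast
  then have "single i (1::complex) \<in> carrier (basis_module I T)"
    "single i (1::complex) \<noteq> 0"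
    using lookup_single_eq[of i "1::complex"] by (auto simp del: lookup_single_eq)
  then show "carrier (basis_module I T) \<noteq> {\<zero>\<^bsub>basis_module I T\<^esub>}" by auto
next
  fix H assume H: "right_submodule (alg_B r s) (basis_module I T) H"
  have HV: "H \<subseteq> {v. keys v \<subseteq> I}" using submodule_subset[OF H] by simp
  have Hact: "free_act T v p \<in> H" if "v \<in> H" for v p
    using submodule_act_closed[OF H that] HV that by (auto simp: act_eq_free_act)
  have H0: "0 \<in> H" and Hadd: "v + w \<in> H" if "v \<in> H" "w \<in> H" for v w
    using H additive_subgroup.zero_closed additive_subgroup.a_closed that
    unfolding right_submodule_def by fastforce+
  have H0: "0 \<in> H" using H additive_subgroup.zero_closed unfolding right_submodule_def by fastforce
  show "H = {\<zero>\<^bsub>basis_module I T\<^esub>} \<or> H = carrier (basis_module I T)"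
  proof (rule disjCI)
    assume "H \<noteq> carrier (basis_module I T)"
    have "v = 0" if "v \<in> H" for v
    proof (rule ccontr)
      assume "v \<noteq> 0"
      define P where "P v \<longleftrightarrow> v \<in> H \<and> v \<noteq> 0" for v
      have "P v" using that \<open>v \<noteq> 0\<close> by (simp add: P_def)
      from arg_min_natI[of P v "\<lambda>v. card (keys v)", OF this]
        arg_min_nat_le[of P _ "\<lambda>v. card (keys v)"]
      obtain w where "P w" and min: "\<And>u. P u \<Longrightarrow> card (keys w) \<le> card (keys u)"
        by blast
      then have w: "w \<in> H" "w \<noteq> 0" by (auto simp: P_def)
      have wI: "keys w \<subseteq> I" using w HV by auto
      have "keys w \<noteq> {}" using w by simp
      then obtain i where i: "i \<in> keys w" by blast
      have "keys w = {i}"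
      proof (rule ccontr)
        assume "keys w \<noteq> {i}"
        with i obtain j where j: "j \<in> keys w" "i \<noteq> j" by blast
        with i wI separate[of i j] obtain p \<chi> where sep: "\<chi> i \<noteq> \<chi> j"
          "\<And>k. k \<in> I \<Longrightarrow> free_act T (single k 1) p = single k (\<chi> k)"
          by blast
        let ?u = "free_act T w (p - free_const (\<chi> i))"
        have diag: "free_act T x p = (\<Sum>k\<in>keys x. single k (\<chi> k * lookup x k))"
          if "keys x \<subseteq> I" for x
        proof -
          have "free_act T (\<Sum>k\<in>A. single k (lookup x k)) p
              = (\<Sum>k\<in>A. single k (\<chi> k * lookup x k))"
            if "finite A" "A \<subseteq> I" for A
            using that
          proof (induction A)
            case (insert k A)
            have "free_act T (single k (lookup x k)) p =
                single k (\<chi> k * lookup x k)"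
              using free_act_scale_vector[of T "lookup x k" "single k 1" p]
                sep(2)[of k] insert.prems by (simp add: mult.commute)
            with insert show ?case by (simp add: free_act_add_vector)
          qed simp
          from this[of "keys x"] that show ?thesis
            by (simp add: poly_mapping_sum_single)
        qed
        have lk: "lookup (free_act T w p) k = \<chi> k * lookup w k" for k
          by (cases "k \<in> keys w")
            (simp_all add: diag[OF wI] lookup_sum lookup_single when_def in_keys_iff sum.delta)
        have lku: "lookup ?u k = (\<chi> k - \<chi> i) * lookup w k" for k
          by (simp add: free_act_diff lookup_minus lk algebra_simps)
        have "keys ?u \<subseteq> keys w - {i}" by (auto simp: in_keys_iff lku)
        with i have "card (keys ?u) < card (keys w)"
          by (intro psubset_card_mono) auto
        moreover have "lookup ?u j \<noteq> 0" using sep(1) j by (simp add: lku in_keys_iff)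
        then have "P ?u" using Hact[OF w(1)] by (auto simp: P_def)
        ultimately show False using min by fastforce
      qed
      then have w_eq: "w = single i (lookup w i)"
        using poly_mapping_sum_single[of w] by simp
      have iI: "i \<in> I" using i wI by auto
      have single: "single j x \<in> H" if j: "j \<in> I" for j x
      proof -
        obtain p c where pc: "c \<noteq> 0" "free_act T (single i 1) p = single j c"
          using transitive[OF iI j] by blast
        have "free_act T w (p * free_const (x / (c * lookup w i)))
            = scale_pm (x / (c * lookup w i)) (free_act T (scale_pm (lookup w i) (single i 1)) p)"
          using w_eq by (simp add: free_act_mult)
        also have "\<dots> = single j x"
          using pc i by (simp add: free_act_scale_vector in_keys_iff del: scale_pm_single)
            (simp add: in_keys_iff)
        finally show ?thesis using Hact[OF w(1)] by metis
      qed
      have "x \<in> H" if "keys x \<subseteq> I" for x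
      proof -
        have "(\<Sum>k\<in>A. single k (lookup x k)) \<in> H"
          if "finite A" "A \<subseteq> I" for A
          using that by (induction A) (auto intro: Hadd H0 single)
        from this[of "keys x"] that show ?thesis by (simp add: poly_mapping_sum_single)
      qed
      with HV have "H = carrier (basis_module I T)" by auto
      with \<open>H \<noteq> carrier (basis_module I T)\<close> show False by contradiction
    qed
    with H0 show "H = {\<zero>\<^bsub>basis_module I T\<^esub>}" by auto
  qed
qed

end

section \<open>Isomorphisms between a simple module and a model\<close>

lemma rmodule_iso_sym:
  assumes "right_module R M" "rmodule_iso R M N" shows "rmodule_iso R N M"
proof -
  interpret right_module R M by fact
  obtain f where f: "bij_betw f (carrier M) (carrier N)"
    "\<And>x y. x \<in> carrier M \<Longrightarrow> y \<in> carrier M \<Longrightarrow> f (x \<oplus>\<^bsub>M\<^esub> y) = f x \<oplus>\<^bsub>N\<^esub> f y"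
    "\<And>x a. x \<in> carrier M \<Longrightarrow> a \<in> carrier R \<Longrightarrow> f (x \<star>\<^bsub>M\<^esub> a) = f x \<star>\<^bsub>N\<^esub> a"
    using assms(2) unfolding rmodule_iso_def by blast
  let ?g = "inv_into (carrier M) f"
  have g: "?g y \<in> carrier M" "f (?g y) = y" if "y \<in> carrier N" for y
    using f(1) that by (auto simp: bij_betw_def inv_into_into f_inv_into_f)
  have inv: "?g (f x) = x" if "x \<in> carrier M" for x
    using f(1) that by (simp add: bij_betw_inv_into_left)
  show ?thesis
    unfolding rmodule_iso_def
  proof (intro exI[of _ ?g] conjI ballI)
    show "bij_betw ?g (carrier N) (carrier M)" using f(1) by (rule bij_betw_inv_into)
  next
    fix x y assume "x \<in> carrier N" "y \<in> carrier N"
    with g f(2)[of "?g x" "?g y"] inv[of "?g x \<oplus>\<^bsub>M\<^esub> ?g y"]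
    show "?g (x \<oplus>\<^bsub>N\<^esub> y) = ?g x \<oplus>\<^bsub>M\<^esub> ?g y" by simp
  next
    fix x a assume "x \<in> carrier N" "a \<in> carrier R"
    with g f(3)[of "?g x" a] inv[of "?g x \<star>\<^bsub>M\<^esub> a"]
    show "?g (x \<star>\<^bsub>N\<^esub> a) = ?g x \<star>\<^bsub>M\<^esub> a" by (simp add: ract_closed)
  qed
qed

context simple_alg_B_module
begin

text \<open>Schur's lemma: \<open>F\<close>, sending the basis vector i to v b(i), is a homomorphism
  from a simple model that is nonzero at \<open>i0\<close>, so its kernel is trivial and its image
  is everything. The candidates for basis vectors are given by algebra elements \<open>b i\<close>,
  so that linear combinations can be formed in the free algebra.\<close>

lemma iso_basis_module:
  assumes "basis_rep r s I T" "simple_right_module (alg_B r s) (basis_module I T)"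
    and v: "v \<in> V" and i0: "i0 \<in> I" "v \<rhd> b i0 \<noteq> \<zero>\<^bsub>N\<^esub>"
    and gen: "\<And>i g. i \<in> I \<Longrightarrow> v \<rhd> (b i * free_gen g) = v \<rhd> lin_ext b (T g i)"
  shows "rmodule_iso (alg_B r s) N (basis_module I T)"
proof -
  interpret B: basis_rep r s I T by fact
  interpret B: simple_alg_B_module r s "basis_module I T" by unfold_locales fact
  define F where "F x = v \<rhd> lin_ext b x" for x
  have F_closed: "F x \<in> V" for x using v by (simp add: F_def)
  have F_add: "F (x + y) = F x \<oplus>\<^bsub>N\<^esub> F y" for x y
    using v by (simp add: F_def lin_ext_add act_add)
  have F_zero: "F 0 = \<zero>\<^bsub>N\<^esub>" using v by (simp add: F_def)
  have F_act: "F (free_act T x p) = F x \<rhd> p" if "keys x \<subseteq> I" for x p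
    using that
  proof (induction p arbitrary: x rule: free_alg_gen_induct)
    case (const c)
    show ?case using v
      by (simp add: F_def lin_ext_scale act_const_mult smul_def flip: free_const_times)
  next
    case (gen g)
    let ?c = "lookup x"
    \<comment> \<open>The assumption on generators holds only after applying \<open>v\<close>, not
      in the free algebra; it is summed in the form of differences annihilating
      \<open>v\<close>.\<close>
    have "v \<rhd> (\<Sum>i\<in>keys x. free_const (?c i) * lin_ext b (T g i)
        - free_const (?c i) * (b i * free_gen g)) = \<zero>\<^bsub>N\<^esub>"
      using v gen.prems assms(6)
      by (intro act_sum_eq_zero) (auto simp: act_diff_eq_zero_iff act_const_mult)
    also have "(\<Sum>i\<in>keys x. free_const (?c i) * lin_ext b (T g i)
        - free_const (?c i) * (b i * free_gen g)) = lin_ext b (lin_ext (T g) x) - lin_ext b x * free_gen g"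
    proof -
      have "lin_ext b (\<Sum>i\<in>A. scale_pm (?c i) (T g i)) = (\<Sum>i\<in>A. scale_pm (?c i) (lin_ext b (T g i)))" for A
        by (induction A rule: infinite_finite_induct) (simp_all add: lin_ext_add lin_ext_scale)
      then show ?thesis
        by (simp add: sum_subtractf lin_ext_def[of "T g"] lin_ext_def[of b x] sum_distrib_right mult.assoc
            flip: free_const_times)
    qed
    finally show ?case using v by (simp add: F_def act_diff_eq_zero_iff act_mult)
  next
    case (add p q)
    then show ?case by (simp add: free_act_add F_add act_add F_closed)
  next
    case (mult p q)
    then show ?case by (simp add: free_act_mult act_mult F_closed keys_free_act[OF B.keys_T])
  qed
  let ?M = "basis_module I T"
  let ?K = "{x \<in> carrier ?M. F x = \<zero>\<^bsub>N\<^esub>}"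
  have K: "right_submodule (alg_B r s) ?M ?K"
  proof (rule B.right_submoduleI)
    fix x y assume "x \<in> ?K" "y \<in> ?K"
    then show "x \<oplus>\<^bsub>?M\<^esub> y \<in> ?K" by (simp add: F_add keys_add_subset)
  next
    fix x p assume "x \<in> ?K"
    then show "B.act x p \<in> ?K"
      by (simp add: B.act_eq_free_act F_act keys_free_act[OF B.keys_T])
  qed (auto simp: F_zero)
  have F_i0: "F (single i0 1) \<noteq> \<zero>\<^bsub>N\<^esub>" using i0 by (simp add: F_def)
  have inj: "x = y" if "x \<in> carrier ?M" "y \<in> carrier ?M" "F x = F y" for x y
  proof (rule ccontr)
    assume "x \<noteq> y"
    have "F (x - y) = \<zero>\<^bsub>N\<^esub>"
      using that(3) v unfolding F_def lin_ext_diff by (simp add: act_diff_eq_zero_iff)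
    moreover have "x - y \<in> carrier ?M"
      using keys_add_subset[of x I "scale_pm (- 1) y"] keys_scale_pm[of "- 1" y] that(1,2)
      by (simp add: scale_pm_uminus)
    ultimately have "x - y \<in> ?K" by simp
    with K \<open>x \<noteq> y\<close> have "?K = carrier ?M" using B.submodule_eq_carrier by simp
    then have "single i0 1 \<in> ?K" using i0 by simp
    with F_i0 show False by simp
  qed
  have "F ` carrier ?M = V"
  proof (rule submodule_eq_carrier)
    show "right_submodule (alg_B r s) N (F ` carrier ?M)"
    proof (rule right_submoduleI)
      fix x y assume "x \<in> F ` carrier ?M" "y \<in> F ` carrier ?M"
      then obtain x' y' where "x' \<in> carrier ?M" "y' \<in> carrier ?M" "x = F x'" "y = F y'" by blast
      then have "x \<oplus>\<^bsub>N\<^esub> y = F (x' + y')" "x' + y' \<in> carrier ?M"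
        by (auto simp: F_add dest: subsetD[OF Poly_Mapping.keys_add])
      then show "x \<oplus>\<^bsub>N\<^esub> y \<in> F ` carrier ?M" by blast
    next
      show "\<zero>\<^bsub>N\<^esub> \<in> F ` carrier ?M" by (rule image_eqI[of _ _ 0]) (simp_all add: F_zero)
    next
      fix x p assume "x \<in> F ` carrier ?M"
      then obtain x' where "x' \<in> carrier ?M" "x = F x'" by blast
      then have "x \<rhd> p = F (free_act T x' p)" "free_act T x' p \<in> carrier ?M"
        by (simp_all add: F_act keys_free_act[OF B.keys_T])
      then show "x \<rhd> p \<in> F ` carrier ?M" by blast
    qed (auto simp: F_closed)
    show "F (single i0 1) \<in> F ` carrier ?M" using i0 by auto
  qed (rule F_i0)
  then have bij: "bij_betw F (carrier ?M) V" using inj unfolding bij_betw_def inj_on_def by blast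
  have "rmodule_iso (alg_B r s) ?M N"
    unfolding rmodule_iso_def
  proof (rule exI[of _ F], intro conjI ballI)
    fix x a assume x: "x \<in> carrier ?M" and "a \<in> carrier (alg_B r s)"
    from \<open>a \<in> _\<close> obtain p where "a = class_B r s p" unfolding carrier_alg_B by (elim imageE)
    with x show "F (x \<star>\<^bsub>?M\<^esub> a) = F x \<star>\<^bsub>N\<^esub> a"
      by (simp add: B.ract_class_B F_act act_def)
  qed (use bij in \<open>simp_all add: F_add\<close>)
  then show ?thesis by (rule rmodule_iso_sym[OF B.right_module_basis_module])
qed

end

section \<open>Orders of roots of unity\<close>

lemma power_mod_period:
  fixes x :: "'a::monoid_mult"
  assumes "x ^ n = 1" shows "x ^ (k mod n) = x ^ k"
proof -
  have "x ^ k = x ^ (n * (k div n) + k mod n)" by simp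
  also have "\<dots> = x ^ (k mod n)" unfolding power_add power_mult assms by simp
  finally show ?thesis ..
qed

lemma mult_ord_root:
  assumes "\<exists>n>0. z ^ n = 1" shows "mult_ord z > 0" and "z ^ mult_ord z = 1"
  using LeastI_ex[OF assms] assms by (auto simp: mult_ord_def)

lemma power_eq_one_iff_mult_ord_dvd:
  assumes "\<exists>n>0. z ^ n = 1" shows "z ^ n = 1 \<longleftrightarrow> mult_ord z dvd n"
proof
  assume "z ^ n = 1"
  have "z ^ (n mod mult_ord z) = 1"
    by (rule trans[OF power_mod_period[OF mult_ord_root(2)[OF assms]] \<open>z ^ n = 1\<close>])
  moreover have "n mod mult_ord z < mult_ord z" using mult_ord_root[OF assms] by simp
  moreover have "mult_ord z = (LEAST n. n > 0 \<and> z ^ n = 1)"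
    unfolding mult_ord_def using assms by (rule if_P)
  ultimately have "\<not> n mod mult_ord z > 0" using not_less_Least by fastforce
  then show "mult_ord z dvd n" by auto
next
  assume "mult_ord z dvd n"
  then obtain k where "n = mult_ord z * k" ..
  then show "z ^ n = 1" by (simp add: power_mult mult_ord_root(2)[OF assms])
qed

lemma power_eq_power_imp_power_diff_eq_one:
  fixes z :: complex
  assumes "z \<noteq> 0" "z ^ i = z ^ j" "i \<le> j" shows "z ^ (j - i) = 1"
  using assms power_diff[of z i j] by simp

text \<open>With \<open>n\<close> the order of \<open>x\<close>, the assumption forces \<open>y\<^sup>n = \<plusminus>1\<close>, and for \<open>-1\<close> the parity of
  \<open>d div n\<close> decides. This is where the factors \<open>2\<close> in \<^const>\<open>l1\<close> and \<^const>\<open>m2\<close> come from.\<close>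

lemma pair_power_eq_one_iff:
  fixes x y :: complex
  assumes "\<exists>n>0. x ^ n = 1" and y: "y ^ (2 * mult_ord x) = 1"
  shows "x ^ d = 1 \<and> y ^ d = 1 \<longleftrightarrow> (if y ^ mult_ord x = 1 then mult_ord x else 2 * mult_ord x) dvd d"
proof (cases "mult_ord x dvd d")
  case True
  then obtain e where e: "d = mult_ord x * e" ..
  have "(y ^ mult_ord x)\<^sup>2 = 1"
    using y unfolding mult.commute[of 2 "mult_ord x"] power_mult .
  then have *: "y ^ mult_ord x = 1 \<or> y ^ mult_ord x = - 1" by (simp add: power2_eq_1_iff)
  have "x ^ d = 1" using True power_eq_one_iff_mult_ord_dvd[OF assms(1)] by blast
  moreover have "y ^ d = (y ^ mult_ord x) ^ e" by (simp add: e power_mult)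
  moreover have "2 * mult_ord x dvd d \<longleftrightarrow> even e"
    unfolding e mult.commute[of 2 "mult_ord x"] using mult_ord_root(1)[OF assms(1)] by simp
  ultimately show ?thesis using True *
    by (cases "even e"; cases "y ^ mult_ord x = 1") simp_all
next
  case False
  then have "\<not> 2 * mult_ord x dvd d" by (metis dvd_mult_left mult.commute)
  with False show ?thesis using power_eq_one_iff_mult_ord_dvd[OF assms(1)] by simp
qed

section \<open>The constants attached to r and s\<close>

locale root_params =
  fixes r s :: complex
  assumes r0 [simp]: "r \<noteq> 0" and s0 [simp]: "s \<noteq> 0"
    and r_root: "\<exists>n>0. r ^ n = 1" and s_root: "\<exists>n>0. s ^ n = 1"
    and r2_neq_s2: "r\<^sup>2 \<noteq> s\<^sup>2"
begin

text \<open>Moving X3 X1 past X2 or W costs a factor \<open>q\<close> or its inverse, moving it past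
  X1 or X3 a factor \<open>A\<close> or its inverse. The constant \<open>\<gamma>\<close> is the
  coefficient of X3 X1 in the relation between W and X2.\<close>

definition q :: complex where "q = r * s powi (-1)"
definition A :: complex where "A = r\<^sup>2 * s\<^sup>2"
definition \<gamma> :: complex where "\<gamma> = s\<^sup>2 * (r\<^sup>2 - s\<^sup>2)"
abbreviation m :: nat where "m \<equiv> mult_ord q"
abbreviation L :: nat where "L \<equiv> mult_ord A"

lemma q_eq: "q = r / s"
  by (simp add: q_def power_int_minus divide_inverse)

lemma q0 [simp]: "q \<noteq> 0" by (simp add: q_eq)

lemma A0 [simp]: "A \<noteq> 0" by (simp add: A_def)

lemma q_neq_one: "q \<noteq> 1"
  using r2_neq_s2 by (auto simp: q_eq field_simps)

lemma q_square_neq_one: "q\<^sup>2 \<noteq> 1"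
  using r2_neq_s2 by (auto simp: q_eq field_simps)

lemma \<gamma>0 [simp]: "\<gamma> \<noteq> 0"
  using r2_neq_s2 by (simp add: \<gamma>_def)

lemma common_exponent: obtains n where "n > 0" "r ^ n = 1" "s ^ n = 1"
proof -
  obtain a b where ab: "a > 0" "r ^ a = 1" "b > 0" "s ^ b = 1" using r_root s_root by blast
  have "r ^ (a * b) = (r ^ a) ^ b" "s ^ (a * b) = (s ^ b) ^ a"
    by (rule power_mult, subst mult.commute, rule power_mult)
  with ab have "a * b > 0" "r ^ (a * b) = 1" "s ^ (a * b) = 1" by simp_all
  then show ?thesis by (rule that)
qed

lemma root_of_unity:
  shows q_root: "\<exists>n>0. q ^ n = 1" and A_root: "\<exists>n>0. A ^ n = 1"
    and rs_root: "\<exists>n>0. (r * s) ^ n = 1"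
    and r2_root: "\<exists>n>0. (r\<^sup>2) ^ n = 1" and s2_root: "\<exists>n>0. (s\<^sup>2) ^ n = 1"
proof -
  obtain n where n: "n > 0" "r ^ n = 1" "s ^ n = 1" by (rule common_exponent)
  have "(z\<^sup>2) ^ n = (z ^ n)\<^sup>2" for z :: complex by (simp add: mult.commute flip: power_mult)
  with n show "\<exists>n>0. q ^ n = 1" "\<exists>n>0. A ^ n = 1" "\<exists>n>0. (r * s) ^ n = 1"
    "\<exists>n>0. (r\<^sup>2) ^ n = 1" "\<exists>n>0. (s\<^sup>2) ^ n = 1"
    by (auto intro!: exI[of _ n] simp: q_eq A_def power_mult_distrib power_divide)
qed

lemma m_pos: "m > 0" and q_power_m: "q ^ m = 1" and L_pos: "L > 0" and A_power_L: "A ^ L = 1"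
  using mult_ord_root q_root A_root by blast+

lemma r_power_m: "r ^ m = s ^ m"
  using q_power_m by (simp add: q_eq power_divide)

text \<open>Keeps the boundary indices 0 and m - 1 of a cycle apart, and makes l3 - 2 positive, as m
  divides l3.\<close>

lemma m_gt_2: "m > 2"
proof (rule ccontr)
  assume "\<not> m > 2"
  with m_pos have "m = 1 \<or> m = 2" by auto
  with q_power_m q_neq_one q_square_neq_one show False by auto
qed

lemma q_power_inj: "q ^ i = q ^ j \<Longrightarrow> i < m \<Longrightarrow> j < m \<Longrightarrow> i = j"
proof (induction i j rule: linorder_wlog)
  case (le i j)
  have "q ^ (j - i) = 1" using power_eq_power_imp_power_diff_eq_one[OF q0] le by blast
  then have "m dvd j - i" using power_eq_one_iff_mult_ord_dvd[OF q_root] by blast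
  with le show ?case by (auto dest: dvd_imp_le)
qed metis

lemma A_power_inj: "A ^ i = A ^ j \<Longrightarrow> i < L \<Longrightarrow> j < L \<Longrightarrow> i = j"
proof (induction i j rule: linorder_wlog)
  case (le i j)
  have "A ^ (j - i) = 1" using power_eq_power_imp_power_diff_eq_one[of A] le by simp
  then have "L dvd j - i" using power_eq_one_iff_mult_ord_dvd[OF A_root] by blast
  with le show ?case by (auto dest: dvd_imp_le)
qed metis

text \<open>By \<open>r ^ m = s ^ m\<close> and \<open>A ^ L = 1\<close>, the numbers r^(2Lm) and
  s^(2Lm) are equal with product 1. They are thus 1 or -1, as \<open>pair_power_eq_one_iff\<close>
  needs.\<close>

lemma power_2Lm: "r ^ (2 * L * m * 2) = 1" "s ^ (2 * L * m * 2) = 1"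
proof -
  have rs: "r ^ (2 * L * m) = s ^ (2 * L * m)"
    using r_power_m by (metis mult.commute power_mult)
  have "r ^ (2 * L * m) * s ^ (2 * L * m) = (A ^ L) ^ m"
    by (simp add: A_def power_mult power_mult_distrib)
  then have *: "r ^ (2 * L * m) * s ^ (2 * L * m) = 1" by (simp add: A_power_L)
  show "r ^ (2 * L * m * 2) = 1"
    unfolding power_mult[of _ _ 2] power2_eq_square using * rs by simp
  show "s ^ (2 * L * m * 2) = 1"
    unfolding power_mult[of _ _ 2] power2_eq_square using * rs by simp
qed

lemma l1_eq: "l1 r s = (if (s ^ (2 * m)) ^ L = 1 then L else 2 * L)"
proof -
  have "(s ^ (2 * m)) ^ L = (s\<^sup>2) ^ (L * m)"
    unfolding power_mult[symmetric] by (rule arg_cong[of _ _ "power s"]) simp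
  then show ?thesis unfolding l1_def q_def[symmetric] A_def[symmetric]
    using power_eq_one_iff_mult_ord_dvd[OF s2_root] by simp
qed

text \<open>So \<open>l1\<close> is the joint order of \<open>A\<close>, which governs the
  eigenvalues of \<open>xt\<close> and X3 X1 along X1, and of \<open>s ^ (2 * m)\<close>, the factor
  between X1 and X2^m. Periodicity in the index a and its recovery from eigenvalues both rest on
  this.\<close>

lemma l1_dvd_iff: "l1 r s dvd d \<longleftrightarrow> A ^ d = 1 \<and> (s ^ (2 * m)) ^ d = 1"
proof -
  have "(s ^ (2 * m)) ^ (2 * L) = s ^ (2 * L * m * 2)"
    unfolding power_mult[symmetric] by (rule arg_cong[of _ _ "power s"]) simp
  then show ?thesis
    using pair_power_eq_one_iff[OF A_root, of "s ^ (2 * m)" d] power_2Lm(2) by (simp only: l1_eq)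
qed

lemma l1_pos: "l1 r s > 0"
  using L_pos by (simp add: l1_eq)

lemma m2_eq: "m2 r s u = (if (r ^ (2 * L)) ^ m = 1 \<or> u = 0 then m else 2 * m)"
proof -
  have "(r ^ (2 * L)) ^ m = (r\<^sup>2) ^ (L * m)"
    unfolding power_mult[symmetric] by (rule arg_cong[of _ _ "power r"]) simp
  then show ?thesis unfolding m2_def q_def[symmetric] A_def[symmetric]
    using power_eq_one_iff_mult_ord_dvd[OF r2_root] by simp
qed

text \<open>The analogue for the cycle of W: \<open>q\<close> is the factor between X3 X1 and W, and
  \<open>r ^ (2 * L)\<close> the one between X1^L and W.\<close>

lemma m2_dvd_iff: "u \<noteq> 0 \<Longrightarrow> m2 r s u dvd d \<longleftrightarrow> q ^ d = 1 \<and> (r ^ (2 * L)) ^ d = 1"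
proof -
  assume "u \<noteq> 0"
  have "(r ^ (2 * L)) ^ (2 * m) = r ^ (2 * L * m * 2)"
    unfolding power_mult[symmetric] by (rule arg_cong[of _ _ "power r"]) simp
  then show ?thesis
    using pair_power_eq_one_iff[OF q_root, of "r ^ (2 * L)" d] power_2Lm(1) \<open>u \<noteq> 0\<close>
    by (simp only: m2_eq simp_thms)
qed

lemma m_le_m2: "m \<le> m2 r s u"
  by (simp add: m2_eq)

lemma q_power_m2: "q ^ m2 r s u = 1"
  by (simp add: m2_eq q_power_m mult.commute[of 2] power_mult)

end

section \<open>Monomial representations and reachability of basis vectors\<close>

lemma power_cyclic_pred:
  fixes x :: complex
  assumes "x ^ n = 1" "x \<noteq> 0" "n > 0" shows "x ^ ((k + n - 1) mod n) = x ^ k / x"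
proof -
  have "x ^ (k + n - 1) * x = x ^ (k + n - 1 + 1)" by (simp only: power_add power_one_right)
  also have "\<dots> = x ^ k" using assms by (simp add: power_add)
  finally show ?thesis using assms by (simp add: power_mod_period field_simps)
qed

text \<open>When generators send basis vectors to multiples of basis vectors, a relation amounts to
  equal target indices and one scalar identity. Five relations are commutations up to the scalar k;
  the sixth has three terms, which must share a target.\<close>

lemma basis_rep_monomial:
  assumes T: "\<And>g i. i \<in> I \<Longrightarrow> T g i = single (\<sigma> g i) (c g i)"
    and \<sigma>: "\<And>g i. i \<in> I \<Longrightarrow> \<sigma> g i \<in> I"
    and "\<And>g h k i. i \<in> I \<Longrightarrow> (g, h, k) \<in> {(GW, GX1, r powi (-2)), (GX2, GX1, s powi (-2)),
        (GX3, GX1, (r * s) powi (-2)), (GX3, GX2, (r * s) powi (-1)), (GW, GX3, r * s)} \<Longrightarrow>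
        \<sigma> h (\<sigma> g i) = \<sigma> g (\<sigma> h i) \<and> c g i * c h (\<sigma> g i) = k * (c h i * c g (\<sigma> h i))"
    and "\<And>i. i \<in> I \<Longrightarrow>
        \<sigma> GX2 (\<sigma> GW i) = \<sigma> GX1 (\<sigma> GX3 i) \<and> \<sigma> GW (\<sigma> GX2 i) = \<sigma> GX1 (\<sigma> GX3 i) \<and>
        c GW i * c GX2 (\<sigma> GW i) = c GX2 i * c GW (\<sigma> GX2 i)
          + s^2 * (r^2 - s^2) * (c GX3 i * c GX1 (\<sigma> GX3 i))"
  shows "basis_rep r s I T"
proof
  fix g i assume "i \<in> I"
  then show "keys (T g i) \<subseteq> I" using T \<sigma> by simp
next
  fix p i assume p: "p \<in> relations_B r s" and i: "i \<in> I"
  have gen2: "free_act T (single i x) (free_gen g * free_gen h) =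
      single (\<sigma> h (\<sigma> g i)) (x * (c g i * c h (\<sigma> g i)))" for x g h
    using i \<sigma> by (simp add: free_act_mult T mult_ac)
  let ?Q = "{(GW, GX1, r powi (-2)), (GX2, GX1, s powi (-2)),
        (GX3, GX1, (r * s) powi (-2)), (GX3, GX2, (r * s) powi (-1)), (GW, GX3, r * s)}"
  let ?R = "\<lambda>g h k. free_act T (single i 1)
      (free_gen g * free_gen h - free_const k * (free_gen h * free_gen g)) = 0"
  have qrel: "?R g h k"
    if "(g, h, k) \<in> ?Q" for g h k
    using assms(3)[OF i that] by (simp add: free_act_diff gen2 free_act_mult[of _ _ "free_const k"])
  have "free_act T (single i 1) (free_gen GW * free_gen GX2 -
      (free_gen GX2 * free_gen GW + free_const (s^2 * (r^2 - s^2)) * (free_gen GX3 * free_gen GX1))) = 0"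
  proof -
    have "\<sigma> GX2 (\<sigma> GW i) = \<sigma> GX1 (\<sigma> GX3 i)" "\<sigma> GW (\<sigma> GX2 i) = \<sigma> GX1 (\<sigma> GX3 i)"
      using assms(4)[OF i] by simp_all
    then show ?thesis
      using assms(4)[OF i]
      by (simp add: free_act_diff free_act_add gen2 free_act_mult[of _ _ "free_const _"] flip: single_add)
  qed
  moreover have "?R GW GX1 (r powi (-2))" "?R GX2 GX1 (s powi (-2))" "?R GX3 GX1 ((r * s) powi (-2))"
    "?R GX3 GX2 ((r * s) powi (-1))" "?R GW GX3 (r * s)"
    by (rule qrel; blast)+
  ultimately show "free_act T (single i 1) p = 0"
    using p unfolding relations_B_def Let_def by (elim insertE emptyE) (simp_all only:)
qed

text \<open>The transitivity condition of \<open>simple_basis_module\<close> as a preorder, so that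
  it can be assembled from single generators.\<close>

definition reaches :: "(gen \<Rightarrow> 'i \<Rightarrow> ('i \<Rightarrow>\<^sub>0 complex)) \<Rightarrow> 'i \<Rightarrow> 'i \<Rightarrow> bool" where
  "reaches T i j \<longleftrightarrow>
    (\<exists>p c. c \<noteq> 0 \<and> free_act T (single i 1) p = single j c)"

lemma reaches_refl [simp]: "reaches T i i"
  unfolding reaches_def by (intro exI[of _ 1]) simp

lemma reaches_trans:
  assumes "reaches T i j" "reaches T j k" shows "reaches T i k"
proof -
  obtain p c where p: "c \<noteq> 0" "free_act T (single i 1) p = single j c"
    using assms(1) by (auto simp: reaches_def)
  obtain p' c' where p': "c' \<noteq> 0" "free_act T (single j 1) p' = single k c'"
    using assms(2) by (auto simp: reaches_def)
  have "free_act T (single i 1) (p * p') = scale_pm c (free_act T (single j 1) p')"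
    using p by (simp add: free_act_mult flip: free_act_scale_vector)
  with p p' show ?thesis unfolding reaches_def by (intro exI[of _ "p * p'"] exI[of _ "c * c'"]) simp
qed

lemma reaches_gen: "T g i = single j c \<Longrightarrow> c \<noteq> 0 \<Longrightarrow> reaches T i j"
  unfolding reaches_def by (intro exI[of _ "free_gen g"] exI[of _ c]) simp

text \<open>A cycle can be run through in one direction only, yet n - a + b forward steps lead from
  a to b whether or not b lies ahead.\<close>

lemma reaches_cyclic:
  fixes f :: "nat \<Rightarrow> 'i"
  assumes "\<And>a. a < n \<Longrightarrow> reaches T (f a) (f (Suc a mod n))" and "a < n" "b < n"
  shows "reaches T (f a) (f b)"
proof -
  have "reaches T (f a) (f ((a + k) mod n))" for k
  proof (induction k)
    case (Suc k)
    have "reaches T (f ((a + k) mod n)) (f ((a + Suc k) mod n))"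
      using assms(1)[of "(a + k) mod n"] \<open>a < n\<close> by (simp add: mod_Suc_eq)
    with Suc show ?case by (rule reaches_trans)
  qed (use assms in simp)
  then have "reaches T (f a) (f ((a + (n - a + b)) mod n))" .
  moreover have "(a + (n - a + b)) mod n = b" using assms(2,3) by simp
  ultimately show ?thesis by (simp only:)
qed

section \<open>The three families satisfy the relations\<close>

lemma cyclic_succ_pred: "a < n \<Longrightarrow> ((a + n - 1) mod n + 1) mod n = a"
  and cyclic_pred_succ: "a < n \<Longrightarrow> ((a + 1) mod n + n - 1) mod n = a" for a n :: nat
proof -
  assume "a < n"
  then have "((a + n - 1) mod n + 1) mod n = (a + n - 1 + 1) mod n" by (simp only: mod_simps)
  then show "((a + n - 1) mod n + 1) mod n = a" using \<open>a < n\<close> by simp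
  have "((a + 1) mod n + n - 1) mod n = ((a + 1) mod n + (n - 1)) mod n" using \<open>a < n\<close> by simp
  also have "\<dots> = (a + 1 + (n - 1)) mod n" by (simp only: mod_simps)
  finally show "((a + 1) mod n + n - 1) mod n = a" using \<open>a < n\<close> by simp
qed

lemma powi_minus_even: "(x::complex) powi (-2 * int b) = 1 / (x\<^sup>2) ^ b"
proof -
  have "x powi (-2 * int b) = x powi (- int (2 * b))" by simp
  also have "\<dots> = 1 / x ^ (2 * b)" unfolding power_int_minus power_int_of_nat by (simp add: divide_inverse)
  finally show ?thesis by (simp only: power_mult)
qed

context root_params
begin

section \<open>The first family\<close>

abbreviation S :: complex where "S \<equiv> s ^ (2 * m)"

text \<open>All three modules are monomial: the generator \<open>g\<close> sends \<open>e(i)\<close> to \<open>coef g i\<close> times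
  \<open>e(shift g i)\<close>.\<close>

definition shift1 :: "gen \<Rightarrow> nat \<times> nat \<Rightarrow> nat \<times> nat" where
  "shift1 g i = (case i of (a, b) \<Rightarrow> (case g of
      GX1 \<Rightarrow> ((a + 1) mod l1 r s, b)
    | GX2 \<Rightarrow> (a, if b = m - 1 then 0 else b + 1)
    | GX3 \<Rightarrow> ((a + l1 r s - 1) mod l1 r s, b)
    | GW \<Rightarrow> (a, if b = 0 then m - 1 else b - 1)))"

text \<open>The eigenvalue of W X2 on e(0,b). As q^m = 1 it has period m in b, which fits the
  wrap-around.\<close>

definition wt :: "complex \<Rightarrow> complex \<Rightarrow> nat \<Rightarrow> complex" where
  "wt k3 k4 b = k4 - \<gamma> * ((1 - q ^ b) / (1 - q)) * k3"

lemma wt_0 [simp]: "wt k3 k4 0 = k4"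
  by (simp add: wt_def)

lemma wt_m [simp]: "wt k3 k4 m = k4"
  by (simp add: wt_def q_power_m)

text \<open>The relation W X2 = X2 W + \<gamma> X3 X1 on eigenvalues: X2 W has the value at b + 1,
  and X3 X1 contributes \<open>q ^ b * k3\<close>.\<close>

lemma wt_Suc: "wt k3 k4 b = wt k3 k4 (Suc b) + \<gamma> * q ^ b * k3"
proof -
  have "(1 - q ^ Suc b) / (1 - q) = (1 - q ^ b) / (1 - q) + q ^ b"
    using q_neq_one by (simp add: field_simps)
  then show ?thesis unfolding wt_def by (simp only:) (simp add: algebra_simps)
qed

text \<open>Up to a scalar e(a,b) is e(0,0) X1^a X2^b, so closing the cycle of X2 moves X2^m past
  X1^a; this is the factor \<open>S ^ a\<close>. The step of W at b = 0 undoes it.\<close>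

definition coef1 :: "complex \<Rightarrow> complex \<Rightarrow> complex \<Rightarrow> complex \<Rightarrow> gen \<Rightarrow> nat \<times> nat \<Rightarrow> complex" where
  "coef1 k1 k2 k3 k4 g i = (case i of (a, b) \<Rightarrow> (case g of
      GX1 \<Rightarrow> k1 / (s\<^sup>2) ^ b
    | GX2 \<Rightarrow> k2 * (if b = m - 1 then S ^ a else 1)
    | GX3 \<Rightarrow> A ^ a * (r * s) ^ b / k1 * k3
    | GW \<Rightarrow> A ^ a * wt k3 k4 b / k2 * (if b = 0 then 1 / S ^ a else 1)))"

lemma rs_power_double: "(r * s) ^ (2 * a) = A ^ a"
  by (simp add: A_def power_mult power_mult_distrib)

lemma m1_eq: "m1 r s = m"
  by (simp only: m1_def q_def)

text \<open>Splits off s^(2a), which joins r^(2a) to give \<open>A ^ a\<close>. Both cases of W then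
  differ only by the factor \<open>1 / S ^ a\<close>.\<close>

lemma powi_wrap: "s powi (- 2 * int a * (int m - 1)) = (s\<^sup>2) ^ a / S ^ a"
proof -
  have "- 2 * int a * (int m - 1) = int (2 * a) - int (2 * m * a)" by (simp add: algebra_simps)
  then have "s powi (- 2 * int a * (int m - 1)) = s ^ (2 * a) / s ^ (2 * m * a)"
    by (simp only: power_int_diff[OF disjI1[OF s0]] power_int_of_nat)
  then show ?thesis by (simp only: power_mult)
qed

lemma act_M1_eq: "act_M1 r s (k1, k2, k3, k4) g (a, b) =
    single (shift1 g (a, b)) (coef1 k1 k2 k3 k4 g (a, b))"
proof (cases g)
  case GX1
  show ?thesis unfolding GX1 act_M1.simps powi_minus_even by (simp add: shift1_def coef1_def)
next
  case GX2
  have *: "s ^ (2 * a * m) = S ^ a"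
    unfolding power_mult[symmetric] by (rule arg_cong[of _ _ "power s"]) simp
  show ?thesis unfolding GX2 act_M1.simps m1_eq * by (simp add: shift1_def coef1_def mult.commute)
next
  case GX3
  show ?thesis unfolding GX3 act_M1.simps power_add rs_power_double
    by (simp add: shift1_def coef1_def power_int_minus divide_inverse)
next
  case GW
  show ?thesis unfolding GW act_M1.simps m1_eq powi_wrap q_def[symmetric] \<gamma>_def[symmetric]
      rs_power_double power_mult[of r 2 a]
    by (simp add: shift1_def coef1_def wt_def power_int_minus divide_inverse A_def power_mult_distrib mult_ac)
qed

lemma A_power_l1: "A ^ l1 r s = 1" and S_power_l1: "S ^ l1 r s = 1"
  using l1_dvd_iff[of "l1 r s"] by simp_all

lemma rs_power_m: "(r * s) ^ m = S"
  by (simp add: power_mult_distrib r_power_m mult_2 power_add)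

lemma power_pred_m:
  shows "q ^ (m - 1) = 1 / q" "(r * s) ^ (m - 1) = S / (r * s)" "(s\<^sup>2) ^ (m - 1) = S / s\<^sup>2"
proof -
  have "x ^ (m - 1) = x ^ m / x" if "x \<noteq> 0" for x :: complex
    using that m_pos power_diff[of x 1 m] by simp
  then show "q ^ (m - 1) = 1 / q" "(r * s) ^ (m - 1) = S / (r * s)" "(s\<^sup>2) ^ (m - 1) = S / s\<^sup>2"
    by (simp_all add: q_power_m rs_power_m) (simp add: power_mult)
qed

text \<open>These products are diagonal and the wrap factors cancel in them. They give the sixth
  relation and the eigenvalues of \<open>xt\<close>, and allow cancelling X1 and X2 in the
  classification.\<close>

lemma M1_products:
  assumes "a < l1 r s" "b < m" "k1 \<noteq> 0" "k2 \<noteq> 0"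
  shows "shift1 GX2 (shift1 GW (a, b)) = (a, b)" "shift1 GW (shift1 GX2 (a, b)) = (a, b)" "shift1 GX1 (shift1 GX3 (a, b)) = (a, b)"
    and "coef1 k1 k2 k3 k4 GW (a, b) * coef1 k1 k2 k3 k4 GX2 (shift1 GW (a, b)) = A ^ a * wt k3 k4 b"
    and "coef1 k1 k2 k3 k4 GX2 (a, b) * coef1 k1 k2 k3 k4 GW (shift1 GX2 (a, b)) = A ^ a * wt k3 k4 (Suc b)"
    and "coef1 k1 k2 k3 k4 GX3 (a, b) * coef1 k1 k2 k3 k4 GX1 (shift1 GX3 (a, b)) = A ^ a * q ^ b * k3"
proof -
  note [simp] = assms(3,4)
  have [simp]: "m - Suc 0 \<noteq> 0" "0 \<noteq> m - Suc 0" using m_gt_2 by auto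
  show "shift1 GX2 (shift1 GW (a, b)) = (a, b)" "shift1 GW (shift1 GX2 (a, b)) = (a, b)" "shift1 GX1 (shift1 GX3 (a, b)) = (a, b)"
    using cyclic_succ_pred[OF assms(1)] assms(2) m_pos by (auto simp: shift1_def)
  show "coef1 k1 k2 k3 k4 GW (a, b) * coef1 k1 k2 k3 k4 GX2 (shift1 GW (a, b)) = A ^ a * wt k3 k4 b"
    using assms(2) by (cases b) (auto simp: shift1_def coef1_def)
  show "coef1 k1 k2 k3 k4 GX2 (a, b) * coef1 k1 k2 k3 k4 GW (shift1 GX2 (a, b)) = A ^ a * wt k3 k4 (Suc b)"
  proof (cases "b = m - 1")
    case True
    then have "Suc b = m" using m_pos by simp
    then have "wt k3 k4 (Suc b) = k4" by simp
    then show ?thesis using True by (simp add: shift1_def coef1_def)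
  qed (simp add: shift1_def coef1_def)
  show "coef1 k1 k2 k3 k4 GX3 (a, b) * coef1 k1 k2 k3 k4 GX1 (shift1 GX3 (a, b)) = A ^ a * q ^ b * k3"
    by (simp add: shift1_def coef1_def q_eq power_mult_distrib power_divide power2_eq_square)
qed

lemma basis_rep_M1:
  assumes [simp]: "k1 \<noteq> 0" "k2 \<noteq> 0"
  shows "basis_rep r s ({..<l1 r s} \<times> {..<m1 r s}) (act_M1 r s (k1, k2, k3, k4))"
proof (rule basis_rep_monomial[where \<sigma> = shift1 and c = "coef1 k1 k2 k3 k4"])
  let ?I = "{..<l1 r s} \<times> {..<m1 r s}"
  show "act_M1 r s (k1, k2, k3, k4) g i = single (shift1 g i) (coef1 k1 k2 k3 k4 g i)" for g i
    by (cases i) (simp only: act_M1_eq)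
  show "shift1 g i \<in> ?I" if "i \<in> ?I" for g i
    using that l1_pos m_pos by (auto simp: shift1_def m1_eq split: gen.split)
  \<comment> \<open>Both \<open>A\<close> and \<open>S\<close> have order dividing
    \<open>l1\<close>, so reducing the index a modulo \<open>l1\<close> does not affect the
    coefficients.\<close>
  have pw: "A ^ (Suc a mod l1 r s) = A ^ a * A" "S ^ (Suc a mod l1 r s) = S ^ a * S"
    "A ^ ((a + l1 r s - Suc 0) mod l1 r s) = A ^ a / A" "S ^ ((a + l1 r s - Suc 0) mod l1 r s) = S ^ a / S" for a
    using power_mod_period[OF A_power_l1, of "Suc a"] power_mod_period[OF S_power_l1, of "Suc a"]
      power_cyclic_pred[OF A_power_l1 A0 l1_pos] power_cyclic_pred[OF S_power_l1 _ l1_pos] by simp_all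
  have r2: "r\<^sup>2 = A / s\<^sup>2" by (simp add: A_def)
  have A_eq: "A = (r * s) * (r * s)" by (simp add: A_def power2_eq_square)
  show "shift1 h (shift1 g i) = shift1 g (shift1 h i) \<and>
      coef1 k1 k2 k3 k4 g i * coef1 k1 k2 k3 k4 h (shift1 g i) =
      k * (coef1 k1 k2 k3 k4 h i * coef1 k1 k2 k3 k4 g (shift1 h i))"
    if I: "i \<in> ?I" and rel: "(g, h, k) \<in> {(GW, GX1, r powi (-2)), (GX2, GX1, s powi (-2)),
        (GX3, GX1, (r * s) powi (-2)), (GX3, GX2, (r * s) powi (-1)), (GW, GX3, r * s)}" for g h k i
  proof -
    obtain a b where i: "i = (a, b)" "a < l1 r s" "b < m" using I by (auto simp: m1_eq)
    have [simp]: "m - Suc 0 \<noteq> 0" "0 \<noteq> m - Suc 0" using m_gt_2 by auto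
    consider "g = GW" "h = GX1" "k = 1 / r\<^sup>2" | "g = GX2" "h = GX1" "k = 1 / s\<^sup>2"
      | "g = GX3" "h = GX1" "k = 1 / A" | "g = GX3" "h = GX2" "k = 1 / (r * s)" | "g = GW" "h = GX3" "k = r * s"
      using rel by (auto simp: power_int_minus divide_inverse A_def power_mult_distrib)
    then show ?thesis
    proof cases
      case 1
      show ?thesis
      proof (cases b)
        case 0
        then show ?thesis unfolding 1 i
          using power_pred_m by (simp add: shift1_def coef1_def pw r2 mult_ac)
      next
        case (Suc b')
        then show ?thesis unfolding 1 i using i by (simp add: shift1_def coef1_def pw r2 mult_ac)
      qed
    next
      case 2
      show ?thesis
      proof (cases "b = m - 1")
        case True
        then show ?thesis unfolding 2 i
          using power_pred_m by (simp add: shift1_def coef1_def pw mult_ac)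
      next
        case False
        then show ?thesis unfolding 2 i by (simp add: shift1_def coef1_def pw mult_ac)
      qed
    next
      case 3
      show ?thesis unfolding 3 i
        using cyclic_succ_pred[OF i(2)] cyclic_pred_succ[OF i(2)]
        by (simp add: shift1_def coef1_def pw mult_ac)
    next
      case 4
      show ?thesis
      proof (cases "b = m - 1")
        case True
        then show ?thesis unfolding 4 i
          using power_pred_m by (simp add: shift1_def coef1_def pw mult_ac)
      next
        case False
        then show ?thesis unfolding 4 i by (simp add: shift1_def coef1_def pw mult_ac)
      qed
    next
      case 5
      show ?thesis
      proof (cases b)
        case 0
        then show ?thesis unfolding 5 i
          using power_pred_m by (simp add: shift1_def coef1_def pw mult_ac) (simp add: A_eq)?
      next
        case (Suc b')
        then show ?thesis unfolding 5 i using i by (simp add: shift1_def coef1_def pw mult_ac) (simp add: A_eq mult_ac)?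
      qed
    qed
  qed
  show "shift1 GX2 (shift1 GW i) = shift1 GX1 (shift1 GX3 i) \<and> shift1 GW (shift1 GX2 i) = shift1 GX1 (shift1 GX3 i) \<and>
        coef1 k1 k2 k3 k4 GW i * coef1 k1 k2 k3 k4 GX2 (shift1 GW i) =
        coef1 k1 k2 k3 k4 GX2 i * coef1 k1 k2 k3 k4 GW (shift1 GX2 i)
          + s^2 * (r^2 - s^2) * (coef1 k1 k2 k3 k4 GX3 i * coef1 k1 k2 k3 k4 GX1 (shift1 GX3 i))"
    if I: "i \<in> ?I" for i
  proof -
    obtain a b where i: "i = (a, b)" "a < l1 r s" "b < m" using I by (auto simp: m1_eq)
    note M = M1_products[OF i(2,3) assms]
    show ?thesis unfolding \<gamma>_def[symmetric] i M wt_Suc[of k3 k4 b] by (simp add: algebra_simps)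
  qed
qed

section \<open>The second family\<close>

definition wt' :: "nat \<Rightarrow> complex" where
  "wt' b = \<gamma> * ((1 - (1 / q) ^ b) / (1 - 1 / q))"

lemma wt'_0 [simp]: "wt' 0 = 0"
  by (simp add: wt'_def)

text \<open>In a chain of length m, X2 vanishes at the bottom only. In a chain of length 2m it
  vanishes once more in the middle, and there the cycle of W connects the two halves.\<close>

lemma wt'_eq_zero_iff: "wt' b = 0 \<longleftrightarrow> m dvd b"
proof -
  have "(1 / q) ^ b = 1 \<longleftrightarrow> m dvd b"
    using power_eq_one_iff_mult_ord_dvd[OF q_root, of b] by (auto simp: power_divide)
  moreover have "1 / q \<noteq> 1" using q_neq_one by simp
  ultimately show ?thesis by (auto simp: wt'_def)
qed

text \<open>Again the sixth relation on eigenvalues: \<open>wt'\<close> is the geometric sum of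
  \<gamma> / q^i for i < b, and each step adds the contribution of X3 X1.\<close>

lemma wt'_Suc: "wt' (Suc b) = wt' b + \<gamma> / q ^ b"
proof -
  have "1 / q \<noteq> 1" using q_neq_one by simp
  then have "(1 - (1 / q) ^ Suc b) / (1 - 1 / q) = (1 - (1 / q) ^ b) / (1 - 1 / q) + (1 / q) ^ b"
    by (simp add: field_simps)
  then show ?thesis unfolding wt'_def by (simp only:) (simp add: algebra_simps power_divide)
qed

text \<open>The target of \<open>X2\<close> at \<open>b = 0\<close> is arbitrary, as the coefficient \<open>wt' 0\<close> vanishes; this choice
  makes \<open>X2\<close> and \<open>W\<close> inverse shifts.\<close>

definition shift2 :: "complex \<Rightarrow> gen \<Rightarrow> nat \<times> nat \<Rightarrow> nat \<times> nat" where
  "shift2 u3 g i = (case i of (a, b) \<Rightarrow> (case g of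
      GX1 \<Rightarrow> ((a + 1) mod L, b)
    | GX2 \<Rightarrow> (a, if b = 0 then m2 r s u3 - 1 else b - 1)
    | GX3 \<Rightarrow> ((a + L - 1) mod L, b)
    | GW \<Rightarrow> (a, if b = m2 r s u3 - 1 then 0 else b + 1)))"

definition coef2 :: "complex \<Rightarrow> complex \<Rightarrow> complex \<Rightarrow> gen \<Rightarrow> nat \<times> nat \<Rightarrow> complex" where
  "coef2 u1 u2 u3 g i = (case i of (a, b) \<Rightarrow> (case g of
      GX1 \<Rightarrow> u1 / (r\<^sup>2) ^ b
    | GX2 \<Rightarrow> A ^ a * wt' b * u2
    | GX3 \<Rightarrow> A ^ a * (r * s) ^ b / u1 * u2
    | GW \<Rightarrow> (if b = m2 r s u3 - 1 then (r ^ (2 * m2 r s u3)) ^ a * u3 else 1)))"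

lemma l2_eq: "l2 r s = L"
  by (simp only: l2_def A_def)

lemma act_M2_eq: "act_M2 r s (u1, u2, u3) g (a, b) =
    single (shift2 u3 g (a, b)) (coef2 u1 u2 u3 g (a, b))"
proof (cases g)
  case GX1
  show ?thesis unfolding GX1 act_M2.simps powi_minus_even l2_eq by (simp add: shift2_def coef2_def)
next
  case GX2
  have "r powi (-1) * s = 1 / q" by (simp add: q_eq power_int_minus field_simps)
  then show ?thesis unfolding GX2 act_M2.simps rs_power_double
    by (simp add: shift2_def coef2_def wt'_def \<gamma>_def mult.assoc)
next
  case GX3
  show ?thesis unfolding GX3 act_M2.simps power_add rs_power_double l2_eq
    by (simp add: shift2_def coef2_def power_int_minus divide_inverse)
next
  case GW
  have *: "r ^ (2 * a * m2 r s u3) = (r ^ (2 * m2 r s u3)) ^ a"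
    unfolding power_mult[symmetric] by (rule arg_cong[of _ _ "power r"]) simp
  show ?thesis unfolding GW act_M2.simps * by (simp add: shift2_def coef2_def)
qed

lemma m2_gt_2: "m2 r s u > 2"
  using m_gt_2 m_le_m2[of u] by simp

lemma r_power_m2: "r ^ m2 r s u = s ^ m2 r s u"
  by (auto simp: m2_eq r_power_m mult.commute[of 2 m] power_mult)

lemma rs_power_m2: "(r * s) ^ m2 r s u = r ^ (2 * m2 r s u)"
  using r_power_m2[of u] by (simp add: power_mult_distrib mult_2 power_add)

lemma power_pred_m2:
  shows "q ^ (m2 r s u - 1) = 1 / q" "(r * s) ^ (m2 r s u - 1) = r ^ (2 * m2 r s u) / (r * s)"
    "(r\<^sup>2) ^ (m2 r s u - 1) = r ^ (2 * m2 r s u) / r\<^sup>2"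
proof -
  have "x ^ (m2 r s u - 1) = x ^ m2 r s u / x" if "x \<noteq> 0" for x :: complex
    using that m2_gt_2[of u] power_diff[of x 1 "m2 r s u"] by simp
  then show "q ^ (m2 r s u - 1) = 1 / q" "(r * s) ^ (m2 r s u - 1) = r ^ (2 * m2 r s u) / (r * s)"
    "(r\<^sup>2) ^ (m2 r s u - 1) = r ^ (2 * m2 r s u) / r\<^sup>2"
    by (simp_all add: q_power_m2 rs_power_m2) (simp add: power_mult)
qed

lemma r_power_m2_L: assumes "u \<noteq> 0" shows "(r ^ (2 * m2 r s u)) ^ L = 1"
proof -
  have "(r ^ (2 * m2 r s u)) ^ L = (r ^ (2 * L)) ^ m2 r s u"
    unfolding power_mult[symmetric] by (rule arg_cong[of _ _ "power r"]) simp
  then show ?thesis using m2_dvd_iff[OF assms, of "m2 r s u"] by simp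
qed

lemma M2_products:
  assumes "a < L" "b < m2 r s u3" "u1 \<noteq> 0" "u2 \<noteq> 0"
  shows "shift2 u3 GX2 (shift2 u3 GW (a, b)) = (a, b)" "shift2 u3 GW (shift2 u3 GX2 (a, b)) = (a, b)"
      "shift2 u3 GX1 (shift2 u3 GX3 (a, b)) = (a, b)"
    and "coef2 u1 u2 u3 GW (a, b) * coef2 u1 u2 u3 GX2 (shift2 u3 GW (a, b)) = A ^ a * wt' (Suc b) * u2"
    and "coef2 u1 u2 u3 GX2 (a, b) * coef2 u1 u2 u3 GW (shift2 u3 GX2 (a, b)) = A ^ a * wt' b * u2"
    and "coef2 u1 u2 u3 GX3 (a, b) * coef2 u1 u2 u3 GX1 (shift2 u3 GX3 (a, b)) = A ^ a / q ^ b * u2"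
proof -
  let ?n = "m2 r s u3"
  note [simp] = assms(3,4)
  show "shift2 u3 GX2 (shift2 u3 GW (a, b)) = (a, b)" "shift2 u3 GW (shift2 u3 GX2 (a, b)) = (a, b)"
      "shift2 u3 GX1 (shift2 u3 GX3 (a, b)) = (a, b)"
    using cyclic_succ_pred[OF assms(1)] assms(2) m2_gt_2[of u3] by (auto simp: shift2_def)
  show "coef2 u1 u2 u3 GX2 (a, b) * coef2 u1 u2 u3 GW (shift2 u3 GX2 (a, b)) = A ^ a * wt' b * u2"
    using assms(2) by (cases b) (auto simp: shift2_def coef2_def)
  show "coef2 u1 u2 u3 GW (a, b) * coef2 u1 u2 u3 GX2 (shift2 u3 GW (a, b)) = A ^ a * wt' (Suc b) * u2"
  proof (cases "b = ?n - 1")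
    case True
    then have "Suc b = ?n" using m2_gt_2[of u3] by simp
    \<comment> \<open>At the last index W wraps to b = 0, where X2 vanishes; the formula agrees
      because \<open>wt'\<close> vanishes at every multiple of m.\<close>
    moreover have "m dvd ?n" using q_power_m2 power_eq_one_iff_mult_ord_dvd[OF q_root] by blast
    ultimately have "wt' (Suc b) = 0" using wt'_eq_zero_iff by simp
    then show ?thesis using True by (simp add: shift2_def coef2_def)
  qed (simp add: shift2_def coef2_def)
  show "coef2 u1 u2 u3 GX3 (a, b) * coef2 u1 u2 u3 GX1 (shift2 u3 GX3 (a, b)) = A ^ a / q ^ b * u2"
    by (simp add: shift2_def coef2_def q_eq power_mult_distrib power_divide power2_eq_square)
qed

lemma basis_rep_M2:
  assumes [simp]: "u1 \<noteq> 0" "u2 \<noteq> 0"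
  shows "basis_rep r s ({..<l2 r s} \<times> {..<m2 r s u3}) (act_M2 r s (u1, u2, u3))"
proof (rule basis_rep_monomial[where \<sigma> = "shift2 u3" and c = "coef2 u1 u2 u3"])
  let ?I = "{..<l2 r s} \<times> {..<m2 r s u3}" and ?n = "m2 r s u3"
  show "act_M2 r s (u1, u2, u3) g i = single (shift2 u3 g i) (coef2 u1 u2 u3 g i)" for g i
    by (cases i) (simp only: act_M2_eq)
  show "shift2 u3 g i \<in> ?I" if "i \<in> ?I" for g i
    using that L_pos m2_gt_2[of u3] by (auto simp: shift2_def l2_eq split: gen.split)
  define R where "R = r ^ (2 * ?n)"
  have R0 [simp]: "R \<noteq> 0" by (simp add: R_def)
  \<comment> \<open>Periodicity of the powers of \<open>R\<close> modulo \<open>L\<close> is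
    available for nonzero \<open>u3\<close>. Where \<open>u3 = 0\<close> the wrap coefficient
    vanishes, so the equations carry the factor \<open>u3\<close>.\<close>
  have pw: "A ^ (Suc a mod L) = A ^ a * A" "R ^ (Suc a mod L) * u3 = R ^ a * (R * u3)"
    "A ^ ((a + L - Suc 0) mod L) = A ^ a / A" "R ^ ((a + L - Suc 0) mod L) * u3 = R ^ a / R * u3" for a
  proof -
    show "R ^ (Suc a mod L) * u3 = R ^ a * (R * u3)"
      using power_mod_period[OF r_power_m2_L[of u3, folded R_def], of "Suc a"] by (cases "u3 = 0") simp_all
    show "R ^ ((a + L - Suc 0) mod L) * u3 = R ^ a / R * u3"
      using power_cyclic_pred[OF r_power_m2_L[of u3, folded R_def] _ L_pos] by (cases "u3 = 0") simp_all
  qed (use power_mod_period[OF A_power_L, of "Suc a"] power_cyclic_pred[OF A_power_L A0 L_pos] in simp_all)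
  note pp = power_pred_m2[of u3, folded R_def]
  have s2: "s\<^sup>2 = A / r\<^sup>2" by (simp add: A_def)
  have A_eq: "A = (r * s) * (r * s)" by (simp add: A_def power2_eq_square)
  have [simp]: "?n - Suc 0 \<noteq> 0" "0 \<noteq> ?n - Suc 0" using m2_gt_2[of u3] by auto
  show "shift2 u3 h (shift2 u3 g i) = shift2 u3 g (shift2 u3 h i) \<and>
      coef2 u1 u2 u3 g i * coef2 u1 u2 u3 h (shift2 u3 g i) =
      k * (coef2 u1 u2 u3 h i * coef2 u1 u2 u3 g (shift2 u3 h i))"
    if I: "i \<in> ?I" and rel: "(g, h, k) \<in> {(GW, GX1, r powi (-2)), (GX2, GX1, s powi (-2)),
        (GX3, GX1, (r * s) powi (-2)), (GX3, GX2, (r * s) powi (-1)), (GW, GX3, r * s)}" for g h k i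
  proof -
    obtain a b where i: "i = (a, b)" "a < L" "b < ?n" using I by (auto simp: l2_eq)
    consider "g = GW" "h = GX1" "k = 1 / r\<^sup>2" | "g = GX2" "h = GX1" "k = 1 / s\<^sup>2"
      | "g = GX3" "h = GX1" "k = 1 / A" | "g = GX3" "h = GX2" "k = 1 / (r * s)" | "g = GW" "h = GX3" "k = r * s"
      using rel by (auto simp: power_int_minus divide_inverse A_def power_mult_distrib)
    then show ?thesis
    proof cases
      case 1
      show ?thesis
      proof (cases "b = ?n - 1")
        case True
        then show ?thesis unfolding 1 i
          using pp by (simp add: shift2_def coef2_def pw flip: R_def)
      next
        case False
        then show ?thesis unfolding 1 i using i by (simp add: shift2_def coef2_def pw mult_ac)
      qed
    next
      case 2
      show ?thesis
      proof (cases b)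
        case 0
        then show ?thesis unfolding 2 i by (simp add: shift2_def coef2_def)
      next
        case (Suc b')
        then show ?thesis unfolding 2 i by (simp add: shift2_def coef2_def pw s2 mult_ac)
      qed
    next
      case 3
      show ?thesis unfolding 3 i
        using cyclic_succ_pred[OF i(2)] cyclic_pred_succ[OF i(2)]
        by (simp add: shift2_def coef2_def pw)
    next
      case 4
      show ?thesis
      proof (cases b)
        case 0
        then show ?thesis unfolding 4 i by (simp add: shift2_def coef2_def)
      next
        case (Suc b')
        then show ?thesis unfolding 4 i by (simp add: shift2_def coef2_def pw mult_ac) (simp add: A_eq mult_ac)?
      qed
    next
      case 5
      show ?thesis
      proof (cases "b = ?n - 1")
        case True
        have "R ^ ((a + L - Suc 0) mod L) * (u2 * u3) = R ^ a / R * (u2 * u3)"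
          using pw(4)[of a] by (simp add: mult_ac)
        with True show ?thesis unfolding 5 i
          using pp pw(4)[of a] by (simp add: shift2_def coef2_def mult_ac flip: R_def) (simp add: A_eq mult_ac)?
      next
        case False
        then show ?thesis unfolding 5 i using i by (simp add: shift2_def coef2_def pw mult_ac) (simp add: A_eq mult_ac)?
      qed
    qed
  qed
  show "shift2 u3 GX2 (shift2 u3 GW i) = shift2 u3 GX1 (shift2 u3 GX3 i) \<and> shift2 u3 GW (shift2 u3 GX2 i) = shift2 u3 GX1 (shift2 u3 GX3 i) \<and>
        coef2 u1 u2 u3 GW i * coef2 u1 u2 u3 GX2 (shift2 u3 GW i) =
        coef2 u1 u2 u3 GX2 i * coef2 u1 u2 u3 GW (shift2 u3 GX2 i)
          + s^2 * (r^2 - s^2) * (coef2 u1 u2 u3 GX3 i * coef2 u1 u2 u3 GX1 (shift2 u3 GX3 i))"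
    if I: "i \<in> ?I" for i
  proof -
    obtain a b where i: "i = (a, b)" "a < L" "b < ?n" using I by (auto simp: l2_eq)
    note M = M2_products[OF i(2,3) assms]
    show ?thesis unfolding \<gamma>_def[symmetric] i M wt'_Suc by (simp add: algebra_simps)
  qed
qed

section \<open>The third family\<close>

definition shift3 :: "gen \<Rightarrow> nat \<Rightarrow> nat" where
  "shift3 g a = (case g of GX1 \<Rightarrow> (a + 2) mod l3 r s | GX2 \<Rightarrow> (a + 1) mod l3 r s | GX3 \<Rightarrow> a
    | GW \<Rightarrow> (a + 1) mod l3 r s)"

text \<open>The scalar of X1 is forced by W X2 = \<gamma> / (1 - q) X3 X1, that is, by X-tilde
  acting as zero.\<close>

definition coef3 :: "complex \<Rightarrow> complex \<Rightarrow> complex \<Rightarrow> gen \<Rightarrow> nat \<Rightarrow> complex" where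
  "coef3 e1 e2 e3 g a = (case g of
      GX1 \<Rightarrow> e1\<^sup>2 * e3 / e2 * ((1 - q) / \<gamma>) / (s\<^sup>2) ^ a
    | GX2 \<Rightarrow> e1
    | GX3 \<Rightarrow> (r * s) ^ a * e2
    | GW \<Rightarrow> e1 * e3 * q ^ a)"

lemma act_M3_eq: "act_M3 r s (e1, e2, e3) g a = single (shift3 g a) (coef3 e1 e2 e3 g a)"
  by (cases g)
    (simp_all only: act_M3.simps powi_minus_even q_def[symmetric] \<gamma>_def[symmetric] shift3_def coef3_def gen.case,
      simp add: power_int_minus divide_inverse mult_ac)

lemma l3_eq: "l3 r s = lcm (mult_ord (r * s)) m"
  by (simp only: l3_def q_def)

lemma l3_pos: "l3 r s > 0"
  using mult_ord_root(1)[OF rs_root] m_pos by (simp add: l3_eq lcm_pos_nat)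

lemma l3_dvd_iff: "l3 r s dvd d \<longleftrightarrow> (r * s) ^ d = 1 \<and> q ^ d = 1"
  using power_eq_one_iff_mult_ord_dvd[OF rs_root] power_eq_one_iff_mult_ord_dvd[OF q_root]
  by (simp add: l3_eq)

lemma power_l3: "(r * s) ^ l3 r s = 1" "q ^ l3 r s = 1" "(s\<^sup>2) ^ l3 r s = 1"
proof -
  show rs: "(r * s) ^ l3 r s = 1" and q: "q ^ l3 r s = 1" using l3_dvd_iff[of "l3 r s"] by simp_all
  have "s\<^sup>2 = r * s / q" by (simp add: q_eq power2_eq_square)
  then show "(s\<^sup>2) ^ l3 r s = 1" using rs q by (simp add: power_divide)
qed

lemma basis_rep_M3:
  assumes [simp]: "e1 \<noteq> 0" "e2 \<noteq> 0" "e3 \<noteq> 0"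
  shows "basis_rep r s {..<l3 r s} (act_M3 r s (e1, e2, e3))"
proof (rule basis_rep_monomial[where \<sigma> = shift3 and c = "coef3 e1 e2 e3"])
  let ?I = "{..<l3 r s}"
  show "act_M3 r s (e1, e2, e3) g a = single (shift3 g a) (coef3 e1 e2 e3 g a)" for g a
    by (rule act_M3_eq)
  show "shift3 g a \<in> ?I" if "a \<in> ?I" for g a
    using that l3_pos by (auto simp: shift3_def split: gen.split)
  have pw: "x ^ (Suc a mod l3 r s) = x ^ a * x" "x ^ (Suc (Suc a) mod l3 r s) = x ^ a * (x * x)"
    if "x \<in> {r * s, q, s\<^sup>2}" for x a
    using that power_l3 power_mod_period[of x "l3 r s"] by (auto simp: mult_ac)
  note pw' = pw[of "r * s", simplified] pw[of q, simplified] pw[of "s\<^sup>2", simplified]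
  have mods: "Suc (Suc a mod l3 r s) mod l3 r s = Suc (Suc a) mod l3 r s"
    "Suc (Suc (Suc a mod l3 r s)) mod l3 r s = Suc (Suc (Suc a)) mod l3 r s"
    "Suc (Suc (Suc a) mod l3 r s) mod l3 r s = Suc (Suc (Suc a)) mod l3 r s" for a
    by (metis mod_Suc_eq)+
  show "shift3 h (shift3 g a) = shift3 g (shift3 h a) \<and>
      coef3 e1 e2 e3 g a * coef3 e1 e2 e3 h (shift3 g a) = k * (coef3 e1 e2 e3 h a * coef3 e1 e2 e3 g (shift3 h a))"
    if rel: "(g, h, k) \<in> {(GW, GX1, r powi (-2)), (GX2, GX1, s powi (-2)),
        (GX3, GX1, (r * s) powi (-2)), (GX3, GX2, (r * s) powi (-1)), (GW, GX3, r * s)}" for g h k a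
  proof -
    consider "g = GW" "h = GX1" "k = 1 / r\<^sup>2" | "g = GX2" "h = GX1" "k = 1 / s\<^sup>2"
      | "g = GX3" "h = GX1" "k = 1 / (r\<^sup>2 * s\<^sup>2)" | "g = GX3" "h = GX2" "k = 1 / (r * s)"
      | "g = GW" "h = GX3" "k = r * s"
      using rel by (auto simp: power_int_minus divide_inverse power_mult_distrib)
    then show ?thesis
    proof cases
      case 1
      have "r\<^sup>2 = s\<^sup>2 * (q * q)" by (simp add: q_eq power2_eq_square)
      then show ?thesis unfolding 1
        by (simp add: shift3_def coef3_def pw' mods mult_ac)
    next
      case 2
      show ?thesis unfolding 2 by (simp add: shift3_def coef3_def pw' mods mult_ac)
    next
      case 3
      have "r\<^sup>2 * s\<^sup>2 = (r * s) * (r * s)" by (simp add: power2_eq_square)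
      then show ?thesis unfolding 3 by (simp add: shift3_def coef3_def pw' mods)
    next
      case 4
      show ?thesis unfolding 4 by (simp add: shift3_def coef3_def pw')
    next
      case 5
      show ?thesis unfolding 5 by (simp add: shift3_def coef3_def pw' mods)
    qed
  qed
  show "shift3 GX2 (shift3 GW a) = shift3 GX1 (shift3 GX3 a) \<and> shift3 GW (shift3 GX2 a) = shift3 GX1 (shift3 GX3 a) \<and>
        coef3 e1 e2 e3 GW a * coef3 e1 e2 e3 GX2 (shift3 GW a) =
        coef3 e1 e2 e3 GX2 a * coef3 e1 e2 e3 GW (shift3 GX2 a)
          + s^2 * (r^2 - s^2) * (coef3 e1 e2 e3 GX3 a * coef3 e1 e2 e3 GX1 (shift3 GX3 a))" for a
  proof -
    have "(r * s) ^ a / (s\<^sup>2) ^ a = q ^ a"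
      by (simp add: q_eq power_mult_distrib power_divide power2_eq_square)
    then have "\<gamma> * (coef3 e1 e2 e3 GX3 a * coef3 e1 e2 e3 GX1 (shift3 GX3 a)) = e1\<^sup>2 * e3 * (1 - q) * q ^ a"
      by (simp add: shift3_def coef3_def field_simps)
    then show ?thesis unfolding \<gamma>_def[symmetric]
      by (simp add: shift3_def coef3_def pw' mods power2_eq_square algebra_simps)
  qed
qed

end

section \<open>The three families are simple\<close>

lemma free_act_two_gens:
  assumes "\<And>g i. T g i = single (\<sigma> g i) (c g i)"
  shows "free_act T (single i x) (free_gen g * free_gen h) =
    single (\<sigma> h (\<sigma> g i)) (x * (c g i * c h (\<sigma> g i)))"
  by (simp add: free_act_mult assms mult_ac)

lemma free_act_power_diagonal:
  assumes "free_act T (single i 1) p = single i c"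
  shows "free_act T (single i 1) (p ^ k) = single i (c ^ k)"
proof (induction k)
  case (Suc k)
  have "free_act T (single i 1) (p ^ Suc k) =
      free_act T (scale_pm c (single i 1)) (p ^ k)"
    using assms by (simp add: free_act_mult)
  also have "\<dots> = single i (c ^ Suc k)"
    unfolding free_act_scale_vector Suc by simp
  finally show ?case .
qed simp

text \<open>Dividing the two equalities shows that n divides the difference of the
  exponents.\<close>

lemma pair_power_inj:
  fixes x y :: complex
  assumes "\<And>d. n dvd d \<longleftrightarrow> x ^ d = 1 \<and> y ^ d = 1" and [simp]: "x \<noteq> 0" "y \<noteq> 0"
    and "x ^ i = x ^ j" "y ^ i = y ^ j" "i < n" "j < n"
  shows "i = j"
  using assms(4-)
proof (induction i j rule: linorder_wlog)
  case (le i j)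
  then have "x ^ (j - i) = 1" "y ^ (j - i) = 1"
    using power_eq_power_imp_power_diff_eq_one by (metis assms(2,3))+
  then have "n dvd j - i" using assms(1) by blast
  with le show ?case by (auto dest: dvd_imp_le)
next
  case (sym i j)
  then show ?case by simp
qed

context root_params
begin

section \<open>Simplicity of the first family\<close>

definition xt :: free_alg where
  "xt = free_gen GW * free_gen GX2 - free_const (\<gamma> / (1 - q)) * (free_gen GX3 * free_gen GX1)"

lemma Xtilde_eq: "Xtilde r s = class_B r s xt"
  by (simp only: Xtilde_def xt_def \<gamma>_def q_def)

lemma free_act_xt:
  assumes "\<And>g i. T g i = single (\<sigma> g i) (c g i)"
    and "\<sigma> GX2 (\<sigma> GW i) = j" "\<sigma> GX1 (\<sigma> GX3 i) = j"
  shows "free_act T (single i 1) xt = single j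
    (c GW i * c GX2 (\<sigma> GW i) - \<gamma> / (1 - q) * (c GX3 i * c GX1 (\<sigma> GX3 i)))"
  using assms(2,3)
  by (simp add: xt_def free_act_diff free_act_two_gens[of T, OF assms(1)] free_act_mult[of _ _ "free_const _"]
      flip: single_diff)

context
  fixes k1 k2 k3 k4 :: complex
  assumes k: "k1 \<noteq> 0" "k2 \<noteq> 0" "k3 \<noteq> 0"
begin

private abbreviation "T1 \<equiv> act_M1 r s (k1, k2, k3, k4)"

private lemma T1_eq: "T1 g i = single (shift1 g i) (coef1 k1 k2 k3 k4 g i)"
  by (cases i) (simp only: act_M1_eq)

private lemma lin_ext_T1: "lin_ext (T1 g) (single i x) =
    single (shift1 g i) (x * coef1 k1 k2 k3 k4 g i)"
  by (simp only: lin_ext_single T1_eq scale_pm_single)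

private lemma reaches_T1: "shift1 g i = j \<Longrightarrow> coef1 k1 k2 k3 k4 g i \<noteq> 0 \<Longrightarrow> reaches T1 i j"
  using reaches_gen[of T1 g i, OF T1_eq] by blast

text \<open>The dependence of W X2 on b is exactly the subtracted multiple of X3 X1, so only a
  remains. The condition on \<open>k4\<close> in \<open>params_M1\<close> says that this eigenvalue
  is nonzero.\<close>

lemma M1_xt:
  assumes "a < l1 r s" "b < m"
  shows "free_act T1 (single (a, b) 1) xt =
    single (a, b) (A ^ a * (k4 - \<gamma> / (1 - q) * k3))"
proof -
  note M = M1_products[OF assms k(1,2)]
  have "wt k3 k4 b - \<gamma> / (1 - q) * (q ^ b * k3) = k4 - \<gamma> / (1 - q) * k3"
  proof -
    have "wt k3 k4 b = k4 - \<gamma> / (1 - q) * (1 - q ^ b) * k3" by (simp add: wt_def)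
    then show ?thesis by (simp add: algebra_simps diff_divide_distrib)
  qed
  then have "A ^ a * wt k3 k4 b - \<gamma> / (1 - q) * (A ^ a * q ^ b * k3) = A ^ a * (k4 - \<gamma> / (1 - q) * k3)"
    by (simp only: mult.left_commute mult.assoc flip: right_diff_distrib)
  then show ?thesis
    using free_act_xt[of T1 shift1 "coef1 k1 k2 k3 k4", OF T1_eq M(1,3)] unfolding M by simp
qed

lemma M1_X3X1:
  assumes "a < l1 r s" "b < m"
  shows "free_act T1 (single (a, b) 1) (free_gen GX3 * free_gen GX1) =
    single (a, b) (A ^ a * q ^ b * k3)"
  using M1_products[OF assms k(1,2)] by (simp add: free_act_two_gens[of T1, OF T1_eq])

lemma M1_X2_power:
  "b + j < m \<Longrightarrow> free_act T1 (single (a, b) x) (free_gen GX2 ^ j) =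
    single (a, b + j) (x * k2 ^ j)"
  by (induction j)
    (auto simp: power_Suc2 free_act_mult lin_ext_T1 shift1_def coef1_def mult.assoc simp del: power_Suc lin_ext_single)

lemma M1_X2_power_m:
  assumes "b < m"
  shows "free_act T1 (single (a, b) 1) (free_gen GX2 ^ m) =
    single (a, b) (k2 ^ m * S ^ a)"
proof -
  \<comment> \<open>The path splits at the wrap-around: up to m - 1, one step to 0 with factor
    \<open>S ^ a\<close>, then b steps back to the start.\<close>
  have m: "m = (m - 1 - b) + (Suc b)" using assms by simp
  have "free_gen GX2 ^ m = free_gen GX2 ^ (m - 1 - b) * (free_gen GX2 * free_gen GX2 ^ b)"
    by (subst m) (simp only: power_add power_Suc)
  then have "free_act T1 (single (a, b) 1) (free_gen GX2 ^ m) =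
    single (a, b) (k2 ^ (m - 1 - b) * (S ^ a * k2) * k2 ^ b)"
    using assms M1_X2_power[of b "m - 1 - b" a 1] M1_X2_power[of 0 b a]
    by (simp add: free_act_mult lin_ext_T1 shift1_def coef1_def mult_ac del: lin_ext_single)
  also have "k2 ^ (m - 1 - b) * (S ^ a * k2) * k2 ^ b = k2 ^ ((m - 1 - b) + (Suc b)) * S ^ a"
    by (simp only: power_add power_Suc mult_ac)
  finally show ?thesis using m by simp
qed

lemma M1_X2_power_nonzero:
  "\<exists>i c. c \<noteq> 0 \<and> free_act T1 (single (0, 0) 1) (free_gen GX2 ^ j) = single i c"
proof (induction j)
  case 0
  show ?case by (intro exI[of _ "(0, 0)"] exI[of _ 1]) simp
next
  case (Suc j)
  then obtain i c where "c \<noteq> 0"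
    "free_act T1 (single (0, 0) 1) (free_gen GX2 ^ j) = single i c" by blast
  then show ?case using k
    by (intro exI[of _ "shift1 GX2 i"] exI[of _ "c * coef1 k1 k2 k3 k4 GX2 i"])
      (auto simp: power_Suc2 free_act_mult lin_ext_T1 coef1_def split: prod.split
        simp del: power_Suc lin_ext_single)
qed

text \<open>Eigenvalues are proportional to A^a for \<open>xt\<close>, A^a q^b for X3 X1 and S^a for
  X2^m. The pair A^a, S^a determines a, and q^b determines b. X2 runs cyclically through b and X1
  through a.\<close>

lemma simple_M1:
  assumes k4: "k4 \<noteq> \<gamma> / (1 - q) * k3"
  shows "simple_right_module (alg_B r s) (mod_M1 r s (k1, k2, k3, k4))"
proof -
  let ?I = "{..<l1 r s} \<times> {..<m1 r s}"
  interpret basis_rep r s ?I T1 by (rule basis_rep_M1[OF k(1,2)])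
  show ?thesis unfolding mod_M1_def
  proof (rule simple_basis_module)
    show "?I \<noteq> {}" using l1_pos m_pos by (auto simp: m1_eq)
  next
    fix i j assume ij: "i \<in> ?I" "j \<in> ?I" "i \<noteq> j"
    obtain a b a' b' where i: "i = (a, b)" "a < l1 r s" "b < m" and j: "j = (a', b')" "a' < l1 r s" "b' < m"
      using ij by (auto simp: m1_eq)
    have "A ^ a \<noteq> A ^ a' \<or> A ^ a = A ^ a' \<and> q ^ b \<noteq> q ^ b' \<or> S ^ a \<noteq> S ^ a'"
    proof (rule ccontr)
      assume "\<not> ?thesis"
      then have eq: "A ^ a = A ^ a'" "q ^ b = q ^ b'" "S ^ a = S ^ a'" by auto
      then have "a = a'" "b = b'"
        using pair_power_inj[OF l1_dvd_iff, of a a'] q_power_inj[of b b'] i j by auto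
      with ij i j show False by simp
    qed
    then show "\<exists>p \<chi>. \<chi> i \<noteq> \<chi> j \<and> (\<forall>k\<in>?I. free_act T1 (single k 1) p = single k (\<chi> k))"
    proof (elim disjE)
      assume "A ^ a \<noteq> A ^ a'"
      with k4 show ?thesis unfolding i j
        by (intro exI[of _ xt] exI[of _ "\<lambda>(a, b). A ^ a * (k4 - \<gamma> / (1 - q) * k3)"])
          (auto simp: M1_xt m1_eq)
    next
      assume "A ^ a = A ^ a' \<and> q ^ b \<noteq> q ^ b'"
      with k show ?thesis unfolding i j
        by (intro exI[of _ "free_gen GX3 * free_gen GX1"] exI[of _ "\<lambda>(a, b). A ^ a * q ^ b * k3"])
          (auto simp: M1_X3X1 m1_eq)
    next
      assume "S ^ a \<noteq> S ^ a'"
      with k show ?thesis unfolding i j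
        by (intro exI[of _ "free_gen GX2 ^ m"] exI[of _ "\<lambda>(a, b). k2 ^ m * S ^ a"])
          (auto simp: M1_X2_power_m m1_eq)
    qed
  next
    fix i j assume ij: "i \<in> ?I" "j \<in> ?I"
    obtain a b a' b' where i: "i = (a, b)" "a < l1 r s" "b < m" and j: "j = (a', b')" "a' < l1 r s" "b' < m"
      using ij by (auto simp: m1_eq)
    have "reaches T1 (a, b) (a, b')"
    proof (rule reaches_cyclic[where n = m and f = "Pair a"])
      fix b assume "b < m"
      then have "shift1 GX2 (a, b) = (a, Suc b mod m)"
        by (cases "Suc b = m") (auto simp: shift1_def)
      moreover have "coef1 k1 k2 k3 k4 GX2 (a, b) \<noteq> 0" using k by (simp add: coef1_def)
      ultimately show "reaches T1 (a, b) (a, Suc b mod m)" by (rule reaches_T1)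
    qed (use i j in auto)
    moreover have "reaches T1 (a, b') (a', b')"
    proof (rule reaches_cyclic[where n = "l1 r s" and f = "\<lambda>a. (a, b')"])
      fix a
      have "shift1 GX1 (a, b') = (Suc a mod l1 r s, b')" by (simp add: shift1_def)
      moreover have "coef1 k1 k2 k3 k4 GX1 (a, b') \<noteq> 0" using k by (simp add: coef1_def)
      ultimately show "reaches T1 (a, b') (Suc a mod l1 r s, b')" by (rule reaches_T1)
    qed (use i j in auto)
    ultimately show "\<exists>p c. c \<noteq> 0 \<and> free_act T1 (single i 1) p = single j c"
      unfolding i j reaches_def[symmetric] by (rule reaches_trans)
  qed
qed

end

section \<open>Simplicity of the second family\<close>

lemma wt'_Suc_eq: "wt' (Suc b) = \<gamma> / (1 - 1 / q) + \<gamma> / (1 - q) * (1 / q ^ b)"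
proof -
  have "1 / q \<noteq> 1" using q_neq_one by simp
  then have "(1 / q) / (1 - 1 / q) = - 1 / (1 - q)" using q_neq_one by (simp add: field_simps)
  moreover have "wt' (Suc b) = \<gamma> / (1 - 1 / q) - \<gamma> * ((1 / q) ^ b * ((1 / q) / (1 - 1 / q)))"
    by (simp only: wt'_def power_Suc2 times_divide_eq_right diff_divide_distrib right_diff_distrib mult_1_right)
  ultimately show ?thesis
    by (simp only:) (simp add: power_divide)
qed

context
  fixes u1 u2 u3 :: complex
  assumes u: "u1 \<noteq> 0" "u2 \<noteq> 0"
begin

private abbreviation "T2 \<equiv> act_M2 r s (u1, u2, u3)"

private lemma T2_eq: "T2 g i = single (shift2 u3 g i) (coef2 u1 u2 u3 g i)"
  by (cases i) (simp only: act_M2_eq)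

private lemma lin_ext_T2: "lin_ext (T2 g) (single i x) =
    single (shift2 u3 g i) (x * coef2 u1 u2 u3 g i)"
  by (simp only: lin_ext_single T2_eq scale_pm_single)

private lemma reaches_T2: "shift2 u3 g i = j \<Longrightarrow> coef2 u1 u2 u3 g i \<noteq> 0 \<Longrightarrow> reaches T2 i j"
  using reaches_gen[of T2 g i, OF T2_eq] by blast

text \<open>In \<open>wt'_Suc_eq\<close> the part depending on b is \<gamma> / (1 - q) times the
  eigenvalue of X3 X1, so subtracting it leaves a constant. That constant is nonzero, hence X-tilde
  is not torsion here.\<close>

lemma M2_xt:
  assumes "a < L" "b < m2 r s u3"
  shows "free_act T2 (single (a, b) 1) xt =
    single (a, b) (A ^ a * (\<gamma> / (1 - 1 / q)) * u2)"
proof -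
  note M = M2_products[OF assms u]
  note wt'_Suc_eq[of b]
  then have "A ^ a * wt' (Suc b) * u2 - \<gamma> / (1 - q) * (A ^ a / q ^ b * u2) = A ^ a * (\<gamma> / (1 - 1 / q)) * u2"
    by (simp only:) (simp add: algebra_simps)
  then show ?thesis
    using free_act_xt[of T2 "shift2 u3" "coef2 u1 u2 u3", OF T2_eq M(1,3)] unfolding M by simp
qed

lemma M2_X3X1:
  assumes "a < L" "b < m2 r s u3"
  shows "free_act T2 (single (a, b) 1) (free_gen GX3 * free_gen GX1) =
    single (a, b) (A ^ a / q ^ b * u2)"
  using M2_products[OF assms u] by (simp add: free_act_two_gens[of T2, OF T2_eq])

lemma M2_X1_power:
  "a < L \<Longrightarrow> free_act T2 (single (a, b) x) (free_gen GX1 ^ j) =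
    single ((a + j) mod L, b) (x * (u1 / (r\<^sup>2) ^ b) ^ j)"
  by (induction j)
    (auto simp: power_Suc2 free_act_mult lin_ext_T2 shift2_def coef2_def mod_Suc_eq mult_ac simp del: power_Suc lin_ext_single)

text \<open>X2 lowers b by one and kills b = 0. The exponent \<open>m2\<close> therefore annihilates
  all basis vectors at once, which gives torsion.\<close>

lemma M2_X2_power: "j > b \<Longrightarrow> free_act T2 (single (a, b) x) (free_gen GX2 ^ j) = 0"
proof (induction j arbitrary: b x)
  case (Suc j)
  show ?case
  proof (cases b)
    case 0
    then show ?thesis by (simp add: free_act_mult lin_ext_T2 coef2_def del: lin_ext_single)
  next
    case (Suc b')
    with Suc.IH[of b'] Suc.prems show ?thesis by (simp add: free_act_mult lin_ext_T2 shift2_def del: lin_ext_single)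
  qed
qed simp

text \<open>The index a is read off from A^a by \<open>xt\<close>; b from q^b by X3 X1 and from
  r^(2Lb) by X1^L, where q^b alone decides if u3 = 0. In that case W climbs a chain that does not
  close, and X2 leads down again.\<close>

lemma simple_M2: "simple_right_module (alg_B r s) (mod_M2 r s (u1, u2, u3))"
proof -
  let ?I = "{..<l2 r s} \<times> {..<m2 r s u3}"
  interpret basis_rep r s ?I T2 by (rule basis_rep_M2[OF u])
  show ?thesis unfolding mod_M2_def snd_conv
  proof (rule simple_basis_module)
    show "?I \<noteq> {}" using L_pos m2_gt_2[of u3] by (auto simp: l2_eq intro: exI[of _ 0])
  next
    fix i j assume ij: "i \<in> ?I" "j \<in> ?I" "i \<noteq> j"
    obtain a b a' b' where i: "i = (a, b)" "a < L" "b < m2 r s u3" and j: "j = (a', b')" "a' < L" "b' < m2 r s u3"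
      using ij by (auto simp: l2_eq)
    define R where "R = r ^ (2 * L)"
    have "A ^ a \<noteq> A ^ a' \<or> A ^ a = A ^ a' \<and> q ^ b \<noteq> q ^ b' \<or> R ^ b \<noteq> R ^ b'"
    proof (rule ccontr)
      assume "\<not> ?thesis"
      then have eq: "A ^ a = A ^ a'" "q ^ b = q ^ b'" "R ^ b = R ^ b'" by auto
      have "b = b'"
      proof (cases "u3 = 0")
        case True
        then have "m2 r s u3 = m" by (simp add: m2_eq)
        with eq i j show ?thesis using q_power_inj by simp
      next
        case False
        show ?thesis
          by (rule pair_power_inj[OF m2_dvd_iff[OF False, folded R_def]]) (use eq i j in \<open>auto simp: R_def\<close>)
      qed
      moreover have "a = a'" using eq i j A_power_inj by blast
      ultimately show False using ij i j by simp
    qed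
    then show "\<exists>p \<chi>. \<chi> i \<noteq> \<chi> j \<and> (\<forall>k\<in>?I. free_act T2 (single k 1) p = single k (\<chi> k))"
    proof (elim disjE)
      assume "A ^ a \<noteq> A ^ a'"
      moreover have "1 / q \<noteq> 1" using q_neq_one by simp
      ultimately show ?thesis using u unfolding i j
        by (intro exI[of _ xt] exI[of _ "\<lambda>(a, b). A ^ a * (\<gamma> / (1 - 1 / q)) * u2"])
          (auto simp: M2_xt l2_eq)
    next
      assume "A ^ a = A ^ a' \<and> q ^ b \<noteq> q ^ b'"
      with u show ?thesis unfolding i j
        by (intro exI[of _ "free_gen GX3 * free_gen GX1"] exI[of _ "\<lambda>(a, b). A ^ a / q ^ b * u2"])
          (auto simp: M2_X3X1 l2_eq)
    next
      assume "R ^ b \<noteq> R ^ b'"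
      moreover have "((r\<^sup>2) ^ b) ^ L = R ^ b" for b
        unfolding R_def power_mult[symmetric] by (rule arg_cong[of _ _ "power r"]) simp
      ultimately show ?thesis using u unfolding i j
        by (intro exI[of _ "free_gen GX1 ^ L"] exI[of _ "\<lambda>(a, b). (u1 / (r\<^sup>2) ^ b) ^ L"])
          (auto simp: M2_X1_power l2_eq power_divide)
    qed
  next
    fix i j assume ij: "i \<in> ?I" "j \<in> ?I"
    obtain a b a' b' where i: "i = (a, b)" "a < L" "b < m2 r s u3" and j: "j = (a', b')" "a' < L" "b' < m2 r s u3"
      using ij by (auto simp: l2_eq)
    have "reaches T2 (a, b) (a, b')"
    proof (cases "u3 = 0")
      case True
      then have n: "m2 r s u3 = m" by (simp add: m2_eq)
      have "reaches T2 (a, b) (a, 0)" if "b < m" for b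
        using that
      proof (induction b)
        case (Suc b)
        have "\<not> m dvd Suc b" using Suc.prems by (auto dest: dvd_imp_le)
        then have "coef2 u1 u2 u3 GX2 (a, Suc b) \<noteq> 0" using u by (simp add: coef2_def wt'_eq_zero_iff)
        moreover have "shift2 u3 GX2 (a, Suc b) = (a, b)" by (simp add: shift2_def)
        ultimately have "reaches T2 (a, Suc b) (a, b)" by (intro reaches_T2)
        with Suc show ?case using reaches_trans by fastforce
      qed simp
      moreover have "reaches T2 (a, 0) (a, b)" if "b < m" for b
        using that
      proof (induction b)
        case (Suc b)
        then have "shift2 u3 GW (a, b) = (a, Suc b)" "coef2 u1 u2 u3 GW (a, b) \<noteq> 0"
          by (auto simp: coef2_def shift2_def n)
        then have "reaches T2 (a, b) (a, Suc b)" by (rule reaches_T2)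
        with Suc show ?case using reaches_trans by fastforce
      qed simp
      ultimately show ?thesis using i j n reaches_trans by metis
    next
      case False
      show ?thesis
      proof (rule reaches_cyclic[where n = "m2 r s u3" and f = "Pair a"])
        fix b assume "b < m2 r s u3"
        then have "shift2 u3 GW (a, b) = (a, Suc b mod m2 r s u3)"
          by (cases "Suc b = m2 r s u3") (auto simp: shift2_def)
        moreover have "coef2 u1 u2 u3 GW (a, b) \<noteq> 0" using False by (simp add: coef2_def)
        ultimately show "reaches T2 (a, b) (a, Suc b mod m2 r s u3)" by (rule reaches_T2)
      qed (use i j in auto)
    qed
    moreover have "reaches T2 (a, b') (a', b')"
    proof (rule reaches_cyclic[where n = L and f = "\<lambda>a. (a, b')"])
      fix a
      have "shift2 u3 GX1 (a, b') = (Suc a mod L, b')" by (simp add: shift2_def)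
      moreover have "coef2 u1 u2 u3 GX1 (a, b') \<noteq> 0" using u by (simp add: coef2_def)
      ultimately show "reaches T2 (a, b') (Suc a mod L, b')" by (rule reaches_T2)
    qed (use i j in auto)
    ultimately show "\<exists>p c. c \<noteq> 0 \<and> free_act T2 (single i 1) p = single j c"
      unfolding i j reaches_def[symmetric] by (rule reaches_trans)
  qed
qed

end

section \<open>Simplicity of the third family\<close>

context
  fixes e1 e2 e3 :: complex
  assumes e: "e1 \<noteq> 0" "e2 \<noteq> 0" "e3 \<noteq> 0"
begin

private abbreviation "T3 \<equiv> act_M3 r s (e1, e2, e3)"

private lemma lin_ext_T3: "lin_ext (T3 g) (single a x) =
    single (shift3 g a) (x * coef3 e1 e2 e3 g a)"
  by (simp only: lin_ext_single act_M3_eq scale_pm_single)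

private lemma reaches_T3: "shift3 g i = j \<Longrightarrow> coef3 e1 e2 e3 g i \<noteq> 0 \<Longrightarrow> reaches T3 i j"
  using reaches_gen[of T3 g i, OF act_M3_eq] by blast

lemma M3_xt: "free_act T3 (single a 1) xt = 0"
proof -
  have eq: "shift3 GX2 (shift3 GW a) = (a + 2) mod l3 r s" "shift3 GX1 (shift3 GX3 a) = (a + 2) mod l3 r s"
    by (simp_all add: shift3_def mod_Suc_eq)
  have "(r * s) ^ a / (s\<^sup>2) ^ a = q ^ a"
    by (simp add: q_eq power_mult_distrib power_divide power2_eq_square)
  then have "coef3 e1 e2 e3 GW a * coef3 e1 e2 e3 GX2 (shift3 GW a) -
      \<gamma> / (1 - q) * (coef3 e1 e2 e3 GX3 a * coef3 e1 e2 e3 GX1 (shift3 GX3 a)) = 0"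
    using e q_neq_one by (simp add: shift3_def coef3_def field_simps power2_eq_square)
  then show ?thesis
    using free_act_xt[of T3 shift3 "coef3 e1 e2 e3", OF act_M3_eq eq] by simp
qed

lemma M3_X2_power:
  "a < l3 r s \<Longrightarrow> free_act T3 (single a x) (free_gen GX2 ^ j) =
    single ((a + j) mod l3 r s) (x * e1 ^ j)"
  by (induction j)
    (auto simp: power_Suc2 free_act_mult lin_ext_T3 shift3_def coef3_def mod_Suc_eq mult.assoc simp del: power_Suc lin_ext_single)

lemma simple_M3: "simple_right_module (alg_B r s) (mod_M3 r s (e1, e2, e3))"
proof -
  let ?I = "{..<l3 r s}"
  interpret basis_rep r s ?I T3 by (rule basis_rep_M3[OF e])
  show ?thesis unfolding mod_M3_def
  proof (rule simple_basis_module)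
    show "?I \<noteq> {}" using l3_pos by auto
  next
    fix a b assume ab: "a \<in> ?I" "b \<in> ?I" "a \<noteq> b"
    then have "(r * s) ^ a \<noteq> (r * s) ^ b \<or> q ^ a \<noteq> q ^ b"
      using pair_power_inj[OF l3_dvd_iff, of a b] by auto
    then show "\<exists>p \<chi>. \<chi> a \<noteq> \<chi> b \<and> (\<forall>k\<in>?I. free_act T3 (single k 1) p = single k (\<chi> k))"
    proof
      assume "(r * s) ^ a \<noteq> (r * s) ^ b"
      with e show ?thesis
        by (intro exI[of _ "free_gen GX3"] exI[of _ "\<lambda>a. (r * s) ^ a * e2"])
          (auto simp: lin_ext_T3 shift3_def coef3_def simp del: lin_ext_single)
    next
      assume "q ^ a \<noteq> q ^ b"
      moreover have "Suc (l3 r s - Suc 0) = l3 r s" using l3_pos by simp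
      then have "(Suc a mod l3 r s + (l3 r s - Suc 0)) mod l3 r s = a" if "a < l3 r s" for a
        using cyclic_pred_succ[OF that] l3_pos by simp
      \<comment> \<open>W advances one step and X2^(l3 - 1) completes the cycle, so their product is
        diagonal; its eigenvalue inherits q^a from W.\<close>
      ultimately show ?thesis using e l3_pos
        by (intro exI[of _ "free_gen GW * free_gen GX2 ^ (l3 r s - 1)"]
              exI[of _ "\<lambda>a. e1 * e3 * q ^ a * e1 ^ (l3 r s - 1)"])
          (auto simp: lin_ext_T3 shift3_def coef3_def free_act_mult M3_X2_power simp del: lin_ext_single)
    qed
  next
    fix a b assume ab: "a \<in> ?I" "b \<in> ?I"
    have "reaches T3 a b"
    proof (rule reaches_cyclic[where n = "l3 r s" and f = "\<lambda>a. a"])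
      fix a
      have "shift3 GX2 a = Suc a mod l3 r s" by (simp add: shift3_def)
      moreover have "coef3 e1 e2 e3 GX2 a \<noteq> 0" using e by (simp add: coef3_def)
      ultimately show "reaches T3 a (Suc a mod l3 r s)" by (rule reaches_T3)
    qed (use ab in auto)
    then show "\<exists>p c. c \<noteq> 0 \<and> free_act T3 (single a 1) p = single b c"
      by (simp only: reaches_def)
  qed
qed

end

end

section \<open>Commutation up to scalars\<close>

text \<open>Equality in the quotient, kept on representatives. The scalars multiply under products
  in either argument, so commutation of monomials becomes arithmetic with scalars.\<close>

definition qcommute :: "complex \<Rightarrow> complex \<Rightarrow> complex \<Rightarrow> free_alg \<Rightarrow> free_alg \<Rightarrow> bool" where
  "qcommute r s c x y \<longleftrightarrow> class_B r s (x * y) = class_B r s (free_const c * (y * x))"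

lemma qcommute_iff: "qcommute r s c x y \<longleftrightarrow> x * y - free_const c * (y * x) \<in> ideal_B r s"
  by (simp add: qcommute_def class_B_eq_iff)

lemma qcommute_refl: "qcommute r s 1 x x"
  by (simp add: qcommute_def)

text \<open>The relator of the product is written as a sum of two-sided multiples of the given
  relators. The next lemmas proceed in the same way.\<close>

lemma qcommute_mult_right:
  assumes "qcommute r s c x y" "qcommute r s d x z" shows "qcommute r s (c * d) x (y * z)"
proof -
  have "x * (y * z) - free_const (c * d) * (y * z * x) =
      (x * y - free_const c * (y * x)) * z + free_const c * y * (x * z - free_const d * (z * x))"
    by (simp add: free_alg_normalize)
  with assms show ?thesis by (simp add: qcommute_iff ideal_B_closed)
qed

lemma qcommute_mult_left:
  assumes "qcommute r s c x z" "qcommute r s d y z" shows "qcommute r s (c * d) (x * y) z"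
proof -
  have "x * y * z - free_const (c * d) * (z * (x * y)) =
      x * (y * z - free_const d * (z * y)) + free_const d * ((x * z - free_const c * (z * x)) * y)"
    by (simp add: free_alg_normalize)
  with assms show ?thesis by (simp add: qcommute_iff ideal_B_closed)
qed

lemma qcommute_diff_left:
  assumes "qcommute r s c x z" "qcommute r s c y z" shows "qcommute r s c (x - free_const k * y) z"
proof -
  have "(x - free_const k * y) * z - free_const c * (z * (x - free_const k * y)) =
      (x * z - free_const c * (z * x)) + free_const (- k) * (y * z - free_const c * (z * y))"
    by (simp add: free_alg_normalize)
  with assms show ?thesis by (simp add: qcommute_iff ideal_B_closed)
qed

lemma qcommute_sym:
  assumes "qcommute r s c x y" "c \<noteq> 0" shows "qcommute r s (1 / c) y x"
proof -
  have "y * x - free_const (1 / c) * (x * y) = free_const (- 1 / c) * (x * y - free_const c * (y * x))"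
    using assms(2) by (simp add: free_alg_normalize)
  with assms show ?thesis by (simp add: qcommute_iff ideal_B_closed)
qed

lemma qcommute_power_right: "qcommute r s c x y \<Longrightarrow> qcommute r s (c ^ n) x (y ^ n)"
proof (induction n)
  case 0
  show ?case by (simp add: qcommute_def)
next
  case (Suc n)
  then show ?case by (simp add: qcommute_mult_right)
qed

lemma qcommute_power_left: "qcommute r s c x y \<Longrightarrow> qcommute r s (c ^ n) (x ^ n) y"
proof (induction n)
  case 0
  show ?case by (simp add: qcommute_def)
next
  case (Suc n)
  then show ?case by (simp add: qcommute_mult_left)
qed

text \<open>Supplies parameters of the models: scaling a chain by powers of a root of its cycle
  eigenvalue makes it close up.\<close>

lemma complex_root_exists: assumes "n > 0" obtains z :: complex where "z ^ n = c"
proof -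
  have "degree (monom 1 n + [:- c:]) = n"
    using assms by (subst degree_add_eq_left) (simp_all add: degree_monom_eq)
  then have "\<not> constant (poly (monom 1 n + [:- c:]))" using assms by (simp add: constant_degree)
  then obtain z where "poly (monom 1 n + [:- c:]) z = 0" using fundamental_theorem_of_algebra by blast
  then have "z ^ n = c" by (simp add: poly_monom)
  with that show ?thesis .
qed

context root_params
begin

section \<open>The relations as commutations up to scalars, and the normal element\<close>

abbreviation "X1 \<equiv> free_gen GX1"
abbreviation "X2 \<equiv> free_gen GX2"
abbreviation "X3 \<equiv> free_gen GX3"
abbreviation "W \<equiv> free_gen GW"
abbreviation "qc \<equiv> qcommute r s"
abbreviation \<tau> :: complex where "\<tau> \<equiv> \<gamma> / (1 - q)"

text \<open>In the first two families X3 itself shifts the basis; this product is the diagonal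
  element standing for it. It passes every generator up to a scalar.\<close>

definition Z :: free_alg where "Z = X3 * X1"

lemma relators_in_ideal:
  "W * X1 - free_const (r powi (-2)) * (X1 * W) \<in> ideal_B r s"
  "X2 * X1 - free_const (s powi (-2)) * (X1 * X2) \<in> ideal_B r s"
  "X3 * X1 - free_const ((r * s) powi (-2)) * (X1 * X3) \<in> ideal_B r s"
  "X3 * X2 - free_const ((r * s) powi (-1)) * (X2 * X3) \<in> ideal_B r s"
  "W * X3 - free_const (r * s) * (X3 * W) \<in> ideal_B r s"
  "W * X2 - (X2 * W + free_const (s^2 * (r^2 - s^2)) * (X3 * X1)) \<in> ideal_B r s"
  using relations_subset_ideal_B[of r s] unfolding relations_B_def Let_def by blast+

lemma W_X2_relator: "W * X2 - (X2 * W + free_const \<gamma> * Z) \<in> ideal_B r s"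
  using relators_in_ideal(6) by (simp only: Z_def \<gamma>_def)

lemma qc_gens:
  "qc (1 / r\<^sup>2) W X1" "qc (1 / s\<^sup>2) X2 X1" "qc (1 / A) X3 X1" "qc (1 / (r * s)) X3 X2" "qc (r * s) W X3"
proof -
  have "r powi (-2) = 1 / r\<^sup>2" "s powi (-2) = 1 / s\<^sup>2" "(r * s) powi (-2) = 1 / A" "(r * s) powi (-1) = 1 / (r * s)"
    by (simp_all add: power_int_minus divide_inverse A_def power_mult_distrib)
  with relators_in_ideal
  show "qc (1 / r\<^sup>2) W X1" "qc (1 / s\<^sup>2) X2 X1" "qc (1 / A) X3 X1" "qc (1 / (r * s)) X3 X2" "qc (r * s) W X3"
    by (simp_all only: qcommute_iff)
qed

lemma qc_gens_sym:
  "qc (r\<^sup>2) X1 W" "qc (s\<^sup>2) X1 X2" "qc A X1 X3" "qc (r * s) X2 X3" "qc (1 / (r * s)) X3 W"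
  using qc_gens[THEN qcommute_sym] by simp_all

lemma qc_Z: "qc (1 / A) Z X1" "qc A Z X3" "qc (1 / q) Z X2" "qc q Z W"
proof -
  show "qc (1 / A) Z X1" unfolding Z_def
    using qcommute_mult_left[OF qc_gens(3) qcommute_refl] by simp
  show "qc A Z X3" unfolding Z_def
    using qcommute_mult_left[OF qcommute_refl qc_gens_sym(3)] by simp
  have "1 / (r * s) * s\<^sup>2 = 1 / q" by (simp add: q_eq power2_eq_square)
  then show "qc (1 / q) Z X2" unfolding Z_def
    using qcommute_mult_left[OF qc_gens(4) qc_gens_sym(2)] by (simp only:)
  have "1 / (r * s) * r\<^sup>2 = q" by (simp add: q_eq power2_eq_square)
  then show "qc q Z W" unfolding Z_def
    using qcommute_mult_left[OF qc_gens_sym(5,1)] by (simp only:)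
qed

lemma xt_eq: "xt = W * X2 - free_const \<tau> * Z"
  by (simp only: xt_def Z_def)

text \<open>Interchanging W and X2 subtracts \<gamma> Z, so X2 W = xt + (\<tau> - \<gamma>) Z; this
  gives the coefficient \<tau> q.\<close>

lemma \<tau>_minus_\<gamma>: "\<tau> - \<gamma> = \<tau> * q"
  using q_neq_one by (simp add: field_simps)

lemma X2_W_eq: "class_B r s (X2 * W) = class_B r s (xt + free_const (\<tau> * q) * Z)"
proof -
  have eq: "X2 * W - (xt + free_const (\<tau> * q) * Z) = - (W * X2 - (X2 * W + free_const \<gamma> * Z))"
    unfolding xt_eq \<tau>_minus_\<gamma>[symmetric] by (simp add: free_const_diff algebra_simps)
  show ?thesis unfolding class_B_eq_iff eq by (rule ideal_B_closed(3)[OF W_X2_relator])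
qed

text \<open>Here \<tau> is determined: W X2 - X2 W contributes \<gamma> Z X2 to the commutator with
  X2, and \<tau> (Z X2 - X2 Z) = \<tau> (1 - q) Z X2 cancels it. The commutator with W vanishes for
  the same value.\<close>

lemma qc_xt: "qc (1 / A) xt X1" "qc A xt X3" "qc 1 xt X2" "qc 1 xt W"
proof -
  show "qc (1 / A) xt X1" unfolding xt_eq
    using qcommute_diff_left[OF _ qc_Z(1)] qcommute_mult_left[OF qc_gens(1,2)] by (simp add: A_def)
  have "r * s * (r * s) = A" by (simp add: A_def power2_eq_square)
  then show "qc A xt X3" unfolding xt_eq
    using qcommute_diff_left[OF _ qc_Z(2)] qcommute_mult_left[OF qc_gens(5) qc_gens_sym(4)] by simp
  have "\<gamma> - \<tau> = - (\<tau> * q)" using \<tau>_minus_\<gamma> by (metis minus_diff_eq)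
  then have "(\<gamma> - \<tau>) / q + \<tau> = 0" by (simp only:) simp
  then have "free_const ((\<gamma> - \<tau>) / q + \<tau>) = 0" by simp
  then have *: "free_const \<tau> = - free_const ((\<gamma> - \<tau>) / q)"
    by (simp add: free_const_add eq_neg_iff_add_eq_0 add.commute)
  have "xt * X2 - X2 * xt = (W * X2 - (X2 * W + free_const \<gamma> * Z)) * X2 +
      free_const (\<gamma> - \<tau>) * (Z * X2 - free_const (1 / q) * (X2 * Z))"
  proof -
    have "free_const (\<gamma> - \<tau>) * (free_const (1 / q) * (X2 * Z)) = - (free_const \<tau> * (X2 * Z))"
      unfolding * free_const_mult_left by simp
    then have "free_const (\<gamma> - \<tau>) * (Z * X2 - free_const (1 / q) * (X2 * Z)) =
        free_const (\<gamma> - \<tau>) * (Z * X2) + free_const \<tau> * (X2 * Z)"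
      by (simp add: right_diff_distrib)
    then show ?thesis
      unfolding xt_eq by (simp add: free_const_diff free_alg_normalize)
  qed
  with W_X2_relator qc_Z(3) show "qc 1 xt X2" by (simp add: qcommute_iff ideal_B_closed ideal_B_diff)
  have "\<tau> = \<tau> * q + \<gamma>" using \<tau>_minus_\<gamma> by (simp only: diff_eq_eq)
  then have "scale_pm (q * \<tau>) (W * Z) = scale_pm \<tau> (W * Z) - scale_pm \<gamma> (W * Z)"
    by (metis scale_pm_add_left add_diff_cancel_right' mult.commute)
  then have "xt * W - W * xt = - (W * (W * X2 - (X2 * W + free_const \<gamma> * Z))) +
      free_const (- \<tau>) * (Z * W - free_const q * (W * Z))"
    unfolding xt_eq by (simp add: free_alg_normalize)
  with W_X2_relator qc_Z(4) show "qc 1 xt W" by (simp add: qcommute_iff ideal_B_closed ideal_B_diff)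
qed

text \<open>Both products are evaluated by moving \<open>xt\<close> and \<open>Z\<close> to the left, which avoids a
  \<open>q\<close>-binomial formula for \<open>W X2\<^sup>n\<close>.\<close>

lemma qc_X2_power_W:
  assumes "n > 0" "q ^ n = 1" shows "qc 1 (X2 ^ n) W"
proof -
  obtain k where n: "n = Suc k" using assms(1) by (cases n) auto
  have "qc (q ^ k) (X2 ^ k) Z" and "qc 1 (X2 ^ k) xt"
    using qcommute_power_left[OF qcommute_sym[OF qc_Z(3)]] qcommute_power_left[OF qcommute_sym[OF qc_xt(3)], of k]
    by simp_all
  then have 1: "X2 ^ k * Z - free_const (q ^ k) * (Z * X2 ^ k) \<in> ideal_B r s"
    and 2: "X2 ^ k * xt - xt * X2 ^ k \<in> ideal_B r s" by (simp_all add: qcommute_iff)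
  have 3: "X2 * W - (xt + free_const (\<tau> * q) * Z) \<in> ideal_B r s"
    using X2_W_eq by (simp add: class_B_eq_iff)
  have q: "q * q ^ k = 1" "q ^ k * q = 1" using assms(2) n by (simp_all add: mult.commute)
  have "X2 ^ n * W - W * X2 ^ n = X2 ^ k * (X2 * W - (xt + free_const (\<tau> * q) * Z)) +
      (X2 ^ k * xt - xt * X2 ^ k) + free_const (\<tau> * q) * (X2 ^ k * Z - free_const (q ^ k) * (Z * X2 ^ k))"
  proof -
    have "X2 ^ n * W = X2 ^ k * (X2 * W)" "W * X2 ^ n = W * (X2 * X2 ^ k)"
      by (simp_all add: n power_Suc2 mult.assoc del: power_Suc) (simp flip: power_Suc2 power_Suc)
    moreover have "W * (X2 * X2 ^ k) = xt * X2 ^ k + free_const \<tau> * (Z * X2 ^ k)"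
      by (simp add: xt_eq free_alg_normalize)
    ultimately show ?thesis by (simp add: free_alg_normalize q mult.assoc)
  qed
  with 1 2 3 show ?thesis by (simp add: qcommute_iff ideal_B_closed ideal_B_diff)
qed

lemma qc_W_power_X2:
  assumes "n > 0" "q ^ n = 1" shows "qc 1 (W ^ n) X2"
proof -
  obtain k where n: "n = Suc k" using assms(1) by (cases n) auto
  have "qc (1 / q ^ k) (W ^ k) Z" and "qc 1 (W ^ k) xt"
    using qcommute_power_left[OF qcommute_sym[OF qc_Z(4)], of k] qcommute_power_left[OF qcommute_sym[OF qc_xt(4)], of k]
    by (simp_all add: power_divide)
  then have 1: "W ^ k * Z - free_const (1 / q ^ k) * (Z * W ^ k) \<in> ideal_B r s"
    and 2: "W ^ k * xt - xt * W ^ k \<in> ideal_B r s" by (simp_all add: qcommute_iff)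
  have 3: "X2 * W - (xt + free_const (\<tau> * q) * Z) \<in> ideal_B r s"
    using X2_W_eq by (simp add: class_B_eq_iff)
  have q: "1 / q ^ k = q" using assms(2) n by (simp add: field_simps)
  have "W ^ n * X2 - X2 * W ^ n = - ((X2 * W - (xt + free_const (\<tau> * q) * Z)) * W ^ k) +
      (W ^ k * xt - xt * W ^ k) + free_const \<tau> * (W ^ k * Z - free_const (1 / q ^ k) * (Z * W ^ k))"
  proof -
    have "W ^ n * X2 = W ^ k * (W * X2)" "X2 * W ^ n = X2 * (W * W ^ k)"
      by (simp_all add: n power_Suc2 mult.assoc del: power_Suc) (simp flip: power_Suc2 power_Suc)
    moreover have "W ^ k * (W * X2) = W ^ k * xt + free_const \<tau> * (W ^ k * Z)"
      by (simp add: xt_eq free_alg_normalize)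
    ultimately show ?thesis by (simp add: free_alg_normalize q)
  qed
  with 1 2 3 show ?thesis by (simp add: qcommute_iff ideal_B_closed ideal_B_diff)
qed

end

section \<open>Classification\<close>

text \<open>The scalar is c^(n (n - 1) / 2), but its existence suffices for concluding that the
  power acts as a scalar.\<close>

lemma qcommute_product_power:
  assumes "qcommute r s c y x"
  shows "\<exists>d. class_B r s ((x * y) ^ n) = class_B r s (free_const d * (x ^ n * y ^ n))"
proof (induction n)
  case 0
  show ?case by (intro exI[of _ 1]) simp
next
  case (Suc n)
  then obtain d where d: "(x * y) ^ n - free_const d * (x ^ n * y ^ n) \<in> ideal_B r s"
    by (auto simp: class_B_eq_iff)
  have e: "y * x ^ n - free_const (c ^ n) * (x ^ n * y) \<in> ideal_B r s"
    using qcommute_power_right[OF assms, of n] by (simp add: qcommute_iff)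
  have "(x * y) ^ Suc n - free_const (d * c ^ n) * (x ^ Suc n * y ^ Suc n) =
      x * y * ((x * y) ^ n - free_const d * (x ^ n * y ^ n)) +
      free_const d * (x * (y * x ^ n - free_const (c ^ n) * (x ^ n * y)) * y ^ n)"
    by (simp add: free_alg_normalize)
  with d e have "(x * y) ^ Suc n - free_const (d * c ^ n) * (x ^ Suc n * y ^ Suc n) \<in> ideal_B r s"
    by (simp add: ideal_B_closed del: power_Suc)
  then show ?case unfolding class_B_eq_iff by blast
qed

context alg_B_module
begin

text \<open>The working form of torsionfreeness: zero kernel. It passes to products and powers, so Z
  inherits it from X3 and X1.\<close>

definition act_inj :: "free_alg \<Rightarrow> bool" where
  "act_inj x \<longleftrightarrow> (\<forall>v\<in>V. v \<rhd> x = \<zero>\<^bsub>N\<^esub> \<longrightarrow> v = \<zero>\<^bsub>N\<^esub>)"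

lemma act_injD: "act_inj x \<Longrightarrow> v \<in> V \<Longrightarrow> v \<rhd> x = \<zero>\<^bsub>N\<^esub> \<Longrightarrow> v = \<zero>\<^bsub>N\<^esub>"
  unfolding act_inj_def by blast

lemma act_inj_mult: "act_inj x \<Longrightarrow> act_inj y \<Longrightarrow> act_inj (x * y)"
  unfolding act_inj_def by (metis act_closed act_mult)

lemma act_inj_power: "act_inj x \<Longrightarrow> act_inj (x ^ n)"
proof (induction n)
  case 0
  show ?case by (simp add: act_inj_def)
next
  case (Suc n)
  then show ?case by (simp add: act_inj_mult)
qed

lemma act_inj_cancel:
  assumes "act_inj x" "v \<in> V" "w \<in> V" "v \<rhd> x = w \<rhd> x"
  shows "v = w"
proof -
  have "(v \<oplus>\<^bsub>N\<^esub> smul (- 1) w) \<rhd> x = smul (1 + - 1) (w \<rhd> x)"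
    using assms(2-) unfolding smul_add[OF act_closed[OF assms(3)]] by (simp add: act_add_vector)
  then have "v \<oplus>\<^bsub>N\<^esub> smul (- 1) w = \<zero>\<^bsub>N\<^esub>" using act_injD[OF assms(1)] assms(2,3) by simp
  then have "v \<oplus>\<^bsub>N\<^esub> smul (- 1) w \<oplus>\<^bsub>N\<^esub> w = w" using assms(3) by simp
  moreover have "smul (- 1) w \<oplus>\<^bsub>N\<^esub> w = smul (- 1 + 1) w"
    using assms(3) by (subst smul_add) simp_all
  ultimately show ?thesis using assms(2,3) by (simp add: rm.M.a_assoc)
qed

lemma eigenvalue_nonzero:
  assumes "act_inj x" "v \<in> V" "v \<noteq> \<zero>\<^bsub>N\<^esub>" "v \<rhd> x = smul c v"
  shows "c \<noteq> 0"
  using assms act_injD[of x v] by auto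

end

section \<open>Central powers and common eigenvectors in the given module\<close>

locale classification = root_params r s + simple_alg_B_module r s N
  for r s :: complex and N :: "(free_alg set, 'v) rmodule" +
  assumes X1_inj: "act_inj X1" and X3_inj: "act_inj X3"
begin

lemma act_qc: "qc c x y \<Longrightarrow> v \<in> V \<Longrightarrow> v \<rhd> x \<rhd> y = smul c (v \<rhd> y \<rhd> x)"
  unfolding qcommute_def by (drule act_eqI[of _ _ v]) (simp add: act_const_mult flip: act_mult)

lemma act_W_X2: "v \<in> V \<Longrightarrow> v \<rhd> W \<rhd> X2 = v \<rhd> xt \<oplus>\<^bsub>N\<^esub> smul \<tau> (v \<rhd> Z)"
  by (simp add: xt_eq flip: act_mult act_const_mult act_add)

lemma act_X2_W: "v \<in> V \<Longrightarrow> v \<rhd> X2 \<rhd> W = v \<rhd> xt \<oplus>\<^bsub>N\<^esub> smul (\<tau> * q) (v \<rhd> Z)"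
  using act_eqI[OF X2_W_eq, of v] by (simp flip: act_mult act_const_mult act_add)

lemma act_W_X2_eigen:
  assumes "v \<in> V" "v \<rhd> xt = smul x v" "v \<rhd> Z = smul y v"
  shows "v \<rhd> W \<rhd> X2 = smul (x + \<tau> * y) v"
  using assms by (simp add: act_W_X2 smul_add)

lemma Z_inj: "act_inj Z"
  unfolding Z_def by (rule act_inj_mult[OF X3_inj X1_inj])

lemma scalar_of_qc:
  assumes "qc 1 X1 z" "qc 1 X2 z" "qc 1 X3 z" "qc 1 W z"
  obtains c where "\<And>v. v \<in> V \<Longrightarrow> v \<rhd> z = smul c v"
proof -
  have "class_B r s (free_gen g * z) = class_B r s (z * free_gen g)" for g
    using assms by (cases g) (simp_all add: qcommute_def)
  then show ?thesis using central_acts_as_scalar[of z] that by blast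
qed

text \<open>All commutation scalars are monomials in r and s with integer exponents, hence trivial
  for n-th powers, so \<open>z ^ n\<close> is central. For X2 against W, which do not commute up to
  a scalar, q^n = 1 enters through \<open>qc_X2_power_W\<close> and
  \<open>qc_W_power_X2\<close>.\<close>

lemma scalar_of_power:
  assumes "z \<in> {X1, X2, X3, W, xt, Z}" "n > 0" "r ^ n = 1" "s ^ n = 1"
  obtains c where "\<And>v. v \<in> V \<Longrightarrow> v \<rhd> z ^ n = smul c v"
proof -
  have one: "(r\<^sup>2) ^ n = 1" "(s\<^sup>2) ^ n = 1" "(r * s) ^ n = 1" "A ^ n = 1" "q ^ n = 1"
  proof -
    have sq: "(x\<^sup>2) ^ n = 1" if "x ^ n = 1" for x :: complex
      using that by (metis mult.commute power_mult power_one)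
    show "(r\<^sup>2) ^ n = 1" "(s\<^sup>2) ^ n = 1" using sq assms(3,4) by blast+
    then show "(r * s) ^ n = 1" "A ^ n = 1" "q ^ n = 1"
      using assms(3,4) by (simp_all add: A_def q_eq power_mult_distrib power_divide)
  qed
  have "qc 1 X1 (z ^ n) \<and> qc 1 X2 (z ^ n) \<and> qc 1 X3 (z ^ n) \<and> qc 1 W (z ^ n)"
  proof -
    consider "z = X1" | "z = X2" | "z = X3" | "z = W" | "z = xt" | "z = Z" using assms(1) by blast
    then show ?thesis
    proof cases
      case 1
      show ?thesis unfolding 1
        using qcommute_power_right[OF qcommute_refl[of r s X1], of n]
          qcommute_power_right[OF qc_gens(2), of n]
          qcommute_power_right[OF qc_gens(3), of n]
          qcommute_power_right[OF qc_gens(1), of n]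
        by (simp add: one power_divide)
    next
      case 2
      show ?thesis unfolding 2
        using qcommute_power_right[OF qc_gens_sym(2), of n]
          qcommute_power_right[OF qcommute_refl[of r s X2], of n]
          qcommute_power_right[OF qc_gens(4), of n]
          qcommute_sym[OF qc_X2_power_W[OF assms(2) one(5)]]
        by (simp add: one power_divide)
    next
      case 3
      show ?thesis unfolding 3
        using qcommute_power_right[OF qc_gens_sym(3), of n]
          qcommute_power_right[OF qc_gens_sym(4), of n]
          qcommute_power_right[OF qcommute_refl[of r s X3], of n]
          qcommute_power_right[OF qc_gens(5), of n]
        by (simp add: one power_divide)
    next
      case 4
      show ?thesis unfolding 4
        using qcommute_power_right[OF qc_gens_sym(1), of n]
          qcommute_sym[OF qc_W_power_X2[OF assms(2) one(5)]]
          qcommute_power_right[OF qc_gens_sym(5), of n]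
          qcommute_power_right[OF qcommute_refl[of r s W], of n]
        by (simp add: one power_divide)
    next
      case 5
      show ?thesis unfolding 5
        using qcommute_power_right[OF qc_xt(1)[THEN qcommute_sym], of n]
          qcommute_power_right[OF qc_xt(3)[THEN qcommute_sym], of n]
          qcommute_power_right[OF qc_xt(2)[THEN qcommute_sym], of n]
          qcommute_power_right[OF qc_xt(4)[THEN qcommute_sym], of n]
        by (simp add: one power_divide)
    next
      case 6
      show ?thesis unfolding 6
        using qcommute_power_right[OF qc_Z(1)[THEN qcommute_sym], of n]
          qcommute_power_right[OF qc_Z(3)[THEN qcommute_sym], of n]
          qcommute_power_right[OF qc_Z(2)[THEN qcommute_sym], of n]
          qcommute_power_right[OF qc_Z(4)[THEN qcommute_sym], of n]
        by (simp add: one power_divide)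
    qed
  qed
  then show ?thesis using scalar_of_qc[of "z ^ n"] that by blast
qed

text \<open>Invariance under all z - c is what the factorization argument for eigenvectors uses;
  closure under addition is not demanded. Intersections with further eigenspaces can thus be
  iterated directly.\<close>

definition stable :: "'v set \<Rightarrow> free_alg \<Rightarrow> bool" where
  "stable H z \<longleftrightarrow> H \<subseteq> V \<and> (\<forall>v\<in>H. \<forall>c. v \<rhd> (z - free_const c) \<in> H)"

lemma stable_V: "stable V z"
  by (simp add: stable_def)

lemma stable_eigenspace:
  assumes "stable H z" "qc 1 y z" shows "stable {v \<in> H. v \<rhd> y = smul c v} z"
proof -
  have "v \<rhd> (z - free_const d) \<rhd> y = smul c (v \<rhd> (z - free_const d))"
    if v: "v \<in> H" "v \<rhd> y = smul c v" for v d
  proof -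
    have V: "v \<in> V" using v assms(1) by (auto simp: stable_def)
    have "qc 1 y (z - free_const d)"
      using assms(2) by (simp add: qcommute_iff algebra_simps free_const_commute)
    from act_qc[OF this V] V v(2) show ?thesis by simp
  qed
  with assms(1) show ?thesis by (auto simp: stable_def)
qed

text \<open>For a kernel, in contrast to an eigenspace, commutation up to an arbitrary scalar
  preserves the defining condition.\<close>

lemma stable_kernel:
  assumes "stable H z" "qc e z y" shows "stable {v \<in> H. v \<rhd> y = \<zero>\<^bsub>N\<^esub>} z"
proof -
  have "v \<rhd> (z - free_const d) \<rhd> y = \<zero>\<^bsub>N\<^esub>" if v: "v \<in> H" "v \<rhd> y = \<zero>\<^bsub>N\<^esub>" for v d
  proof -
    have V: "v \<in> V" using v assms(1) by (auto simp: stable_def)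
    have "v \<rhd> (z * y) = \<zero>\<^bsub>N\<^esub>" using act_qc[OF assms(2) V] v(2) V by (simp add: act_mult)
    moreover have "v \<rhd> (free_const d * y) = \<zero>\<^bsub>N\<^esub>" using v(2) V by (simp add: act_const_mult)
    ultimately have "v \<rhd> (z * y - free_const d * y) = \<zero>\<^bsub>N\<^esub>" using V by (simp add: act_diff_eq_zero_iff)
    then show ?thesis using V by (simp add: left_diff_distrib flip: act_mult)
  qed
  with assms(1) show ?thesis by (auto simp: stable_def)
qed

lemma stable_eigenvector:
  assumes "stable H z" "n > 0" "v \<in> H" "v \<noteq> \<zero>\<^bsub>N\<^esub>" "v \<rhd> z ^ n = smul d v"
  obtains w c where "w \<in> H" "w \<noteq> \<zero>\<^bsub>N\<^esub>" "w \<rhd> z = smul c w"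
proof -
  from assms(1) have H: "H \<subseteq> V" "\<And>v c. v \<in> H \<Longrightarrow> v \<rhd> (z - free_const c) \<in> H"
    by (auto simp: stable_def)
  show ?thesis by (rule eigenvector_of_power[OF H assms(2-5)]) (assumption, rule that)
qed

lemma iso_monomial:
  assumes "basis_rep r s I T" "simple_right_module (alg_B r s) (basis_module I T)"
    and "v \<in> V" "j \<in> I" "v \<rhd> b j \<noteq> \<zero>\<^bsub>N\<^esub>"
    and "\<And>i g. i \<in> I \<Longrightarrow> T g i = single (\<sigma> g i) (c g i)"
    and "\<And>i g. i \<in> I \<Longrightarrow> v \<rhd> b i \<rhd> free_gen g = smul (c g i) (v \<rhd> b (\<sigma> g i))"
  shows "rmodule_iso (alg_B r s) N (basis_module I T)"
proof (rule iso_basis_module[OF assms(1-3), of j b])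
  show "v \<rhd> (b i * free_gen g) = v \<rhd> lin_ext b (T g i)" if "i \<in> I" for i g
    using assms(3) assms(6,7)[OF that] by (simp add: act_mult flip: free_const_times smul_def)
qed fact+

text \<open>When \<open>xt\<close> vanishes on \<open>N\<close>, the product \<open>W X2\<close> is a multiple of \<open>Z\<close>, so the diagonal operator
  \<open>W X2\<^bsup>l-1\<^esup>\<close> of the model can be replaced by \<open>Z X2\<^bsup>l-2\<^esup>\<close>, a product of pairwise
  \<open>q\<close>-commuting generators, whose powers are therefore scalars.\<close>

lemma iso_M3:
  assumes xt0: "\<And>v. v \<in> V \<Longrightarrow> v \<rhd> xt = \<zero>\<^bsub>N\<^esub>"
  shows "\<exists>e\<in>params_M3. rmodule_iso (alg_B r s) N (mod_M3 r s e)"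
proof -
  let ?l = "l3 r s"
  have \<tau>0: "\<tau> \<noteq> 0" using q_neq_one by simp
  have WX2: "v \<rhd> W \<rhd> X2 = smul \<tau> (v \<rhd> Z)" and X2W: "v \<rhd> X2 \<rhd> W = smul (\<tau> * q) (v \<rhd> Z)" if "v \<in> V" for v
    using that xt0 by (simp_all add: act_W_X2 act_X2_W)
  \<comment> \<open>X2 W acts as \<tau> q Z, a nonzero multiple of an injective operator.\<close>
  have X2_inj: "act_inj X2"
    unfolding act_inj_def
  proof (intro ballI impI)
    fix v assume v: "v \<in> V" "v \<rhd> X2 = \<zero>\<^bsub>N\<^esub>"
    then have "smul (\<tau> * q) (v \<rhd> Z) = \<zero>\<^bsub>N\<^esub>" using X2W[OF v(1)] by simp
    then have "v \<rhd> Z = \<zero>\<^bsub>N\<^esub>" using v(1) \<tau>0 by (simp del: times_divide_eq_left)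
    then show "v = \<zero>\<^bsub>N\<^esub>" using act_injD[OF Z_inj v(1)] by blast
  qed
  obtain \<beta> where \<beta>: "\<And>v. v \<in> V \<Longrightarrow> v \<rhd> X2 ^ ?l = smul \<beta> v"
  proof (rule scalar_of_qc[of "X2 ^ ?l"])
    show "qc 1 X1 (X2 ^ ?l)" using qcommute_power_right[OF qc_gens_sym(2), of ?l] by (simp add: power_l3)
    show "qc 1 X2 (X2 ^ ?l)" using qcommute_power_right[OF qcommute_refl[of r s X2], of ?l] by simp
    show "qc 1 X3 (X2 ^ ?l)" using qcommute_power_right[OF qc_gens(4), of ?l] by (simp add: power_l3 power_divide)
    show "qc 1 W (X2 ^ ?l)" using qcommute_sym[OF qc_X2_power_W[OF l3_pos power_l3(2)]] by simp
  qed blast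
  \<comment> \<open>Keeps the subtraction in the exponent \<open>?l - 2\<close> from being
    truncated.\<close>
  have l: "?l > 2"
    using m_gt_2 dvd_imp_le[of m ?l] l3_pos power_l3(2) power_eq_one_iff_mult_ord_dvd[OF q_root] by fastforce
  define Y where "Y = Z * X2 ^ (?l - 2)"
  obtain n where n: "n > 0" "r ^ n = 1" "s ^ n = 1" by (rule common_exponent)
  obtain c1 where c1: "\<And>v. v \<in> V \<Longrightarrow> v \<rhd> X3 ^ n = smul c1 v" using scalar_of_power[of X3 n] n by blast
  obtain c2 where c2: "\<And>v. v \<in> V \<Longrightarrow> v \<rhd> Z ^ n = smul c2 v" using scalar_of_power[of Z n] n by blast
  obtain c3 where c3: "\<And>v. v \<in> V \<Longrightarrow> v \<rhd> X2 ^ ((?l - 2) * n) = smul c3 v"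
    using scalar_of_power[of X2 "(?l - 2) * n"] n l by (auto simp: mult.commute[of _ n] power_mult)
  obtain d where d: "class_B r s (Y ^ n) = class_B r s (free_const d * (Z ^ n * (X2 ^ (?l - 2)) ^ n))"
    unfolding Y_def
    using qcommute_product_power[OF qcommute_power_left[OF qcommute_sym[OF qc_Z(3)], of "?l - 2"], of n] by auto
  have Yn: "v \<rhd> Y ^ n = smul (d * (c2 * c3)) v" if "v \<in> V" for v
    using act_eqI[OF d, of v] that c2 c3 by (simp add: act_mult mult_ac flip: power_mult smul_def)
  obtain v0 where v0: "v0 \<in> V" "v0 \<noteq> \<zero>\<^bsub>N\<^esub>" by (rule obtain_nonzero)
  obtain v1 e2 where v1: "v1 \<in> V" "v1 \<noteq> \<zero>\<^bsub>N\<^esub>" "v1 \<rhd> X3 = smul e2 v1"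
    using stable_eigenvector[OF stable_V n(1) v0 c1[OF v0(1)]] by blast
  \<comment> \<open>Z contributes A = (rs)^2 and X2^(l-2) the rest of (rs)^l = 1, so
    \<open>Y\<close> commutes with X3 and the two have a common eigenvector.\<close>
  have "A * (r * s) ^ (?l - 2) = (r * s) ^ (2 + (?l - 2))" unfolding power_add rs_power_double[of 1, simplified] by simp
  also have "2 + (?l - 2) = ?l" using l by simp
  also note power_l3(1)
  finally have "qc 1 Y X3" unfolding Y_def
    using qcommute_mult_left[OF qc_Z(2) qcommute_power_left[OF qc_gens_sym(4)]] by metis
  then have "qc 1 X3 Y" using qcommute_sym by fastforce
  then have "stable {v \<in> V. v \<rhd> X3 = smul e2 v} Y" by (rule stable_eigenspace[OF stable_V])
  then obtain v \<eta> where v: "v \<in> V" "v \<noteq> \<zero>\<^bsub>N\<^esub>" "v \<rhd> X3 = smul e2 v" "v \<rhd> Y = smul \<eta> v"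
    using stable_eigenvector[OF _ n(1) _ v1(2) Yn[OF v1(1)]] v1 by blast
  have e2: "e2 \<noteq> 0" by (rule eigenvalue_nonzero[OF X3_inj v(1-3)])
  have \<beta>0: "\<beta> \<noteq> 0" by (rule eigenvalue_nonzero[OF act_inj_power[OF X2_inj] v(1,2) \<beta>[OF v(1)]])
  have \<eta>0: "\<eta> \<noteq> 0"
  proof
    assume "\<eta> = 0"
    then have "v \<rhd> Z \<rhd> X2 ^ (?l - 2) = \<zero>\<^bsub>N\<^esub>" using v by (simp add: Y_def act_mult)
    then have "v \<rhd> Z = \<zero>\<^bsub>N\<^esub>" using act_injD[OF act_inj_power[OF X2_inj]] v(1) by simp
    then show False using act_injD[OF Z_inj v(1)] v(2) by blast
  qed
  obtain e1 where e1: "e1 ^ ?l = \<beta>" using complex_root_exists[OF l3_pos] .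
  have e10: "e1 \<noteq> 0" using e1 \<beta>0 l3_pos by auto
  \<comment> \<open>As X2^l acts by \<beta>, the eigenvalue \<eta> of Z X2^(l-2) gives v Z = (\<eta>
    / \<beta>) v X2^2. Since W X2 = \<tau> Z, cancelling X2 yields v W = e3 (v X2).\<close>
  define e3 where "e3 = \<tau> * \<eta> / \<beta>"
  have e3: "e3 \<noteq> 0" using \<tau>0 \<eta>0 \<beta>0 by (simp add: e3_def)
  have vZ: "v \<rhd> Z = smul (\<eta> / \<beta>) (v \<rhd> X2 ^ 2)"
  proof -
    have "v \<rhd> Y \<rhd> X2 ^ 2 = v \<rhd> Z \<rhd> X2 ^ (?l - 2 + 2)"
      unfolding power_add Y_def using v(1) by (simp only: act_mult act_closed)
    also have "?l - 2 + 2 = ?l" using l by simp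
    finally have "v \<rhd> Y \<rhd> X2 ^ 2 = v \<rhd> Z \<rhd> X2 ^ ?l" .
    then have "smul \<eta> (v \<rhd> X2 ^ 2) = smul \<beta> (v \<rhd> Z)" using v \<beta>[of "v \<rhd> Z"] by simp
    then have "smul (1 / \<beta>) (smul \<eta> (v \<rhd> X2 ^ 2)) = smul (1 / \<beta>) (smul \<beta> (v \<rhd> Z))" by simp
    then show ?thesis using v(1) \<beta>0 by simp
  qed
  define b where "b a = free_const (1 / e1 ^ a) * X2 ^ a" for a
  define E where "E a = v \<rhd> b a" for a
  have E_eq: "E a = smul (1 / e1 ^ a) (v \<rhd> X2 ^ a)" for a using v(1) by (simp add: E_def b_def act_const_mult)
  have E_closed: "E a \<in> V" for a using v(1) by (simp add: E_def)
  have E_mod: "E (a mod ?l) = E a" for a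
  proof -
    have "E (?l * k + c) = E c" for k c
    proof (induction k)
      case (Suc k)
      have "?l * Suc k + c = ?l + (?l * k + c)" by simp
      then have "E (?l * Suc k + c) = smul (1 / e1 ^ (?l + (?l * k + c))) (v \<rhd> X2 ^ ?l \<rhd> X2 ^ (?l * k + c))"
        using v(1) by (simp only: E_eq power_add act_mult)
      also have "\<dots> = E (?l * k + c)"
        using v(1) \<beta> \<beta>0 unfolding E_eq power_add[of e1 ?l] e1 by simp
      finally show ?case using Suc by simp
    qed simp
    from this[of "a div ?l" "a mod ?l"] show ?thesis by simp
  qed
  have E_X2: "E a \<rhd> X2 = smul e1 (E (Suc a))" for a
    using v(1) e10 unfolding E_eq power_Suc2 by (simp add: act_mult)
  have E_X3: "E a \<rhd> X3 = smul ((r * s) ^ a * e2) (E a)" for a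
    using v act_qc[OF qcommute_power_left[OF qc_gens_sym(4)], of v a] unfolding E_eq by (simp add: mult_ac)
  have E_Z: "smul \<tau> (E a \<rhd> Z) = smul (e1\<^sup>2 * e3 * q ^ a) (E (Suc (Suc a)))" for a
  proof -
    have "v \<rhd> X2 ^ a \<rhd> Z = smul (q ^ a) (v \<rhd> Z \<rhd> X2 ^ a)"
      using act_qc[OF qcommute_power_left[OF qcommute_sym[OF qc_Z(3)], of a] v(1)] by simp
    also have "v \<rhd> Z \<rhd> X2 ^ a = smul (\<eta> / \<beta>) (v \<rhd> X2 ^ (2 + a))"
      unfolding vZ power_add using v(1) by (simp add: act_mult)
    finally show ?thesis using v(1) e10 unfolding E_eq by (simp add: e3_def power2_eq_square mult_ac)
  qed
  have E_W: "E a \<rhd> W = smul (e1 * e3 * q ^ a) (E (Suc a))" for a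
  proof (rule act_inj_cancel[OF X2_inj])
    show "E a \<rhd> W \<rhd> X2 = smul (e1 * e3 * q ^ a) (E (Suc a)) \<rhd> X2"
      unfolding WX2[OF E_closed] E_Z using E_closed by (simp add: E_X2 power2_eq_square mult_ac)
  qed (use E_closed in auto)
  have E_X1: "E a \<rhd> X1 = smul (e1\<^sup>2 * e3 / e2 * ((1 - q) / \<gamma>) / (s\<^sup>2) ^ a) (E (Suc (Suc a)))" for a
  proof -
    have "(r * s) ^ a / (s\<^sup>2) ^ a = q ^ a"
      by (simp add: q_eq power_mult_distrib power_divide power2_eq_square)
    then have q: "q ^ a / (r * s) ^ a = 1 / (s\<^sup>2) ^ a" by (simp add: field_simps)
    \<comment> \<open>On the X3-eigenvector \<open>E a\<close> the first factor of Z = X3 X1 is a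
      nonzero scalar, which can be divided out.\<close>
    have "smul \<tau> (E a \<rhd> Z) = smul (\<tau> * ((r * s) ^ a * e2)) (E a \<rhd> X1)"
      using E_closed by (simp add: Z_def act_mult E_X3)
    then have "smul (\<tau> * ((r * s) ^ a * e2)) (E a \<rhd> X1) = smul (e1\<^sup>2 * e3 * q ^ a) (E (Suc (Suc a)))"
      unfolding E_Z ..
    then have "smul (1 / (\<tau> * ((r * s) ^ a * e2))) (smul (\<tau> * ((r * s) ^ a * e2)) (E a \<rhd> X1)) =
        smul (1 / (\<tau> * ((r * s) ^ a * e2))) (smul (e1\<^sup>2 * e3 * q ^ a) (E (Suc (Suc a))))" by simp
    moreover have "1 / (\<tau> * ((r * s) ^ a * e2)) * (\<tau> * ((r * s) ^ a * e2)) = 1" using \<tau>0 e2 by simp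
    moreover have "1 / (\<tau> * ((r * s) ^ a * e2)) * (e1\<^sup>2 * e3 * q ^ a) =
        e1\<^sup>2 * e3 / e2 * ((1 - q) / \<gamma>) * (q ^ a / (r * s) ^ a)" by (simp add: mult_ac)
    moreover have "\<dots> = e1\<^sup>2 * e3 / e2 * ((1 - q) / \<gamma>) / (s\<^sup>2) ^ a" unfolding q by simp
    ultimately show ?thesis by (simp only: smul_smul smul_closed act_closed E_closed smul_one)
  qed
  have "rmodule_iso (alg_B r s) N (basis_module {..<?l} (act_M3 r s (e1, e2, e3)))"
  proof (rule iso_monomial[where \<sigma> = shift3 and c = "coef3 e1 e2 e3" and j = 0 and b = b])
    show "basis_rep r s {..<?l} (act_M3 r s (e1, e2, e3))" by (rule basis_rep_M3[OF e10 e2 e3])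
    show "simple_right_module (alg_B r s) (basis_module {..<?l} (act_M3 r s (e1, e2, e3)))"
      using simple_M3[OF e10 e2 e3] by (simp only: mod_M3_def)
    show "v \<rhd> b 0 \<noteq> \<zero>\<^bsub>N\<^esub>" using v by (simp add: b_def)
    show "v \<rhd> b a \<rhd> free_gen g = smul (coef3 e1 e2 e3 g a) (v \<rhd> b (shift3 g a))" for a g
      unfolding E_def[symmetric]
      by (cases g) (simp_all add: E_X1 E_X2 E_X3 E_W shift3_def coef3_def E_mod)
  qed (use v l3_pos in \<open>simp_all add: act_M3_eq\<close>)
  then have "rmodule_iso (alg_B r s) N (mod_M3 r s (e1, e2, e3))" by (simp only: mod_M3_def)
  moreover have "(e1, e2, e3) \<in> params_M3" using e10 e2 e3 by (simp add: params_M3_def)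
  ultimately show ?thesis by blast
qed

end

section \<open>Modules of the first two types, and exhaustiveness\<close>

context classification
begin

lemma qc_xt_Z: "qc 1 xt Z"
  using qcommute_mult_right[OF qc_xt(2,1)] by (simp add: Z_def)

lemma scalar_of_power_power:
  assumes z: "z \<in> {X1, X2, X3, W, xt, Z}" and "k > 0" and n: "n > 0" "r ^ n = 1" "s ^ n = 1"
  obtains c where "\<And>v. v \<in> V \<Longrightarrow> v \<rhd> (z ^ k) ^ n = smul c v"
proof -
  have "k * n > 0" "r ^ (k * n) = 1" "s ^ (k * n) = 1"
    unfolding mult.commute[of k n] power_mult using assms by simp_all
  then obtain c where "\<And>v. v \<in> V \<Longrightarrow> v \<rhd> z ^ (k * n) = smul c v"
    using scalar_of_power[of z "k * n"] z by blast
  then show ?thesis by (intro that[of c]) (simp only: power_mult)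
qed

text \<open>The vector \<open>v\<close> playing the role of \<open>e(0,0)\<close> is a common eigenvector of the commuting elements
  \<open>xt\<close>, \<open>Z\<close>, \<open>X2\<^sup>m\<close> and \<open>X1\<^bsup>l\<^esup>\<close>. The actions of \<open>X3\<close> and \<open>W\<close> are recovered from those of
  \<open>X3 X1 = Z\<close> and \<open>W X2 = xt + \<tau> Z\<close> by cancelling \<open>X1\<close> and \<open>X2\<close>.\<close>

lemma iso_M1:
  assumes xt_inj: "act_inj xt" and X2_inj: "act_inj X2"
  shows "\<exists>k\<in>params_M1 r s. rmodule_iso (alg_B r s) N (mod_M1 r s k)"
proof -
  let ?l = "l1 r s"
  obtain n where n: "n > 0" "r ^ n = 1" "s ^ n = 1" by (rule common_exponent)
  obtain c1 where c1: "\<And>v. v \<in> V \<Longrightarrow> v \<rhd> xt ^ n = smul c1 v" using scalar_of_power[of xt n] n by blast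
  obtain c2 where c2: "\<And>v. v \<in> V \<Longrightarrow> v \<rhd> Z ^ n = smul c2 v" using scalar_of_power[of Z n] n by blast
  obtain c3 where c3: "\<And>v. v \<in> V \<Longrightarrow> v \<rhd> (X2 ^ m) ^ n = smul c3 v"
    using scalar_of_power_power[of X2 m n] n m_pos by blast
  obtain c4 where c4: "\<And>v. v \<in> V \<Longrightarrow> v \<rhd> (X1 ^ ?l) ^ n = smul c4 v"
    using scalar_of_power_power[of X1 ?l n] n l1_pos by blast
  have q1: "qc 1 xt Z" by (rule qc_xt_Z)
  have q2: "qc 1 xt (X2 ^ m)" using qcommute_power_right[OF qc_xt(3), of m] by simp
  have q3: "qc 1 Z (X2 ^ m)"
    using qcommute_power_right[OF qc_Z(3), of m] by (simp add: power_divide q_power_m)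
  have q4: "qc 1 xt (X1 ^ ?l)"
    using qcommute_power_right[OF qc_xt(1), of ?l] by (simp add: power_divide A_power_l1)
  have q5: "qc 1 Z (X1 ^ ?l)"
    using qcommute_power_right[OF qc_Z(1), of ?l] by (simp add: power_divide A_power_l1)
  \<comment> \<open>This is the scalar between X2^m and X1^l; the possible doubling in
    \<open>l1\<close> makes it equal to 1.\<close>
  have "((1 / s\<^sup>2) ^ m) ^ ?l = 1 / S ^ ?l" by (simp add: power_divide power_mult)
  then have q6: "qc 1 (X2 ^ m) (X1 ^ ?l)"
    using qcommute_power_right[OF qcommute_power_left[OF qc_gens(2), of m], of ?l] by (simp only: S_power_l1) simp
  obtain v0 where v0: "v0 \<in> V" "v0 \<noteq> \<zero>\<^bsub>N\<^esub>" by (rule obtain_nonzero)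
  obtain v1 \<xi> where v1: "v1 \<in> V" "v1 \<noteq> \<zero>\<^bsub>N\<^esub>" "v1 \<rhd> xt = smul \<xi> v1"
    using stable_eigenvector[OF stable_V n(1) v0 c1[OF v0(1)]] by blast
  let ?H1 = "{v \<in> V. v \<rhd> xt = smul \<xi> v}"
  note st1 = stable_eigenspace[OF stable_V, of xt _ \<xi>]
  obtain v2 k3 where v2: "v2 \<in> ?H1" "v2 \<noteq> \<zero>\<^bsub>N\<^esub>" "v2 \<rhd> Z = smul k3 v2"
    using stable_eigenvector[OF st1[OF q1] n(1) _ v1(2) c2[OF v1(1)]] v1 by blast
  let ?H2 = "{v \<in> ?H1. v \<rhd> Z = smul k3 v}"
  note st2 = stable_eigenspace[OF st1, of _ Z k3]
  obtain v3 \<beta> where v3: "v3 \<in> ?H2" "v3 \<noteq> \<zero>\<^bsub>N\<^esub>" "v3 \<rhd> X2 ^ m = smul \<beta> v3"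
  proof (rule stable_eigenvector[OF st2[OF q2 q3] n(1) _ v2(2)])
    show "v2 \<in> ?H2" using v2 by blast
    show "v2 \<rhd> (X2 ^ m) ^ n = smul c3 v2" using v2 c3 by blast
  qed
  note st3 = stable_eigenspace[OF st2, of _ "X2 ^ m" \<beta>]
  obtain v \<omega> where v': "v \<in> {v \<in> ?H2. v \<rhd> X2 ^ m = smul \<beta> v}" "v \<noteq> \<zero>\<^bsub>N\<^esub>" "v \<rhd> X1 ^ ?l = smul \<omega> v"
  proof (rule stable_eigenvector[OF st3[OF q4 q5 q6] n(1) _ v3(2)])
    show "v3 \<in> {v \<in> ?H2. v \<rhd> X2 ^ m = smul \<beta> v}" using v3 by blast
    show "v3 \<rhd> (X1 ^ ?l) ^ n = smul c4 v3" using v3 c4 by blast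
  qed
  have v: "v \<in> V" "v \<noteq> \<zero>\<^bsub>N\<^esub>" "v \<rhd> xt = smul \<xi> v" "v \<rhd> Z = smul k3 v" "v \<rhd> X2 ^ m = smul \<beta> v"
    "v \<rhd> X1 ^ ?l = smul \<omega> v"
    using v' by blast+
  have \<xi>0: "\<xi> \<noteq> 0" by (rule eigenvalue_nonzero[OF xt_inj v(1,2,3)])
  have k30: "k3 \<noteq> 0" by (rule eigenvalue_nonzero[OF Z_inj v(1,2,4)])
  have \<beta>0: "\<beta> \<noteq> 0" by (rule eigenvalue_nonzero[OF act_inj_power[OF X2_inj] v(1,2,5)])
  have \<omega>0: "\<omega> \<noteq> 0" by (rule eigenvalue_nonzero[OF act_inj_power[OF X1_inj] v(1,2,6)])
  obtain k1 where k1: "k1 ^ ?l = \<omega>" using complex_root_exists[OF l1_pos] .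
  have k10: "k1 \<noteq> 0" using k1 \<omega>0 l1_pos by auto
  obtain k2 where k2: "k2 ^ m = \<beta>" using complex_root_exists[OF m_pos] .
  have k20: "k2 \<noteq> 0" using k2 \<beta>0 m_pos by auto
  \<comment> \<open>The eigenvalue of W X2 = xt + \<tau> Z on \<open>v\<close>. The condition on
    \<open>k4\<close> in \<open>params_M1\<close> thus expresses that \<xi> is nonzero.\<close>
  define k4 where "k4 = \<xi> + \<tau> * k3"
  \<comment> \<open>With this normalization X1 and X2 carry the constants \<open>k1\<close> and
    \<open>k2\<close>, and the chain of X1 closes after \<open>l1\<close> steps.\<close>
  define b where "b i = (case i of (a, b) \<Rightarrow> free_const (1 / (k1 ^ a * k2 ^ b)) * (X1 ^ a * X2 ^ b))" for i :: "nat \<times> nat"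
  define E where "E a c = v \<rhd> b (a, c)" for a c
  have E_eq: "E a c = smul (1 / (k1 ^ a * k2 ^ c)) (v \<rhd> X1 ^ a \<rhd> X2 ^ c)" for a c
    using v(1) by (simp add: E_def b_def act_const_mult act_mult flip: smul_def)
  have E_closed: "E a c \<in> V" for a c using v(1) by (simp add: E_def)
  have E_mod: "E (a mod ?l) c = E a c" for a c
  proof -
    have "E (?l * k + d) c = E d c" for k d
    proof (induction k)
      case (Suc k)
      have "?l * Suc k + d = ?l + (?l * k + d)" by simp
      then have "E (?l * Suc k + d) c =
          smul (1 / (k1 ^ (?l + (?l * k + d)) * k2 ^ c)) (v \<rhd> X1 ^ ?l \<rhd> X1 ^ (?l * k + d) \<rhd> X2 ^ c)"
        using v(1) by (simp only: E_eq power_add act_mult)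
      also have "\<dots> = E (?l * k + d) c"
        using v(1) \<omega>0 unfolding E_eq power_add[of k1 ?l] k1 v(6) by simp
      finally show ?case using Suc by simp
    qed simp
    from this[of "a div ?l" "a mod ?l"] show ?thesis by simp
  qed
  have E_X2: "E a c \<rhd> X2 = smul k2 (E a (Suc c))" for a c
    using v(1) k10 k20 unfolding E_eq power_Suc2 by (simp add: act_mult)
  have E_m: "E a m = smul (S ^ a) (E a 0)" for a
  proof -
    have "qc ((s\<^sup>2) ^ a) (X1 ^ a) X2" by (rule qcommute_power_left[OF qc_gens_sym(2)])
    then have "qc (((s\<^sup>2) ^ a) ^ m) (X1 ^ a) (X2 ^ m)" by (rule qcommute_power_right)
    then have "v \<rhd> X1 ^ a \<rhd> X2 ^ m = smul (((s\<^sup>2) ^ a) ^ m) (v \<rhd> X2 ^ m \<rhd> X1 ^ a)"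
      by (rule act_qc[OF _ v(1)])
    also have "((s\<^sup>2) ^ a) ^ m = S ^ a"
      unfolding power_mult[symmetric] by (rule arg_cong[of _ _ "power s"]) simp
    finally show ?thesis using v(1) \<beta>0 unfolding E_eq k2 v(5) by simp
  qed
  have E_X1: "E a c \<rhd> X1 = smul (k1 / (s\<^sup>2) ^ c) (E (Suc a) c)" for a c
  proof -
    have "qc (1 / (s\<^sup>2) ^ c) (X2 ^ c) X1"
      using qcommute_power_left[OF qc_gens(2), of c] by (simp add: power_divide)
    then have "v \<rhd> X1 ^ a \<rhd> X2 ^ c \<rhd> X1 = smul (1 / (s\<^sup>2) ^ c) (v \<rhd> X1 ^ a \<rhd> X1 \<rhd> X2 ^ c)"
      using v(1) by (simp add: act_qc)
    then show ?thesis using v(1) k10 unfolding E_eq power_Suc2 by (simp add: act_mult mult_ac)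
  qed
  have E_xt: "E a c \<rhd> xt = smul (A ^ a * \<xi>) (E a c)" for a c
  proof -
    have "qc (A ^ a) (X1 ^ a) xt" using qcommute_power_left[OF qcommute_sym[OF qc_xt(1)], of a] by simp
    moreover have "qc 1 (X2 ^ c) xt" using qcommute_power_left[OF qcommute_sym[OF qc_xt(3)], of c] by simp
    ultimately show ?thesis using v(1,3) unfolding E_eq by (simp add: act_qc mult_ac)
  qed
  have E_Z: "E a c \<rhd> Z = smul (A ^ a * q ^ c * k3) (E a c)" for a c
  proof -
    have "qc (A ^ a) (X1 ^ a) Z" using qcommute_power_left[OF qcommute_sym[OF qc_Z(1)], of a] by simp
    moreover have "qc (q ^ c) (X2 ^ c) Z" using qcommute_power_left[OF qcommute_sym[OF qc_Z(3)], of c] by simp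
    ultimately show ?thesis using v(1,4) unfolding E_eq by (simp add: act_qc mult_ac)
  qed
  let ?I = "{..<?l} \<times> {..<m1 r s}"
  let ?c = "coef1 k1 k2 k3 k4"
  have gen1: "v \<rhd> b i \<rhd> X1 = smul (?c GX1 i) (v \<rhd> b (shift1 GX1 i))" for i
    by (cases i) (simp add: shift1_def coef1_def E_X1 E_mod flip: E_def)
  have gen2: "v \<rhd> b i \<rhd> X2 = smul (?c GX2 i) (v \<rhd> b (shift1 GX2 i))" if I: "i \<in> ?I" for i
  proof -
    obtain a c where i: "i = (a, c)" "c < m" using I by (auto simp: m1_eq)
    show ?thesis
    proof (cases "c = m - 1")
      case True
      then have "Suc c = m" using m_pos by simp
      with True show ?thesis unfolding i
        using E_X2[of a c] E_m[of a] E_closed by (simp add: shift1_def coef1_def flip: E_def)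
    next
      case False
      then show ?thesis unfolding i using E_X2[of a c] by (simp add: shift1_def coef1_def flip: E_def)
    qed
  qed
  have shift_I: "shift1 g i \<in> ?I" if "i \<in> ?I" for g i
    using that l1_pos m_pos by (auto simp: shift1_def m1_eq split: gen.split)
  have bV: "v \<rhd> b i \<in> V" for i using v(1) by simp
  have gen: "v \<rhd> b i \<rhd> free_gen g = smul (?c g i) (v \<rhd> b (shift1 g i))" if i: "i \<in> ?I" for i g
  proof -
    obtain a c where ac: "i = (a, c)" "a < ?l" "c < m" using i by (auto simp: m1_eq)
    note M = M1_products[OF ac(2,3) k10 k20]
    show ?thesis
    proof (cases g)
      case GX3
      have "v \<rhd> b i \<rhd> X3 = smul (?c GX3 i) (v \<rhd> b (shift1 GX3 i))"
      proof (rule act_inj_cancel[OF X1_inj])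
        have "smul (?c GX3 i) (v \<rhd> b (shift1 GX3 i)) \<rhd> X1 = smul (A ^ a * q ^ c * k3) (v \<rhd> b i)"
          using bV unfolding act_smul[OF bV] gen1 ac by (simp add: M)
        also have "\<dots> = v \<rhd> b i \<rhd> X3 \<rhd> X1"
          using E_Z[of a c] bV unfolding ac E_def Z_def by (simp add: act_mult)
        finally show "v \<rhd> b i \<rhd> X3 \<rhd> X1 = smul (?c GX3 i) (v \<rhd> b (shift1 GX3 i)) \<rhd> X1" ..
      qed (use bV in auto)
      with GX3 show ?thesis by simp
    next
      case GW
      have "v \<rhd> b i \<rhd> W = smul (?c GW i) (v \<rhd> b (shift1 GW i))"
      proof (rule act_inj_cancel[OF X2_inj])
        have "smul (?c GW i) (v \<rhd> b (shift1 GW i)) \<rhd> X2 = smul (A ^ a * wt k3 k4 c) (v \<rhd> b i)"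
          using bV unfolding act_smul[OF bV] gen2[OF shift_I[OF i]] unfolding ac by (simp add: M)
        also have "A ^ a * wt k3 k4 c = A ^ a * \<xi> + \<tau> * (A ^ a * q ^ c * k3)"
        proof -
          have "wt k3 k4 c = k4 - \<tau> * (1 - q ^ c) * k3" by (simp add: wt_def)
          then show ?thesis unfolding k4_def by (simp add: algebra_simps diff_divide_distrib)
        qed
        also have "smul \<dots> (v \<rhd> b i) = v \<rhd> b i \<rhd> W \<rhd> X2"
          using act_W_X2_eigen[OF bV, of i] E_xt[of a c] E_Z[of a c] unfolding ac E_def by simp
        finally show "v \<rhd> b i \<rhd> W \<rhd> X2 = smul (?c GW i) (v \<rhd> b (shift1 GW i)) \<rhd> X2" ..
      qed (use bV in auto)
      with GW show ?thesis by simp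
    qed (use gen1 gen2[OF i] in simp_all)
  qed
  have k4: "k4 \<noteq> \<tau> * k3" using \<xi>0 by (simp add: k4_def)
  have "rmodule_iso (alg_B r s) N (basis_module ?I (act_M1 r s (k1, k2, k3, k4)))"
  proof (rule iso_monomial[where \<sigma> = shift1 and c = ?c and j = "(0, 0)" and b = b])
    show "basis_rep r s ?I (act_M1 r s (k1, k2, k3, k4))" by (rule basis_rep_M1[OF k10 k20])
    show "simple_right_module (alg_B r s) (basis_module ?I (act_M1 r s (k1, k2, k3, k4)))"
      using simple_M1[OF k10 k20 k30 k4] by (simp only: mod_M1_def)
    show "v \<rhd> b (0, 0) \<noteq> \<zero>\<^bsub>N\<^esub>" using v by (simp add: b_def)
    show "act_M1 r s (k1, k2, k3, k4) g i = single (shift1 g i) (?c g i)" for g i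
      by (cases i) (simp only: act_M1_eq)
  qed (use v gen l1_pos m_pos in \<open>simp_all add: m1_eq\<close>)
  then have "rmodule_iso (alg_B r s) N (mod_M1 r s (k1, k2, k3, k4))" by (simp only: mod_M1_def)
  moreover have "(k1, k2, k3, k4) \<in> params_M1 r s"
    unfolding params_M1_def q_def[symmetric] \<gamma>_def[symmetric] using k10 k20 k30 k4 by simp
  ultimately show ?thesis by blast
qed

text \<open>The exponent \<open>m2\<close> depends on the eigenvalue \<open>u3\<close> of \<open>W\<^bsup>m2\<^esup>\<close> that is to be found. So the first
  attempt uses an exponent \<open>p\<close> that is right unless \<open>u3 = 0\<close> and \<open>p = 2m\<close>; in that case \<open>W\<^sup>m\<close> is
  nilpotent on \<open>v\<close>, and \<open>v\<close> or \<open>v W\<^sup>m\<close> is killed by it.\<close>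

lemma obtain_M2_vector:
  assumes "\<not> act_inj X2"
  obtains v u2 \<omega> u3 where "v \<in> V" "v \<noteq> \<zero>\<^bsub>N\<^esub>" "v \<rhd> X2 = \<zero>\<^bsub>N\<^esub>" "v \<rhd> Z = smul u2 v"
    "v \<rhd> X1 ^ L = smul \<omega> v" "v \<rhd> W ^ m2 r s u3 = smul u3 v"
proof -
  define R where "R = r ^ (2 * L)"
  define p where "p = (if R ^ m = 1 then m else 2 * m)"
  have p: "p > 0" "q ^ p = 1" using m_pos by (simp_all add: p_def q_power_m mult.commute[of 2] power_mult)
  have "(R ^ m) ^ 2 = 1"
    using power_2Lm(1) unfolding R_def power_mult[symmetric] by (simp add: mult_ac)
  then have Rp: "R ^ p = 1" by (simp add: p_def mult.commute[of 2] power_mult)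
  obtain n where n: "n > 0" "r ^ n = 1" "s ^ n = 1" by (rule common_exponent)
  obtain c2 where c2: "\<And>v. v \<in> V \<Longrightarrow> v \<rhd> Z ^ n = smul c2 v" using scalar_of_power[of Z n] n by blast
  obtain c3 where c3: "\<And>v. v \<in> V \<Longrightarrow> v \<rhd> (W ^ p) ^ n = smul c3 v"
    using scalar_of_power_power[of W p n] n p(1) by blast
  obtain c4 where c4: "\<And>v. v \<in> V \<Longrightarrow> v \<rhd> (X1 ^ L) ^ n = smul c4 v"
    using scalar_of_power_power[of X1 L n] n L_pos by blast
  have q0: "qc ((s\<^sup>2) ^ L) (X1 ^ L) X2" by (rule qcommute_power_left[OF qc_gens_sym(2)])
  have q1: "qc 1 Z (X1 ^ L)"
    using qcommute_power_right[OF qc_Z(1), of L] by (simp add: power_divide A_power_L)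
  have q2: "qc 1 (W ^ p) X2" by (rule qc_W_power_X2[OF p])
  have q3: "qc 1 Z (W ^ p)" using qcommute_power_right[OF qc_Z(4), of p] p by simp
  have X1W: "qc (R ^ k) (X1 ^ L) (W ^ k)" for k
  proof -
    have "((r\<^sup>2) ^ L) ^ k = R ^ k" by (simp add: R_def power_mult)
    then show ?thesis
      using qcommute_power_right[OF qcommute_power_left[OF qc_gens_sym(1), of L], of k] by simp
  qed
  have q4: "qc 1 (X1 ^ L) (W ^ p)" using X1W[of p] Rp by simp
  let ?H0 = "{v \<in> V. v \<rhd> X2 = \<zero>\<^bsub>N\<^esub>}"
  note st0 = stable_kernel[OF stable_V, of _ _ X2]
  obtain v0 where v0: "v0 \<in> ?H0" "v0 \<noteq> \<zero>\<^bsub>N\<^esub>" using assms by (auto simp: act_inj_def)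
  obtain v1 u2 where v1: "v1 \<in> ?H0" "v1 \<noteq> \<zero>\<^bsub>N\<^esub>" "v1 \<rhd> Z = smul u2 v1"
  proof (rule stable_eigenvector[OF st0[OF qc_Z(3)] n(1) v0])
    show "v0 \<rhd> Z ^ n = smul c2 v0" using v0 c2 by blast
  qed
  let ?H1 = "{v \<in> ?H0. v \<rhd> Z = smul u2 v}"
  note st1 = stable_eigenspace[OF st0, of _ _ Z u2]
  obtain v2 \<omega> where v2: "v2 \<in> ?H1" "v2 \<noteq> \<zero>\<^bsub>N\<^esub>" "v2 \<rhd> X1 ^ L = smul \<omega> v2"
  proof (rule stable_eigenvector[OF st1[OF q0 q1] n(1) _ v1(2)])
    show "v1 \<in> ?H1" using v1 by blast
    show "v1 \<rhd> (X1 ^ L) ^ n = smul c4 v1" using v1 c4 by blast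
  qed
  note st2 = stable_eigenspace[OF st1, of _ _ "X1 ^ L" \<omega>]
  obtain v u3 where v': "v \<in> {v \<in> ?H1. v \<rhd> X1 ^ L = smul \<omega> v}" "v \<noteq> \<zero>\<^bsub>N\<^esub>" "v \<rhd> W ^ p = smul u3 v"
  proof (rule stable_eigenvector[OF st2[OF q2 q3 q4] n(1) _ v2(2)])
    show "v2 \<in> {v \<in> ?H1. v \<rhd> X1 ^ L = smul \<omega> v}" using v2 by blast
    show "v2 \<rhd> (W ^ p) ^ n = smul c3 v2" using v2 c3 by blast
  qed
  have v: "v \<in> V" "v \<noteq> \<zero>\<^bsub>N\<^esub>" "v \<rhd> X2 = \<zero>\<^bsub>N\<^esub>" "v \<rhd> Z = smul u2 v" "v \<rhd> X1 ^ L = smul \<omega> v"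
    using v' by blast+
  show ?thesis
  proof (cases "R ^ m = 1 \<or> u3 \<noteq> 0")
    case True
    then have "m2 r s u3 = p" by (auto simp: m2_eq p_def R_def)
    with v v'(3) show ?thesis using that by metis
  next
    case False
    then have m2: "m2 r s 0 = m" and Wm: "v \<rhd> W ^ m \<rhd> W ^ m = \<zero>\<^bsub>N\<^esub>"
      using v'(3) v(1) by (auto simp: m2_eq p_def mult_2 power_add act_mult)
    show ?thesis
    proof (cases "v \<rhd> W ^ m = \<zero>\<^bsub>N\<^esub>")
      case True
      then show ?thesis using that[of v u2 \<omega> 0] v by (simp add: m2)
    next
      case False
      \<comment> \<open>The replacement vector v W^m has to keep the other properties: W^m commutes
        with X2 and Z, and changes the eigenvalue of X1^L by the factor 1 / R^m only.\<close>
      have "v \<rhd> W ^ m \<rhd> X2 = \<zero>\<^bsub>N\<^esub>"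
        using act_qc[OF qc_W_power_X2[OF m_pos q_power_m] v(1)] v by simp
      moreover have "qc 1 (W ^ m) Z"
        using qcommute_power_left[OF qcommute_sym[OF qc_Z(4)], of m] by (simp add: power_divide q_power_m)
      then have "v \<rhd> W ^ m \<rhd> Z = smul u2 (v \<rhd> W ^ m)" using act_qc[OF _ v(1)] v by simp
      moreover have "R ^ m \<noteq> 0" by (simp add: R_def)
      then have "v \<rhd> W ^ m \<rhd> X1 ^ L = smul (1 / R ^ m * \<omega>) (v \<rhd> W ^ m)"
        using act_qc[OF qcommute_sym[OF X1W[of m]] v(1)] v by simp
      ultimately show ?thesis
        using that[of "v \<rhd> W ^ m" u2 "1 / R ^ m * \<omega>" 0] False Wm v(1) by (simp add: m2)
    qed
  qed
qed

text \<open>The vector for e(0,0) is taken in the kernel of X2 and moved by X1 and W. The action of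
  X2 on higher vectors follows from W X2 = xt + \<tau> Z, that of X3 by cancelling X1.\<close>

lemma iso_M2:
  assumes "\<not> act_inj X2"
  shows "\<exists>u\<in>params_M2. rmodule_iso (alg_B r s) N (mod_M2 r s u)"
proof -
  obtain v u2 \<omega> u3 where v: "v \<in> V" "v \<noteq> \<zero>\<^bsub>N\<^esub>" "v \<rhd> X2 = \<zero>\<^bsub>N\<^esub>" "v \<rhd> Z = smul u2 v"
    "v \<rhd> X1 ^ L = smul \<omega> v" "v \<rhd> W ^ m2 r s u3 = smul u3 v"
    using obtain_M2_vector[OF assms] .
  let ?n = "m2 r s u3"
  have u20: "u2 \<noteq> 0" by (rule eigenvalue_nonzero[OF Z_inj v(1,2,4)])
  have \<omega>0: "\<omega> \<noteq> 0" by (rule eigenvalue_nonzero[OF act_inj_power[OF X1_inj] v(1,2,5)])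
  obtain u1 where u1: "u1 ^ L = \<omega>" using complex_root_exists[OF L_pos] .
  have u10: "u1 \<noteq> 0" using u1 \<omega>0 L_pos by auto
  \<comment> \<open>Read off from 0 = v X2 W = v xt + \<tau> q (v Z), so \<open>v\<close> is
    automatically an eigenvector of \<open>xt\<close>.\<close>
  define \<xi> where "\<xi> = - (\<tau> * q * u2)"
  have v_xt: "v \<rhd> xt = smul \<xi> v"
  proof -
    have "v \<rhd> xt \<oplus>\<^bsub>N\<^esub> smul (\<tau> * q * u2) v = \<zero>\<^bsub>N\<^esub>"
      using act_X2_W[OF v(1)] v by simp
    then have "v \<rhd> xt \<oplus>\<^bsub>N\<^esub> smul (\<tau> * q * u2) v = smul \<xi> v \<oplus>\<^bsub>N\<^esub> smul (\<tau> * q * u2) v"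
      using v(1) unfolding \<xi>_def by (simp flip: smul_add)
    then show ?thesis using v(1) by simp
  qed
  \<comment> \<open>Only X1 is normalized by a root. W advances with coefficient 1 and its wrap
    carries the whole eigenvalue \<open>u3\<close>, which may be zero.\<close>
  define b where "b i = (case i of (a, b) \<Rightarrow> free_const (1 / u1 ^ a) * (X1 ^ a * W ^ b))" for i :: "nat \<times> nat"
  define E where "E a c = v \<rhd> b (a, c)" for a c
  have E_eq: "E a c = smul (1 / u1 ^ a) (v \<rhd> X1 ^ a \<rhd> W ^ c)" for a c
    using v(1) by (simp add: E_def b_def act_const_mult act_mult flip: smul_def)
  have E_closed: "E a c \<in> V" for a c using v(1) by (simp add: E_def)
  have E_mod: "E (a mod L) c = E a c" for a c
  proof -
    have "E (L * k + d) c = E d c" for k d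
    proof (induction k)
      case (Suc k)
      have "L * Suc k + d = L + (L * k + d)" by simp
      then have "E (L * Suc k + d) c =
          smul (1 / u1 ^ (L + (L * k + d))) (v \<rhd> X1 ^ L \<rhd> X1 ^ (L * k + d) \<rhd> W ^ c)"
        using v(1) by (simp only: E_eq power_add act_mult)
      also have "\<dots> = E (L * k + d) c"
        using v(1) \<omega>0 unfolding E_eq power_add[of u1 L] u1 v(5) by simp
      finally show ?case using Suc by simp
    qed simp
    from this[of "a div L" "a mod L"] show ?thesis by simp
  qed
  have E_W: "E a c \<rhd> W = E a (Suc c)" for a c
    using v(1) unfolding E_eq power_Suc2 by (simp add: act_mult)
  have E_n: "E a ?n = smul ((r ^ (2 * ?n)) ^ a * u3) (E a 0)" for a
  proof -
    have "qc ((r\<^sup>2) ^ a) (X1 ^ a) W" by (rule qcommute_power_left[OF qc_gens_sym(1)])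
    then have "qc (((r\<^sup>2) ^ a) ^ ?n) (X1 ^ a) (W ^ ?n)" by (rule qcommute_power_right)
    then have "v \<rhd> X1 ^ a \<rhd> W ^ ?n = smul (((r\<^sup>2) ^ a) ^ ?n) (v \<rhd> W ^ ?n \<rhd> X1 ^ a)"
      by (rule act_qc[OF _ v(1)])
    also have "((r\<^sup>2) ^ a) ^ ?n = (r ^ (2 * ?n)) ^ a"
      unfolding power_mult[symmetric] by (rule arg_cong[of _ _ "power r"]) simp
    finally show ?thesis using v(1) unfolding E_eq v(6) by (simp add: mult_ac)
  qed
  have E_X1: "E a c \<rhd> X1 = smul (u1 / (r\<^sup>2) ^ c) (E (Suc a) c)" for a c
  proof -
    have "qc (1 / (r\<^sup>2) ^ c) (W ^ c) X1"
      using qcommute_power_left[OF qc_gens(1), of c] by (simp add: power_divide)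
    then have "v \<rhd> X1 ^ a \<rhd> W ^ c \<rhd> X1 = smul (1 / (r\<^sup>2) ^ c) (v \<rhd> X1 ^ a \<rhd> X1 \<rhd> W ^ c)"
      using v(1) by (simp add: act_qc)
    then show ?thesis using v(1) u10 unfolding E_eq power_Suc2 by (simp add: act_mult mult.commute)
  qed
  have E_xt: "E a c \<rhd> xt = smul (A ^ a * \<xi>) (E a c)" for a c
  proof -
    have "qc (A ^ a) (X1 ^ a) xt" using qcommute_power_left[OF qcommute_sym[OF qc_xt(1)], of a] by simp
    moreover have "qc 1 (W ^ c) xt" using qcommute_power_left[OF qcommute_sym[OF qc_xt(4)], of c] by simp
    ultimately show ?thesis using v(1) v_xt unfolding E_eq by (simp add: act_qc mult_ac)
  qed
  have E_Z: "E a c \<rhd> Z = smul (A ^ a / q ^ c * u2) (E a c)" for a c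
  proof -
    have "qc (A ^ a) (X1 ^ a) Z" using qcommute_power_left[OF qcommute_sym[OF qc_Z(1)], of a] by simp
    moreover have "qc (1 / q ^ c) (W ^ c) Z"
      using qcommute_power_left[OF qcommute_sym[OF qc_Z(4)], of c] by (simp add: power_divide)
    ultimately show ?thesis using v(1,4) unfolding E_eq by (simp add: act_qc mult_ac)
  qed
  have E_X2_0: "E a 0 \<rhd> X2 = \<zero>\<^bsub>N\<^esub>" for a
    using act_qc[OF qcommute_power_left[OF qc_gens_sym(2), of a] v(1)] v(1,3) unfolding E_eq by simp
  have E_X2_Suc: "E a (Suc c) \<rhd> X2 = smul (A ^ a * wt' (Suc c) * u2) (E a c)" for a c
  proof -
    have "E a c \<rhd> W \<rhd> X2 = smul (A ^ a * \<xi> + \<tau> * (A ^ a / q ^ c * u2)) (E a c)"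
      by (rule act_W_X2_eigen[OF E_closed E_xt E_Z])
    moreover have "1 / q \<noteq> 1" using q_neq_one by simp
    then have "\<gamma> / (1 - 1 / q) = - (\<tau> * q)" using q_neq_one by (simp add: field_simps)
    then have "A ^ a * \<xi> + \<tau> * (A ^ a / q ^ c * u2) = A ^ a * wt' (Suc c) * u2"
      unfolding wt'_Suc_eq \<xi>_def by (simp only:) (simp add: algebra_simps)
    ultimately show ?thesis by (simp only: E_W)
  qed
  let ?I = "{..<l2 r s} \<times> {..<?n}"
  let ?c = "coef2 u1 u2 u3"
  have gen1: "v \<rhd> b i \<rhd> X1 = smul (?c GX1 i) (v \<rhd> b (shift2 u3 GX1 i))" for i
    by (cases i) (simp add: shift2_def coef2_def E_X1 E_mod flip: E_def)
  have bV: "v \<rhd> b i \<in> V" for i using v(1) by simp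
  have gen: "v \<rhd> b i \<rhd> free_gen g = smul (?c g i) (v \<rhd> b (shift2 u3 g i))" if i: "i \<in> ?I" for i g
  proof -
    obtain a c where ac: "i = (a, c)" "a < L" "c < ?n" using i by (auto simp: l2_eq)
    note M = M2_products[OF ac(2,3) u10 u20]
    show ?thesis
    proof (cases g)
      case GX3
      have "v \<rhd> b i \<rhd> X3 = smul (?c GX3 i) (v \<rhd> b (shift2 u3 GX3 i))"
      proof (rule act_inj_cancel[OF X1_inj])
        have "smul (?c GX3 i) (v \<rhd> b (shift2 u3 GX3 i)) \<rhd> X1 = smul (A ^ a / q ^ c * u2) (v \<rhd> b i)"
          using bV unfolding act_smul[OF bV] gen1 ac by (simp add: M)
        also have "\<dots> = v \<rhd> b i \<rhd> X3 \<rhd> X1"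
          using E_Z[of a c] bV unfolding ac E_def Z_def by (simp add: act_mult)
        finally show "v \<rhd> b i \<rhd> X3 \<rhd> X1 = smul (?c GX3 i) (v \<rhd> b (shift2 u3 GX3 i)) \<rhd> X1" ..
      qed (use bV in auto)
      with GX3 show ?thesis by simp
    next
      case GX2
      show ?thesis
      proof (cases c)
        case 0
        then show ?thesis using E_X2_0[of a] E_closed unfolding GX2 ac by (simp add: shift2_def coef2_def flip: E_def)
      next
        case (Suc c')
        then show ?thesis using E_X2_Suc[of a c'] unfolding GX2 ac by (simp add: shift2_def coef2_def flip: E_def)
      qed
    next
      case GW
      show ?thesis
      proof (cases "c = ?n - 1")
        case True
        then have "Suc c = ?n" using m2_gt_2[of u3] by simp
        with True show ?thesis unfolding GW ac
          using E_W[of a c] E_n[of a] by (simp add: shift2_def coef2_def flip: E_def)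
      next
        case False
        then show ?thesis unfolding GW ac
          using E_W[of a c] E_closed by (simp add: shift2_def coef2_def flip: E_def)
      qed
    qed (use gen1 in simp_all)
  qed
  have "rmodule_iso (alg_B r s) N (basis_module ?I (act_M2 r s (u1, u2, u3)))"
  proof (rule iso_monomial[where \<sigma> = "shift2 u3" and c = ?c and j = "(0, 0)" and b = b])
    show "basis_rep r s ?I (act_M2 r s (u1, u2, u3))" by (rule basis_rep_M2[OF u10 u20])
    show "simple_right_module (alg_B r s) (basis_module ?I (act_M2 r s (u1, u2, u3)))"
      using simple_M2[OF u10 u20, of u3] by (simp only: mod_M2_def snd_conv)
    show "v \<rhd> b (0, 0) \<noteq> \<zero>\<^bsub>N\<^esub>" using v by (simp add: b_def)
    show "act_M2 r s (u1, u2, u3) g i = single (shift2 u3 g i) (?c g i)" for g i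
      by (cases i) (simp only: act_M2_eq)
    show "(0, 0) \<in> ?I" using L_pos m2_gt_2[of u3] by (simp add: l2_eq)
  qed (use v gen in simp_all)
  then have "rmodule_iso (alg_B r s) N (mod_M2 r s (u1, u2, u3))" by (simp only: mod_M2_def snd_conv)
  moreover have "(u1, u2, u3) \<in> params_M2" using u10 u20 by (simp add: params_M2_def)
  ultimately show ?thesis by blast
qed

text \<open>Being normal, \<open>xt\<close> is injective or zero on the simple module. If it is
  injective, the kernel of X2 separates the first type from the second; if it is zero, the third
  applies.\<close>

lemma trichotomy:
  "(\<exists>k\<in>params_M1 r s. rmodule_iso (alg_B r s) N (mod_M1 r s k)) \<or>
   (\<exists>u\<in>params_M2. rmodule_iso (alg_B r s) N (mod_M2 r s u)) \<or>
   (\<exists>e\<in>params_M3. rmodule_iso (alg_B r s) N (mod_M3 r s e))"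
proof (cases "act_inj xt")
  case True
  then show ?thesis using iso_M1 iso_M2 by blast
next
  case False
  then obtain v where v: "v \<in> V" "v \<noteq> \<zero>\<^bsub>N\<^esub>" "v \<rhd> xt = \<zero>\<^bsub>N\<^esub>" by (auto simp: act_inj_def)
  have "\<exists>c. qc c (free_gen g) xt" for g
    by (cases g) (use qc_xt[THEN qcommute_sym] in auto)
  then have "\<exists>c. class_B r s (free_gen g * xt) = class_B r s (free_const c * (xt * free_gen g))" for g
    by (simp only: qcommute_def)
  then have "w \<rhd> xt = \<zero>\<^bsub>N\<^esub>" if "w \<in> V" for w using normal_kernel[OF _ v that] by blast
  then show ?thesis using iso_M3 by blast
qed

end

section \<open>Torsion in the three families\<close>

lemma rmodule_iso_torsion:
  assumes "right_module R M" "right_module R N" "rmodule_iso R M N" "x \<in> carrier R"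
  shows "torsion R M x \<longleftrightarrow> torsion R N x"
proof -
  interpret M: right_module R M by fact
  interpret N: right_module R N by fact
  have pow: "x [^]\<^bsub>R\<^esub> (k::nat) \<in> carrier R" for k using assms(4) by simp
  obtain f where f: "bij_betw f (carrier M) (carrier N)"
    "\<And>v w. v \<in> carrier M \<Longrightarrow> w \<in> carrier M \<Longrightarrow> f (v \<oplus>\<^bsub>M\<^esub> w) = f v \<oplus>\<^bsub>N\<^esub> f w"
    "\<And>v a. v \<in> carrier M \<Longrightarrow> a \<in> carrier R \<Longrightarrow> f (v \<star>\<^bsub>M\<^esub> a) = f v \<star>\<^bsub>N\<^esub> a"
    using assms(3) unfolding rmodule_iso_def by blast
  have fN: "f v \<in> carrier N" if "v \<in> carrier M" for v using f(1) that by (auto simp: bij_betw_def)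
  have f0: "f \<zero>\<^bsub>M\<^esub> = \<zero>\<^bsub>N\<^esub>"
    using f(2)[of "\<zero>\<^bsub>M\<^esub>" "\<zero>\<^bsub>M\<^esub>"] fN[of "\<zero>\<^bsub>M\<^esub>"] by (simp add: N.M.add.l_cancel_one')
  have "f v \<star>\<^bsub>N\<^esub> (x [^]\<^bsub>R\<^esub> (k::nat)) = \<zero>\<^bsub>N\<^esub> \<longleftrightarrow> v \<star>\<^bsub>M\<^esub> (x [^]\<^bsub>R\<^esub> k) = \<zero>\<^bsub>M\<^esub>"
    if v: "v \<in> carrier M" for v k
  proof -
    have "f (v \<star>\<^bsub>M\<^esub> (x [^]\<^bsub>R\<^esub> k)) = f \<zero>\<^bsub>M\<^esub> \<longleftrightarrow> v \<star>\<^bsub>M\<^esub> (x [^]\<^bsub>R\<^esub> k) = \<zero>\<^bsub>M\<^esub>"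
      using f(1) M.ract_closed[OF v pow] by (auto simp: bij_betw_def inj_on_eq_iff)
    then show ?thesis using f(3)[OF v pow] f0 by simp
  qed
  moreover have "carrier N = f ` carrier M" using f(1) by (auto simp: bij_betw_def)
  ultimately show ?thesis by (simp add: torsion_def)
qed

context alg_B_module
begin

lemma torsion_iff: "torsion (alg_B r s) N (class_B r s p) \<longleftrightarrow> (\<forall>v\<in>V. \<exists>k. v \<rhd> p ^ k = \<zero>\<^bsub>N\<^esub>)"
  by (simp add: torsion_def act_def class_B_pow)

lemma torsionfree_imp_act_inj:
  assumes "torsionfree (alg_B r s) N (class_B r s p)" shows "act_inj p"
  unfolding act_inj_def
proof (intro ballI impI)
  fix v assume "v \<in> V" "v \<rhd> p = \<zero>\<^bsub>N\<^esub>"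
  then have "v \<star>\<^bsub>N\<^esub> (class_B r s p [^]\<^bsub>alg_B r s\<^esub> (1::nat)) = \<zero>\<^bsub>N\<^esub>"
    using class_B_pow[of r s p 1] by (simp add: act_def)
  with assms \<open>v \<in> V\<close> show "v = \<zero>\<^bsub>N\<^esub>" unfolding torsionfree_def by blast
qed

end

lemma (in simple_alg_B_module) torsionfree_imp_not_torsion:
  assumes "torsionfree (alg_B r s) N x" shows "\<not> torsion (alg_B r s) N x"
proof -
  obtain v where "v \<in> V" "v \<noteq> \<zero>\<^bsub>N\<^esub>" by (rule obtain_nonzero)
  with assms show ?thesis unfolding torsion_def torsionfree_def by blast
qed

lemma (in basis_rep) torsion_basis_module_iff:
  "torsion (alg_B r s) (basis_module I T) (class_B r s p) \<longleftrightarrow>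
    (\<forall>v. keys v \<subseteq> I \<longrightarrow> (\<exists>k. free_act T v (p ^ k) = 0))"
  by (auto simp: torsion_iff act_eq_free_act)

lemma (in basis_rep) not_torsion_of_eigenvector:
  assumes "i \<in> I" "free_act T (single i 1) p = single i c" "c \<noteq> 0"
  shows "\<not> torsion (alg_B r s) (basis_module I T) (class_B r s p)"
proof -
  have "free_act T (single i 1) (p ^ k) = single i (c ^ k)" for k
    using assms(2) by (rule free_act_power_diagonal)
  then have "free_act T (single i 1) (p ^ k) \<noteq> 0" for k
    using assms(3) by (metis lookup_single_eq lookup_zero power_not_zero)
  then show ?thesis using assms(1) unfolding torsion_basis_module_iff
    by (intro notI) (auto dest!: spec[of _ "single i 1"])
qed

context root_params
begin

lemma torsion_M1:
  assumes "k \<in> params_M1 r s"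
  shows "\<not> torsion (alg_B r s) (mod_M1 r s k) (Xtilde r s)"
    and "\<not> torsion (alg_B r s) (mod_M1 r s k) (gen_B r s GX2)"
proof -
  obtain k1 k2 k3 k4 where k: "k = (k1, k2, k3, k4)" "k1 \<noteq> 0" "k2 \<noteq> 0" "k3 \<noteq> 0" "k4 \<noteq> \<tau> * k3"
    using assms unfolding params_M1_def q_def[symmetric] \<gamma>_def[symmetric] by auto
  let ?T = "act_M1 r s (k1, k2, k3, k4)"
  interpret basis_rep r s "{..<l1 r s} \<times> {..<m1 r s}" ?T
    by (rule basis_rep_M1[OF k(2,3)])
  have I: "(0, 0) \<in> {..<l1 r s} \<times> {..<m1 r s}" using l1_pos m_pos by (simp add: m1_eq)
  show "\<not> torsion (alg_B r s) (mod_M1 r s k) (Xtilde r s)"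
    unfolding k(1) mod_M1_def Xtilde_eq
    by (rule not_torsion_of_eigenvector[OF I M1_xt[OF k(2-4) l1_pos m_pos]]) (use k(5) in simp)
  have "free_act ?T (single (0, 0) 1) (X2 ^ j) \<noteq> 0" for j
    using M1_X2_power_nonzero[OF k(2-4), of k4 j] by (metis lookup_single_eq lookup_zero)
  then show "\<not> torsion (alg_B r s) (mod_M1 r s k) (gen_B r s GX2)"
    using I unfolding k(1) mod_M1_def gen_B_def torsion_basis_module_iff
    by (intro notI) (auto dest!: spec[of _ "single (0, 0) 1"])
qed

lemma torsion_M2:
  assumes "u \<in> params_M2"
  shows "\<not> torsion (alg_B r s) (mod_M2 r s u) (Xtilde r s)"
    and "torsion (alg_B r s) (mod_M2 r s u) (gen_B r s GX2)"
proof -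
  obtain u1 u2 u3 where u: "u = (u1, u2, u3)" "u1 \<noteq> 0" "u2 \<noteq> 0"
    using assms unfolding params_M2_def by auto
  let ?T = "act_M2 r s (u1, u2, u3)" and ?I = "{..<l2 r s} \<times> {..<m2 r s u3}"
  interpret basis_rep r s ?I ?T by (rule basis_rep_M2[OF u(2,3)])
  have n: "0 < m2 r s u3" using m2_gt_2[of u3] by simp
  have I: "(0, 0) \<in> ?I" using L_pos n by (simp add: l2_eq)
  have "1 / q \<noteq> 1" using q_neq_one by simp
  then show "\<not> torsion (alg_B r s) (mod_M2 r s u) (Xtilde r s)"
    unfolding u(1) mod_M2_def snd_conv Xtilde_eq
    by (intro not_torsion_of_eigenvector[OF I M2_xt[OF u(2,3) L_pos n]]) (use u(3) in simp)
  have "free_act ?T (single i 1) (X2 ^ m2 r s u3) = 0" if "i \<in> ?I" for i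
    using that M2_X2_power[OF u(2,3)] by auto
  then have "free_act ?T v (X2 ^ m2 r s u3) = 0" if "keys v \<subseteq> ?I" for v
    using free_act_eq_zero_of_basis that by blast
  then show "torsion (alg_B r s) (mod_M2 r s u) (gen_B r s GX2)"
    unfolding u(1) mod_M2_def snd_conv gen_B_def torsion_basis_module_iff by blast
qed

lemma torsion_M3:
  assumes "e \<in> params_M3"
  shows "torsion (alg_B r s) (mod_M3 r s e) (Xtilde r s)"
proof -
  obtain e1 e2 e3 where e: "e = (e1, e2, e3)" "e1 \<noteq> 0" "e2 \<noteq> 0" "e3 \<noteq> 0"
    using assms unfolding params_M3_def by auto
  interpret basis_rep r s "{..<l3 r s}" "act_M3 r s (e1, e2, e3)" by (rule basis_rep_M3[OF e(2-4)])
  have "free_act (act_M3 r s (e1, e2, e3)) v (xt ^ 1) = 0" if "keys v \<subseteq> {..<l3 r s}" for v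
    using free_act_eq_zero_of_basis[of "{..<l3 r s}" "act_M3 r s (e1, e2, e3)" xt v] M3_xt[OF e(2-4)] that
    by simp
  then show ?thesis unfolding e(1) mod_M3_def Xtilde_eq torsion_basis_module_iff by blast
qed

lemma simple_modules:
  shows "k \<in> params_M1 r s \<Longrightarrow> simple_right_module (alg_B r s) (mod_M1 r s k)"
    and "u \<in> params_M2 \<Longrightarrow> simple_right_module (alg_B r s) (mod_M2 r s u)"
    and "e \<in> params_M3 \<Longrightarrow> simple_right_module (alg_B r s) (mod_M3 r s e)"
  unfolding params_M1_def params_M2_def params_M3_def q_def[symmetric] \<gamma>_def[symmetric]
  by (auto intro: simple_M1 simple_M2 simple_M3)

end

lemma torsion_transfer:
  assumes "simple_right_module (alg_B r s) N" "simple_right_module (alg_B r s) M"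
    and "rmodule_iso (alg_B r s) N M"
  shows "torsion (alg_B r s) N (Xtilde r s) \<longleftrightarrow> torsion (alg_B r s) M (Xtilde r s)"
    and "torsion (alg_B r s) N (gen_B r s g) \<longleftrightarrow> torsion (alg_B r s) M (gen_B r s g)"
  using rmodule_iso_torsion[of "alg_B r s" N M] assms
  by (simp_all add: simple_right_module_def Xtilde_def gen_B_def)

theorem theorem6p1:
  fixes r s :: complex and N :: "(free_alg set, 'v) rmodule"
  assumes "r \<noteq> 0" and "s \<noteq> 0"
    and "\<exists>n::nat. n > 0 \<and> r ^ n = 1" and "\<exists>n::nat. n > 0 \<and> s ^ n = 1"
    and "r^2 \<noteq> s^2"
    and "simple_right_module (alg_B r s) N"
    and "torsionfree (alg_B r s) N (gen_B r s GX1)"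
    and "torsionfree (alg_B r s) N (gen_B r s GX3)"
  shows
    "(\<forall>k\<in>params_M1 r s. simple_right_module (alg_B r s) (mod_M1 r s k)) \<and>
     (\<forall>u\<in>params_M2. simple_right_module (alg_B r s) (mod_M2 r s u)) \<and>
     (\<forall>e\<in>params_M3. simple_right_module (alg_B r s) (mod_M3 r s e)) \<and>
     (let type1 = (\<exists>k\<in>params_M1 r s. rmodule_iso (alg_B r s) N (mod_M1 r s k));
          type2 = (\<exists>u\<in>params_M2. rmodule_iso (alg_B r s) N (mod_M2 r s u));
          type3 = (\<exists>e\<in>params_M3. rmodule_iso (alg_B r s) N (mod_M3 r s e))
      in (type1 \<or> type2 \<or> type3) \<and>
         \<not> (type1 \<and> type2) \<and> \<not> (type1 \<and> type3) \<and> \<not> (type2 \<and> type3) \<and>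
         (torsionfree (alg_B r s) N (Xtilde r s) \<and> torsionfree (alg_B r s) N (gen_B r s GX2)
            \<longrightarrow> type1) \<and>
         (torsionfree (alg_B r s) N (Xtilde r s) \<and> torsion (alg_B r s) N (gen_B r s GX2)
            \<longrightarrow> type2) \<and>
         (torsion (alg_B r s) N (Xtilde r s) \<longrightarrow> type3))"
proof -
  have N: "right_module (alg_B r s) N" using assms(6) by (simp add: simple_right_module_def)
  interpret root_params r s using assms(1-5) by unfold_locales
  interpret simple_alg_B_module r s N
    by (intro simple_alg_B_module.intro alg_B_module.intro simple_alg_B_module_axioms.intro N assms(6))
  interpret classification r s N
    using assms(7,8) torsionfree_imp_act_inj unfolding gen_B_def by unfold_locales blast+
  let ?type1 = "\<exists>k\<in>params_M1 r s. rmodule_iso (alg_B r s) N (mod_M1 r s k)"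
  let ?type2 = "\<exists>u\<in>params_M2. rmodule_iso (alg_B r s) N (mod_M2 r s u)"
  let ?type3 = "\<exists>e\<in>params_M3. rmodule_iso (alg_B r s) N (mod_M3 r s e)"
  let ?tX = "torsion (alg_B r s) N (Xtilde r s)" and ?t2 = "torsion (alg_B r s) N (gen_B r s GX2)"
  note transfer = torsion_transfer[OF assms(6)]
  \<comment> \<open>Torsion of X-tilde and X2 is invariant under isomorphism and contradictory
    between any two types. Together with exhaustiveness this gives the uniqueness of the type, and
    each implication follows by excluding the two other types.\<close>
  have 1: "\<not> ?tX \<and> \<not> ?t2" if ?type1
    using that torsion_M1 transfer[OF simple_modules(1)] by blast
  have 2: "\<not> ?tX \<and> ?t2" if ?type2
    using that torsion_M2 transfer[OF simple_modules(2)] by blast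
  have 3: "?tX" if ?type3
    using that torsion_M3 transfer[OF simple_modules(3)] by blast
  have "(?type1 \<or> ?type2 \<or> ?type3) \<and>
      \<not> (?type1 \<and> ?type2) \<and> \<not> (?type1 \<and> ?type3) \<and> \<not> (?type2 \<and> ?type3) \<and>
      (torsionfree (alg_B r s) N (Xtilde r s) \<and> torsionfree (alg_B r s) N (gen_B r s GX2) \<longrightarrow> ?type1) \<and>
      (torsionfree (alg_B r s) N (Xtilde r s) \<and> ?t2 \<longrightarrow> ?type2) \<and> (?tX \<longrightarrow> ?type3)"
    using trichotomy 1 2 3 torsionfree_imp_not_torsion by blast
  then show ?thesis unfolding Let_def using simple_modules by blast
qed

end
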